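(* For any $u\in\mathcal{L}PSH(\mathbb{C})$, $c_\infty(u)=\hat c_\infty(u)=1/\sigma_u$. Moreover, for any nonconstant $u\in\mathcal{L}PSH(\mathbb{C})$, \[ \{c>0:\ e^{-cu}\in L^2(\infty)\}=\{c>0:\ e^{-cu^+}\in L^2(\infty)\}=(1/\sigma_u,+\infty). \]
   Context: $\mathcal{L}PSH(\mathbb{C})$ is the class of subharmonic functions $u$ on $\mathbb{C}$ with finite logarithmic type $\sigma_u=\limsup_{|z|\to\infty}u(z)/\log|z|<\infty$. $g\in L^2(\infty)$ means there is a compact $K\subset\mathbb{C}$ with $\int_{\mathbb{C}\setminus K}|g|^2d\lambda<\infty$ ($d\lambda$ Lebesgue measure). $c_\infty(u)=\inf\{c>0:e^{-cu}\in L^2(\infty)\}$, $u^+=\max\{u,0\}$, and $\hat c_\infty(u)=c_\infty(u^+)=\inf\{c>0: e^{-cu^+}\in L^2(\mathbb{C})\}$; $\inf\emptyset=+\infty$, $1/0=+\infty$. *)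

theory Defs
  imports "HOL-Analysis.Analysis" "HOL-Library.Liminf_Limsup"
begin

(* Mean value of an ereal-valued function over the circle of centre z and radius r,
   computed as (integral of positive part) - (integral of negative part), divided by 2 pi. *)
definition circle_mean :: "(complex \<Rightarrow> ereal) \<Rightarrow> complex \<Rightarrow> real \<Rightarrow> ereal" where
  "circle_mean u z r =
     (enn2ereal (\<integral>\<^sup>+ t. indicator {0..2*pi} t * e2ennreal (u (z + complex_of_real r * cis t)) \<partial>lborel)
      - enn2ereal (\<integral>\<^sup>+ t. indicator {0..2*pi} t * e2ennreal (- u (z + complex_of_real r * cis t)) \<partial>lborel))
     / ereal (2*pi)"

definition subharmonic :: "(complex \<Rightarrow> ereal) \<Rightarrow> bool" where
  "subharmonic u \<longleftrightarrow>
     (\<forall>z. u z \<noteq> \<infinity>) \<and>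
     (\<forall>z a. u z < a \<longrightarrow> eventually (\<lambda>w. u w < a) (at z)) \<and>
     (\<exists>z. u z \<noteq> -\<infinity>) \<and>
     (\<forall>z. \<exists>r0>0. \<forall>r. 0 < r \<and> r < r0 \<longrightarrow> u z \<le> circle_mean u z r)"

definition log_type :: "(complex \<Rightarrow> ereal) \<Rightarrow> ereal" where
  "log_type u = Limsup at_infinity (\<lambda>z. u z / ereal (ln (cmod z)))"

definition LPSH :: "(complex \<Rightarrow> ereal) set" where
  "LPSH = {u. subharmonic u \<and> log_type u < \<infinity>}"

fun eexp :: "ereal \<Rightarrow> ennreal" where
  "eexp (ereal x) = ennreal (exp x)"
| "eexp PInfty = \<infinity>"
| "eexp MInfty = 0"

definition L2_infty :: "(complex \<Rightarrow> ennreal) \<Rightarrow> bool" where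
  "L2_infty g \<longleftrightarrow>
     (\<exists>K. compact K \<and> (\<integral>\<^sup>+ z. indicator (UNIV - K) z * (g z)\<^sup>2 \<partial>lborel) < \<infinity>)"

definition exps_L2 :: "(complex \<Rightarrow> ereal) \<Rightarrow> real set" where
  "exps_L2 u = {c. c > 0 \<and> L2_infty (\<lambda>z. eexp (- ereal c * u z))}"

definition c_infty :: "(complex \<Rightarrow> ereal) \<Rightarrow> ereal" where
  "c_infty u = Inf (ereal ` exps_L2 u)"

definition pos_part :: "(complex \<Rightarrow> ereal) \<Rightarrow> complex \<Rightarrow> ereal" where
  "pos_part u z = max (u z) 0"

definition c_infty_hat :: "(complex \<Rightarrow> ereal) \<Rightarrow> ereal" where
  "c_infty_hat u = c_infty (pos_part u)"

end

theory Submission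
  imports Defs "HOL-Complex_Analysis.Cauchy_Integral_Formula" "HOL-Probability.Probability_Measure"
begin

text \<open>
Write \<open>\<sigma>\<close> for the logarithmic type of \<open>u\<close>. The maximum principle on annuli gives
\<open>u\<^sup>+ \<le> \<sigma> log \<bar>z\<bar> + C\<close> for \<open>\<bar>z\<bar> \<ge> 1\<close>, so \<open>exp (- 2 c u\<^sup>+)\<close> dominates a multiple of
\<open>\<bar>z\<bar> powr - 2\<close> when \<open>c \<sigma> \<le> 1\<close> and is not integrable at infinity.

For \<open>c \<sigma> > 1\<close> no Riesz measure is needed: its role is played by the circle means \<open>M(z,t)\<close>, which
increase with \<open>t\<close>, are convex in \<open>log t\<close> and decrease to \<open>u z\<close> as \<open>t\<close> tends to \<open>0\<close>. The maximum
principle and a Harnack inequality give \<open>M(z,t) \<ge> (\<sigma> - \<epsilon>) log \<bar>z\<bar>\<close> already at the scale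
\<open>t = \<surd>\<bar>z\<bar>\<close>, if \<open>\<bar>z\<bar>\<close> is large. By convexity the increments \<open>d\<^sub>k = M(z,t/2^k) - M(z,t/2^(k+1))\<close>
are then uniformly small, while integrating them against a test function bounds their integral over
the annulus \<open>r \<le> \<bar>z\<bar> < 2r\<close> by a multiple of \<open>4^(-k)\<close>. Telescoping \<open>exp (2 c (d\<^sub>0 + \<dots> + d\<^sub>k))\<close>
bounds the integral of \<open>exp (- 2 c u)\<close> over the annulus by a multiple of
\<open>r powr (2 - 2 c (\<sigma> - \<epsilon>))\<close>, which is summable over \<open>r = 2^j\<close>. Everything is done for the
truncations \<open>max u (- n)\<close>, uniformly in \<open>n\<close>.
\<close>

section \<open>Uniform measure on the unit circle\<close>

text \<open>A term m ln |z - a| in u with c m \<ge> 1 would make exp (- 2 c u) non-integrable near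
  a, so such concentration has to be excluded far out. Between the radii s = sqrt r and |z| the mean
  gains at most (3/2) \<epsilon> ln |z|, while the logarithm of the radius gains at least half of ln
  |z|. By convexity every slope below the scale s is then at most 3 \<epsilon>, and each halving of
  the radius costs at most \<delta> = 3 \<epsilon> ln 2. If \<epsilon> is so small that exp (2 c
  \<delta>) \<le> 2, the weight 2^k of the k-th increment loses against 4^(-k). The square root
  scale also pays for crude estimates: its square is r instead of r^2, and the spare factor r
  absorbs the logarithm in the bound of order r^2 ln r for the L1 norm of K - u on a disc.
  Truncation makes every mean a finite integral. The constants must not depend on the level n, which
  is achieved by anchoring the lower bounds at one point p where u is finite.\<close>

definition circ :: "complex measure" where
  "circ = distr (uniform_measure lborel {0..2*pi}) borel cis"

lemma sets_circ [measurable_cong, simp]: "sets circ = sets borel"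
  by (simp add: circ_def)

lemma space_circ [simp]: "space circ = UNIV"
  by (simp add: circ_def)

lemma cis_borel_measurable [measurable]: "cis \<in> borel_measurable borel"
  by (intro borel_measurable_continuous_onI continuous_intros)

lemma prob_space_circ: "prob_space circ"
  unfolding circ_def
  by (intro prob_space.prob_space_distr prob_space_uniform_measure) auto

interpretation circ: prob_space circ
  by (rule prob_space_circ)

lemma nn_integral_circ:
  assumes [measurable]: "f \<in> borel_measurable borel"
  shows "nn_integral circ f = (\<integral>\<^sup>+t. indicator {0..2*pi} t * f (cis t) \<partial>lborel) / ennreal (2*pi)"
  unfolding circ_def
  by (subst nn_integral_distr)
     (auto simp: nn_integral_uniform_measure mult.commute)

lemma nn_integral_circ_scaled:
  assumes [measurable]: "f \<in> borel_measurable borel"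
  shows "(\<integral>\<^sup>+t. indicator {0..2*pi} t * f (cis t) \<partial>lborel) = ennreal (2*pi) * nn_integral circ f"
  using ennreal_mult_divide_eq[of "ennreal (2*pi)" "\<integral>\<^sup>+t. indicator {0..2*pi} t * f (cis t) \<partial>lborel"]
  by (simp add: nn_integral_circ ennreal_times_divide mult.commute[of "ennreal (2*pi)"])

lemma AE_circ: "AE y in circ. cmod y = 1"
  unfolding circ_def by (subst AE_distr_iff) (auto intro!: AE_I2)

text \<open>Rotation shifts the angular window to [p, 2 pi + p]. The part beyond 2 pi is brought
  back by periodicity of \<open>cis\<close>, and the change of half-open ends touches only null
  sets.\<close>

lemma nn_integral_circ_rotate_cis:
  assumes [measurable]: "f \<in> borel_measurable borel" and p: "0 \<le> p" "p \<le> 2*pi"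
  shows "(\<integral>\<^sup>+y. f (cis p * y) \<partial>circ) = nn_integral circ f"
proof -
  have a: "(\<integral>\<^sup>+t. indicator {0..2*pi} t * f (cis p * cis t) \<partial>lborel) =
        (\<integral>\<^sup>+t. indicator {p..2*pi+p} t * f (cis t) \<partial>lborel)"
    by (subst nn_integral_real_affine[where c=1 and t="-p"])
       (auto intro!: nn_integral_cong simp: cis_mult indicator_def split: if_splits)
  have b: "(\<integral>\<^sup>+t. indicator {2*pi<..2*pi+p} t * f (cis t) \<partial>lborel) = 
      (\<integral>\<^sup>+t. indicator {0<..p} t * f (cis t) \<partial>lborel)"
    by (subst nn_integral_real_affine[where c=1 and t="2*pi"])
       (auto intro!: nn_integral_cong simp: cis_mult[symmetric] indicator_def split: if_splits)
  have c: "(\<integral>\<^sup>+t. indicator {0<..p} t * f (cis t) \<partial>lborel) = (\<integral>\<^sup>+t. indicator {0..<p} t * f (cis t) \<partial>lborel)"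
    using AE_lborel_singleton[of 0] AE_lborel_singleton[of p]
    by (intro nn_integral_cong_AE) (auto simp: indicator_def)
  have "(\<integral>\<^sup>+t. indicator {p..2*pi+p} t * f (cis t) \<partial>lborel) = 
     (\<integral>\<^sup>+t. indicator {p..2*pi} t * f (cis t) + indicator {2*pi<..2*pi+p} t * f (cis t) \<partial>lborel)"
    using p by (auto intro!: nn_integral_cong simp: indicator_def)
  also have "\<dots> = (\<integral>\<^sup>+t. indicator {p..2*pi} t * f (cis t) \<partial>lborel) + (\<integral>\<^sup>+t. indicator {0..<p} t * f (cis t) \<partial>lborel)"
    using b c by (subst nn_integral_add) auto
  also have "\<dots> = (\<integral>\<^sup>+t. indicator {p..2*pi} t * f (cis t) + indicator {0..<p} t * f (cis t) \<partial>lborel)"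
    by (subst nn_integral_add) auto
  also have "\<dots> = (\<integral>\<^sup>+t. indicator {0..2*pi} t * f (cis t) \<partial>lborel)"
    using p by (auto intro!: nn_integral_cong simp: indicator_def)
  finally show ?thesis using a by (simp add: nn_integral_circ)
qed

lemma distr_circ_rotate:
  assumes "cmod w = 1"
  shows "distr circ borel (\<lambda>y. w * y) = circ"
proof (rule measure_eqI)
  fix A assume "A \<in> sets (distr circ borel (\<lambda>y. w * y))"
  then have A[measurable]: "A \<in> sets borel" by simp
  obtain p where p: "w = cis p" "0 \<le> p" "p < 2*pi"
    using Arg2pi[of w] assms by (auto simp: is_Arg_def cis_conv_exp mult.commute)
  have "emeasure (distr circ borel (\<lambda>y. w * y)) A = (\<integral>\<^sup>+y. indicator A (w * y) \<partial>circ)"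
    using nn_integral_distr[of "\<lambda>y. w * y" circ borel "indicator A"] by simp
  also have "\<dots> = (\<integral>\<^sup>+y. indicator A y \<partial>circ)"
    using nn_integral_circ_rotate_cis[of "indicator A" p] p by simp
  finally show "emeasure (distr circ borel (\<lambda>y. w * y)) A = emeasure circ A" by simp
qed simp

lemma nn_integral_circ_rotate:
  assumes [measurable]: "f \<in> borel_measurable borel" and w: "cmod w = 1"
  shows "(\<integral>\<^sup>+y. f (w * y) \<partial>circ) = nn_integral circ f"
  using nn_integral_distr[of "\<lambda>y. w * y" circ borel f] distr_circ_rotate[OF w] by simp

lemma integral_circ_rotate:
  fixes f :: "complex \<Rightarrow> 'a::{banach,second_countable_topology}"
  assumes [measurable]: "f \<in> borel_measurable borel" and w: "cmod w = 1"
  shows "(\<integral>y. f (w * y) \<partial>circ) = integral\<^sup>L circ f"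
  using integral_distr[of "\<lambda>y. w * y" circ borel f] distr_circ_rotate[OF w] by simp

lemma integral_circ:
  fixes f :: "complex \<Rightarrow> real"
  assumes [measurable]: "f \<in> borel_measurable borel"
  shows "integral\<^sup>L circ f = (\<integral>t. indicator {0..2*pi} t * f (cis t) \<partial>lborel) / (2*pi)"
proof -
  have "integral\<^sup>L circ f = integral\<^sup>L (uniform_measure lborel {0..2*pi}) (\<lambda>t. f (cis t))"
    unfolding circ_def by (subst integral_distr) auto
  also have "uniform_measure lborel {0..2*pi} = density lborel (\<lambda>t. ennreal (indicator {0..2*pi} t / (2*pi)))"
    unfolding uniform_measure_def
    by (intro density_cong) (auto simp: indicator_def divide_ennreal[symmetric])
  finally show ?thesis
    by (subst (asm) integral_density) auto
qed

text \<open>Cauchy's integral formula on a circle, read as a mean. \<open>g\<close> is kept apart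
  from \<open>f\<close> because \<open>f\<close> is controlled only on the closed ball, whereas
  integration against \<open>circ\<close> asks for a function that is Borel on the whole
  plane.\<close>

lemma mean_value_holomorphic:
  assumes f: "f holomorphic_on cball z R" and r: "0 < r" "r \<le> R"
    and [measurable]: "g \<in> borel_measurable borel" and g: "\<And>w. w \<in> cball z R \<Longrightarrow> g w = Re (f w)"
  shows "(\<integral>y. g (z + of_real r * y) \<partial>circ) = g z"
proof -
  have ci: "((\<lambda>u. f u / (u - z)) has_contour_integral (2 * of_real pi * \<i> * f z)) (circlepath z r)"
    using f r
    by (intro Cauchy_integral_circlepath)
       (auto intro!: holomorphic_on_imp_continuous_on elim!: holomorphic_on_subset)
  then have "((\<lambda>x. f (circlepath z r x) / (circlepath z r x - z) * vector_derivative (circlepath z r) (at x)) has_integral (2 * of_real pi * \<i> * f z)) {0..1}"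
    by (simp add: has_contour_integral)
  moreover have "f (circlepath z r x) / (circlepath z r x - z) * vector_derivative (circlepath z r) (at x)
     = 2 * of_real pi * \<i> * f (z + of_real r * cis (2*pi*x))" for x
    using r by (simp add: vector_derivative_circlepath) (simp add: circlepath mult_ac cis_conv_exp)
  ultimately have "((\<lambda>x. 2 * of_real pi * \<i> * f (z + of_real r * cis (2*pi*x))) has_integral (2 * of_real pi * \<i> * f z)) {0..1}"
    by simp
  from has_integral_mult_right[OF this, of "1/(2 * of_real pi * \<i>)"]
  have "((\<lambda>x. f (z + of_real r * cis (2*pi*x))) has_integral f z) {0..1}"
    by simp
  \<comment> \<open>Rescales the contour parameter in [0,1] to the angle in [0, 2 pi].\<close>
  from has_integral_affinity[OF this[unfolded cbox_interval[symmetric]], of "1/(2*pi)" 0]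
  have "((\<lambda>x. f (z + of_real r * cis x)) has_integral (2 * pi) *\<^sub>R f z) {0..2*pi}"
    by simp
  from has_integral_linear[OF this bounded_linear_Re]
  have R: "((\<lambda>x. Re (f (z + of_real r * cis x))) has_integral (2 * pi) * Re (f z)) {0..2*pi}"
    by (simp add: o_def)
  have in_cball: "z + of_real r * cis x \<in> cball z R" for x
    using r by (simp add: dist_norm norm_mult)
  have "continuous_on {0..2*pi} (\<lambda>x. Re (f (z + of_real r * cis x)))"
    by (intro continuous_intros continuous_on_compose2[OF holomorphic_on_imp_continuous_on[OF f]])
       (use in_cball in auto)
  then have "set_integrable lborel {0..2*pi} (\<lambda>x. Re (f (z + of_real r * cis x)))"
    by (rule borel_integrable_atLeastAtMost')
  then have "(LINT x:{0..2*pi}|lborel. Re (f (z + of_real r * cis x))) = 2*pi * Re (f z)"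
    using set_borel_integral_eq_integral(2) integral_unique[OF R] by metis
  then have "(LINT x:{0..2*pi}|lborel. g (z + of_real r * cis x)) = 2*pi * g z"
    using g[OF in_cball] g[of z] r by simp
  then show ?thesis
    by (subst integral_circ) (auto simp: set_lebesgue_integral_def)
qed

lemma integrable_circ_continuous_on:
  fixes f :: "complex \<Rightarrow> real"
  assumes [measurable]: "f \<in> borel_measurable borel"
    and f: "continuous_on (sphere z r) f" and r: "0 \<le> r"
  shows "integrable circ (\<lambda>y. f (z + of_real r * y))"
proof -
  have "bounded (f ` sphere z r)"
    by (intro compact_imp_bounded compact_continuous_image f) auto
  then obtain B where B: "\<And>x. x \<in> sphere z r \<Longrightarrow> norm (f x) \<le> B"
    unfolding bounded_iff by blast
  show ?thesis
  proof (rule circ.integrable_const_bound[where B=B])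
    show "AE y in circ. norm (f (z + of_real r * y)) \<le> B"
      using AE_circ by eventually_elim (use r in \<open>intro B, simp add: dist_norm norm_mult\<close>)
  qed auto
qed

text \<open>Once \<open>ln (cmod (z - a))\<close> is split off, the factor 1 + w/(z - a) has
  positive real part for |w| \<le> r, so the principal \<open>Ln\<close> is holomorphic there and
  its real part obeys the mean value property.\<close>

lemma mean_value_ln_norm:
  assumes "0 < r" "r < cmod (z - a)"
  shows "(\<integral>y. ln (cmod (z + of_real r * y - a)) \<partial>circ) = ln (cmod (z - a))"
proof -
  have za: "z \<noteq> a" using assms by auto
  have *: "(\<integral>y. ln (cmod (1 + (0 + of_real r * y) / (z - a))) \<partial>circ) = ln (cmod (1 + 0 / (z-a)))"
  proof (rule mean_value_holomorphic[where f="\<lambda>w. Ln (1 + w / (z - a))" and R=r and g="\<lambda>w. ln (cmod (1 + w / (z-a)))"])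
    have pos: "1 + w/(z-a) \<notin> \<real>\<^sub>\<le>\<^sub>0" if "w \<in> cball 0 r" for w
    proof -
      have "cmod (w / (z-a)) < 1" using that assms za by (simp add: norm_divide)
      then have "\<bar>Re (w/(z-a))\<bar> < 1" using abs_Re_le_cmod[of "w/(z-a)"] by linarith
      then have "Re (1 + w/(z-a)) > 0" by simp
      then show ?thesis by (auto simp: complex_nonpos_Reals_iff)
    qed
    then show "(\<lambda>w. Ln (1 + w / (z - a))) holomorphic_on cball 0 r"
      using za by (intro holomorphic_intros) auto
    show "ln (cmod (1 + w / (z - a))) = Re (Ln (1 + w / (z - a)))" if "w \<in> cball 0 r" for w
      using pos[OF that] by (subst Re_Ln) auto
  qed (use assms in auto)
  have "ln (cmod (z + of_real r * y - a)) = ln (cmod (z - a)) + ln (cmod (1 + (0 + of_real r * y) / (z - a)))" if "cmod y = 1" for y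
  proof -
    have "cmod (of_real r * y / (z-a)) < 1" using that assms za by (simp add: norm_divide norm_mult)
    then have nz: "1 + of_real r * y / (z-a) \<noteq> 0"
      by (metis add_eq_0_iff norm_minus_cancel norm_one order_less_irrefl add.commute)
    have "z + of_real r * y - a = (z-a) * (1 + of_real r * y / (z-a))"
      using za by (simp add: field_simps)
    then show ?thesis using nz za by (simp add: norm_mult ln_mult)
  qed
  then have "(\<integral>y. ln (cmod (z + of_real r * y - a)) \<partial>circ) = (\<integral>y. ln (cmod (z - a)) + ln (cmod (1 + (0 + of_real r * y) / (z - a))) \<partial>circ)"
    by (intro integral_cong_AE) (use AE_circ in auto)
  also have "\<dots> = ln (cmod (z-a)) + (\<integral>y. ln (cmod (1 + (0 + of_real r * y) / (z - a))) \<partial>circ)"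
  proof (subst Bochner_Integration.integral_add)
    have "1 + w / (z - a) \<noteq> 0" if "w \<in> sphere 0 r" for w
    proof
      assume "1 + w / (z - a) = 0"
      then have "w = a - z" using za by (simp add: field_simps)
      then show False using that assms by (simp add: norm_minus_commute)
    qed
    then have "continuous_on (sphere 0 r) (\<lambda>w. ln (cmod (1 + w / (z - a))))"
      using za by (intro continuous_intros) auto
    then show "integrable circ (\<lambda>y. ln (cmod (1 + (0 + of_real r * y) / (z - a))))"
      using assms by (intro integrable_circ_continuous_on) auto
  qed (use circ.prob_space in auto)
  finally show ?thesis using * by simp
qed

section \<open>The maximum principle\<close>

lemma AE_circ_rotate:
  assumes "cmod w = 1" and ae: "AE y in circ. P y"
  shows "AE y in circ. P (w * y)"
proof (rule AE_distrD[where M'=borel and P=P])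
  show "almost_everywhere (distr circ borel ((*) w)) P"
    unfolding distr_circ_rotate[OF assms(1)] by (rule ae)
qed auto

text \<open>If a closed half plane had full measure, so would its quarter turns, and these meet only
  in 0. Rotation invariance thus replaces a computation of arc lengths.\<close>

lemma not_AE_circ_half_plane: "\<not> (AE y in circ. Re y \<le> 0)"
proof
  assume A: "AE y in circ. Re y \<le> 0"
  have R: "AE y in circ. Re (-1 * y) \<le> 0" "AE y in circ. Re (\<i> * y) \<le> 0" "AE y in circ. Re (-\<i> * y) \<le> 0"
    by (rule AE_circ_rotate[OF _ A], simp)+
  have "AE y in circ. False"
    using A R AE_circ
  proof eventually_elim
    case (elim y)
    then have "Re y = 0" "Im y = 0" by auto
    then have "y = 0" by (simp add: complex_eq_iff)
    then show ?case using elim by simp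
  qed
  then show False by (simp add: circ.AE_False)
qed

section \<open>Upper semicontinuous functions and their maxima\<close>

definition usc :: "(complex \<Rightarrow> real) \<Rightarrow> bool" where
  "usc v \<longleftrightarrow> (\<forall>z a. v z < a \<longrightarrow> eventually (\<lambda>w. v w < a) (nhds z))"

lemma usc_open: "usc v \<Longrightarrow> open {z. v z < a}"
  unfolding open_subopen[of "{z. v z < a}"]
proof (intro ballI)
  fix z assume "usc v" "z \<in> {z. v z < a}"
  then have "eventually (\<lambda>w. v w < a) (nhds z)" by (simp add: usc_def)
  then show "\<exists>T. open T \<and> z \<in> T \<and> T \<subseteq> {z. v z < a}" unfolding eventually_nhds by auto
qed

lemma usc_borel: "usc v \<Longrightarrow> v \<in> borel_measurable borel"
  using usc_open by (intro borel_measurableI_less) auto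

lemma usc_add:
  assumes "usc u" "usc v"
  shows "usc (\<lambda>z. u z + v z)"
  unfolding usc_def
proof (intro allI impI)
  fix z a assume "u z + v z < a"
  define e where "e = (a - (u z + v z)) / 2"
  have "e > 0" using \<open>u z + v z < a\<close> by (simp add: e_def)
  then have "eventually (\<lambda>w. u w < u z + e) (nhds z)" "eventually (\<lambda>w. v w < v z + e) (nhds z)"
    using assms unfolding usc_def by auto
  then show "eventually (\<lambda>w. u w + v w < a) (nhds z)"
    by eventually_elim (simp add: e_def field_simps)
qed

text \<open>If no point were maximal, the sets {g < g y} would cover D, but a finite subcover misses
  the index y with the largest g y. Openness is relative to D because g will be v - h with h
  continuous on D only.\<close>

lemma usc_attains_sup:
  fixes g :: "complex \<Rightarrow> real"
  assumes D: "compact D" "D \<noteq> {}" and g: "\<And>a. openin (top_of_set D) {x \<in> D. g x < a}"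
  obtains x where "x \<in> D" "\<And>y. y \<in> D \<Longrightarrow> g y \<le> g x"
proof (rule ccontr)
  assume "\<not> thesis"
  then have *: "\<And>x. x \<in> D \<Longrightarrow> \<exists>y\<in>D. g x < g y"
    using that by force
  let ?C = "(\<lambda>y. {x \<in> D. g x < g y}) ` D"
  have "\<forall>c\<in>?C. openin (top_of_set D) c" "D \<subseteq> \<Union>?C" using g * by fastforce+
  then obtain F where F: "F \<subseteq> D" "finite F" "D \<subseteq> (\<Union>y\<in>F. {x \<in> D. g x < g y})"
    using D(1) unfolding compact_eq_openin_cover by (metis (no_types, lifting) finite_subset_image)
  then have "F \<noteq> {}" using D(2) by auto
  then have "Max (g ` F) \<in> g ` F" using F(2) by auto
  then obtain y where y: "y \<in> F" "g y = Max (g ` F)" by auto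
  then obtain y' where "y' \<in> F" "g y < g y'" using F by blast
  then show False using y F(2) by (metis Max_ge finite_imageI image_eqI linorder_not_less)
qed

lemma openin_diff_less:
  assumes v: "usc v" and h: "continuous_on D h"
  shows "openin (top_of_set D) {x \<in> D. v x - h x < a}"
proof (subst openin_subopen, intro ballI)
  fix x assume x: "x \<in> {x \<in> D. v x - h x < a}"
  define e where "e = (a - (v x - h x)) / 2"
  have e: "e > 0" using x by (simp add: e_def)
  have "openin (top_of_set D) (D \<inter> {y. v y < v x + e})"
    using usc_open[OF v] by auto
  moreover have "openin (top_of_set D) (D \<inter> h -` {h x - e<..})"
    using h by (rule continuous_openin_preimage_gen) auto
  ultimately have "openin (top_of_set D) ((D \<inter> {y. v y < v x + e}) \<inter> (D \<inter> h -` {h x - e<..}))"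
    by (rule openin_Int)
  moreover have "x \<in> (D \<inter> {y. v y < v x + e}) \<inter> (D \<inter> h -` {h x - e<..})"
    using x e by auto
  moreover have "(D \<inter> {y. v y < v x + e}) \<inter> (D \<inter> h -` {h x - e<..}) \<subseteq> {x \<in> D. v x - h x < a}"
    by (auto simp: e_def field_simps)
  ultimately show "\<exists>T. openin (top_of_set D) T \<and> x \<in> T \<and> T \<subseteq> {x \<in> D. v x - h x < a}"
    by blast
qed

text \<open>The point of the maximum set with the largest real part has a circle around it whose right
half avoids the maximum set.\<close>
lemma usc_max_principle:
  assumes D: "compact D" "open \<Omega>" "\<Omega> \<subseteq> D"
    and v: "usc v" and h: "continuous_on D h"
    and sub: "\<And>z. z \<in> \<Omega> \<Longrightarrow> \<exists>r0>0. \<forall>r. 0 < r \<and> r < r0 \<longrightarrow>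
        integrable circ (\<lambda>y. v (z + of_real r * y) - h (z + of_real r * y)) \<and>
        v z - h z \<le> (\<integral>y. v (z + of_real r * y) - h (z + of_real r * y) \<partial>circ)"
    and bd: "\<And>z. z \<in> D - \<Omega> \<Longrightarrow> v z \<le> h z"
    and z: "z \<in> D"
  shows "v z \<le> h z"
proof (rule ccontr)
  assume neg: "\<not> v z \<le> h z"
  define g where "g = (\<lambda>x. v x - h x)"
  have og: "openin (top_of_set D) {x \<in> D. g x < a}" for a
    unfolding g_def by (rule openin_diff_less[OF v h])
  obtain p where p: "p \<in> D" "\<And>y. y \<in> D \<Longrightarrow> g y \<le> g p"
    using usc_attains_sup[OF D(1) _ og] z by blast
  define E where "E = {x \<in> D. g x = g p}"
  have "E = D - {x \<in> D. g x < g p}" using p by (fastforce simp: E_def)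
  then have "closedin (top_of_set D) E" using og by (metis closedin_diff closedin_topspace topspace_euclidean_subtopology)
  then have "compact E" using D(1) closedin_compact by blast
  moreover have "E \<noteq> {}" using p by (auto simp: E_def)
  ultimately obtain x where x: "x \<in> E" "\<And>y. y \<in> E \<Longrightarrow> Re y \<le> Re x"
    using continuous_attains_sup[of E Re] continuous_on_Re[OF continuous_on_id] by metis
  \<comment> \<open>The point z violates the claim, so the maximum of g is positive and the maximum
    set avoids \<open>D - \<Omega>\<close>.\<close>
  have "g x > 0" using x(1) p(2)[OF z] neg by (auto simp: E_def g_def)
  then have "x \<in> \<Omega>" using bd[of x] x(1) by (force simp: E_def g_def)
  then obtain r0 where r0: "r0 > 0" "\<And>r. 0 < r \<Longrightarrow> r < r0 \<Longrightarrow>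
        integrable circ (\<lambda>y. g (x + of_real r * y)) \<and> g x \<le> (\<integral>y. g (x + of_real r * y) \<partial>circ)"
    using sub[of x] unfolding g_def by blast
  obtain d where d: "d > 0" "ball x d \<subseteq> \<Omega>" using D(2) \<open>x \<in> \<Omega>\<close> openE by blast
  define r where "r = min r0 d / 2"
  have r: "0 < r" "r < r0" "r < d" using r0 d by (auto simp: r_def)
  have inD: "x + of_real r * y \<in> D" if "cmod y = 1" for y
  proof -
    have "x + of_real r * y \<in> ball x d" using r that by (simp add: dist_norm norm_mult)
    then show ?thesis using d D by auto
  qed
  have gx: "g x = g p" using x by (simp add: E_def)
  have int: "integrable circ (\<lambda>y. g x - g (x + of_real r * y))"
    using r0(2)[OF r(1,2)] by auto
  have nn: "AE y in circ. 0 \<le> g x - g (x + of_real r * y)"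
    using AE_circ by eventually_elim (use inD p gx in auto)
  have "(\<integral>y. g x - g (x + of_real r * y) \<partial>circ) = g x - (\<integral>y. g (x + of_real r * y) \<partial>circ)"
    using r0(2)[OF r(1,2)] circ.prob_space by (subst Bochner_Integration.integral_diff) auto
  also have "\<dots> \<le> 0" using r0(2)[OF r(1,2)] by simp
  finally have "(\<integral>y. g x - g (x + of_real r * y) \<partial>circ) = 0"
    using integral_nonneg_AE[OF nn] by simp
  then have "AE y in circ. g x - g (x + of_real r * y) = 0"
    using integral_nonneg_eq_0_iff_AE[OF int nn] by simp
  then have "AE y in circ. Re y \<le> 0"
    using AE_circ
  proof eventually_elim
    case (elim y)
    then have "x + of_real r * y \<in> E" using inD[of y] gx by (simp add: E_def)
    then have "Re (x + of_real r * y) \<le> Re x" using x by blast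
    then show ?case using r by (simp add: mult_le_0_iff)
  qed
  then show False using not_AE_circ_half_plane by blast
qed

section \<open>Local mean value property and real-valued subharmonic functions\<close>

definition cmean :: "(complex \<Rightarrow> real) \<Rightarrow> complex \<Rightarrow> real \<Rightarrow> real" where
  "cmean v z r = (\<integral>y. v (z + of_real r * y) \<partial>circ)"

text \<open>A local substitute for harmonicity that is closed under sums and multiples.
  Integrability is included because the Bochner integral of a non-integrable function is 0, which
  would make the equation meaningless.\<close>

definition mean_prop :: "(complex \<Rightarrow> real) \<Rightarrow> complex \<Rightarrow> bool" where
  "mean_prop h z \<longleftrightarrow> (\<exists>r0>0. \<forall>r. 0 < r \<and> r < r0 \<longrightarrow>
     integrable circ (\<lambda>y. h (z + of_real r * y)) \<and> cmean h z r = h z)"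

lemma mean_prop_const [simp]: "mean_prop (\<lambda>_. c) z"
proof -
  have "cmean (\<lambda>_. c) z r = c" for r using circ.prob_space by (simp add: cmean_def)
  then show ?thesis unfolding mean_prop_def by (intro exI[of _ "1::real"]) auto
qed

lemma mean_prop_cmult:
  assumes "mean_prop h z"
  shows "mean_prop (\<lambda>x. c * h x) z"
proof -
  obtain a where a: "a > 0" "\<And>r. 0 < r \<Longrightarrow> r < a \<Longrightarrow> integrable circ (\<lambda>y. h (z + of_real r * y)) \<and> cmean h z r = h z"
    using assms unfolding mean_prop_def by blast
  show ?thesis unfolding mean_prop_def
    by (rule exI[of _ a]) (use a in \<open>simp add: cmean_def\<close>)
qed

lemma mean_prop_add:
  assumes "mean_prop h z" "mean_prop k z"
  shows "mean_prop (\<lambda>x. h x + k x) z"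
proof -
  obtain a b where a: "a > 0" "\<And>r. 0 < r \<Longrightarrow> r < a \<Longrightarrow> integrable circ (\<lambda>y. h (z + of_real r * y)) \<and> cmean h z r = h z"
    and b: "b > 0" "\<And>r. 0 < r \<Longrightarrow> r < b \<Longrightarrow> integrable circ (\<lambda>y. k (z + of_real r * y)) \<and> cmean k z r = k z"
    using assms unfolding mean_prop_def by blast
  show ?thesis unfolding mean_prop_def
    by (rule exI[of _ "min a b"]) (use a b in \<open>auto simp: cmean_def\<close>)
qed

lemma mean_prop_ln: 
  assumes "z \<noteq> a"
  shows "mean_prop (\<lambda>x. ln (cmod (x - a))) z"
  unfolding mean_prop_def cmean_def
proof (rule exI[of _ "cmod (z - a)"], intro conjI allI impI)
  fix r assume r: "0 < r \<and> r < cmod (z - a)"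
  show "integrable circ (\<lambda>y. ln (cmod (z + of_real r * y - a)))"
    using r by (intro integrable_circ_continuous_on continuous_intros) (auto simp: dist_norm)
  show "(\<integral>y. ln (cmod (z + of_real r * y - a)) \<partial>circ) = ln (cmod (z - a))"
    using r by (intro mean_value_ln_norm) auto
qed (use assms in auto)

text \<open>The lower bound is what truncation provides: with upper semicontinuity it makes
  \<open>v\<close> bounded on every circle, so all means are genuine integrals. The sub-mean
  inequality is local here; \<open>real_subharmonic_le_cmean\<close> extends it to all
  radii.\<close>

definition real_subharmonic :: "(complex \<Rightarrow> real) \<Rightarrow> bool" where
  "real_subharmonic v \<longleftrightarrow> usc v \<and> (\<exists>b. \<forall>z. b \<le> v z) \<and>
     (\<forall>z. \<exists>r0>0. \<forall>r. 0 < r \<and> r < r0 \<longrightarrow> v z \<le> cmean v z r)"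

lemma real_subharmonic_usc: "real_subharmonic v \<Longrightarrow> usc v" by (simp add: real_subharmonic_def)

lemma real_subharmonic_borel: "real_subharmonic v \<Longrightarrow> v \<in> borel_measurable borel"
  by (simp add: real_subharmonic_def usc_borel)

lemma real_subharmonic_bounded_below:
  assumes "real_subharmonic v"
  obtains b where "\<And>z. b \<le> v z"
proof -
  have "\<exists>b. \<forall>z. b \<le> v z" using assms unfolding real_subharmonic_def by (elim conjE)
  then show thesis using that by auto
qed

lemma real_subharmonic_submean:
  assumes "real_subharmonic v"
  obtains r0 where "r0 > 0" "\<And>r. 0 < r \<Longrightarrow> r < r0 \<Longrightarrow> v z \<le> cmean v z r"
proof -
  have "\<forall>z. \<exists>r0>0. \<forall>r. 0 < r \<and> r < r0 \<longrightarrow> v z \<le> cmean v z r"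
    using assms unfolding real_subharmonic_def by (elim conjE)
  from spec[OF this, of z] show thesis using that by (elim exE conjE) simp
qed

lemma usc_bounded_above:
  assumes "usc v" "compact D"
  obtains K where "\<And>z. z \<in> D \<Longrightarrow> v z \<le> K"
proof (cases "D = {}")
  case False
  have "openin (top_of_set D) {x \<in> D. v x < a}" for a
    using openin_diff_less[OF assms(1), of D "\<lambda>_. 0" a] by simp
  then show ?thesis using usc_attains_sup[OF assms(2) False] that by metis
qed (use that in auto)

lemma usc_integrable:
  assumes v: "usc v" and b: "\<And>z. b \<le> v z"
  shows "integrable circ (\<lambda>y. v (z + of_real r * y))"
proof -
  obtain K where K: "\<And>w. w \<in> sphere z \<bar>r\<bar> \<Longrightarrow> v w \<le> K"
    using usc_bounded_above[OF v, of "sphere z \<bar>r\<bar>"] by auto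
  note [measurable] = usc_borel[OF v]
  show ?thesis
  proof (rule circ.integrable_const_bound[where B="max \<bar>K\<bar> \<bar>b\<bar>"])
    show "AE y in circ. norm (v (z + of_real r * y)) \<le> max \<bar>K\<bar> \<bar>b\<bar>"
      using AE_circ
    proof eventually_elim
      case (elim y)
      have "v (z + of_real r * y) \<le> K" using elim by (intro K) (simp add: dist_norm norm_mult)
      then show ?case using b[of "z + of_real r * y"] by auto
    qed
  qed auto
qed

lemma real_subharmonic_integrable:
  assumes v: "real_subharmonic v"
  shows "integrable circ (\<lambda>y. v (z + of_real r * y))"
proof -
  obtain b where "\<And>z. b \<le> v z" using real_subharmonic_bounded_below[OF v] by metis
  then show ?thesis using usc_integrable[OF real_subharmonic_usc[OF v]] by blast
qed

lemma real_subharmonic_max_principle: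
  assumes v: "real_subharmonic v" and D: "compact D" "open \<Omega>" "\<Omega> \<subseteq> D"
    and h: "continuous_on D h" "\<And>z. z \<in> \<Omega> \<Longrightarrow> mean_prop h z"
    and bd: "\<And>z. z \<in> D - \<Omega> \<Longrightarrow> v z \<le> h z" and z: "z \<in> D"
  shows "v z \<le> h z"
proof (rule usc_max_principle[OF D real_subharmonic_usc[OF v] h(1) _ bd z])
  fix z assume "z \<in> \<Omega>"
  then obtain a where a: "a > 0" "\<And>r. 0 < r \<Longrightarrow> r < a \<Longrightarrow> integrable circ (\<lambda>y. h (z + of_real r * y)) \<and> cmean h z r = h z"
    using h(2) unfolding mean_prop_def by blast
  obtain b where b: "b > 0" "\<And>r. 0 < r \<Longrightarrow> r < b \<Longrightarrow> v z \<le> cmean v z r"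
    using real_subharmonic_submean[OF v] by metis
  show "\<exists>r0>0. \<forall>r. 0 < r \<and> r < r0 \<longrightarrow>
        integrable circ (\<lambda>y. v (z + of_real r * y) - h (z + of_real r * y)) \<and>
        v z - h z \<le> (\<integral>y. v (z + of_real r * y) - h (z + of_real r * y) \<partial>circ)"
    by (rule exI[of _ "min a b"])
       (use a b real_subharmonic_integrable[OF v] in \<open>auto simp: cmean_def\<close>)
qed

lemma real_subharmonic_const [simp]: "real_subharmonic (\<lambda>_. c)"
proof -
  have "usc (\<lambda>_. c)" by (simp add: usc_def)
  moreover have "cmean (\<lambda>_. c) z r = c" for z r using circ.prob_space by (simp add: cmean_def)
  ultimately show ?thesis unfolding real_subharmonic_def by (intro conjI allI exI[of _ "1::real"] exI[of _ c]) auto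
qed

lemma real_subharmonic_add:
  assumes u: "real_subharmonic u" and v: "real_subharmonic v"
  shows "real_subharmonic (\<lambda>z. u z + v z)"
  unfolding real_subharmonic_def
proof (intro conjI allI)
  show "usc (\<lambda>z. u z + v z)" using assms by (simp add: real_subharmonic_def usc_add)
  obtain a where "\<And>z. a \<le> u z" using real_subharmonic_bounded_below[OF u] by metis
  moreover obtain b where "\<And>z. b \<le> v z" using real_subharmonic_bounded_below[OF v] by metis
  ultimately show "\<exists>b. \<forall>z. b \<le> u z + v z" by (intro exI[of _ "a+b"]) (auto intro: add_mono)
  fix z
  obtain r1 where r1: "r1 > 0" "\<And>r. 0 < r \<Longrightarrow> r < r1 \<Longrightarrow> u z \<le> cmean u z r"
    using real_subharmonic_submean[OF u] by metis
  obtain r2 where r2: "r2 > 0" "\<And>r. 0 < r \<Longrightarrow> r < r2 \<Longrightarrow> v z \<le> cmean v z r"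
    using real_subharmonic_submean[OF v] by metis
  have eq: "cmean (\<lambda>z. u z + v z) z r = cmean u z r + cmean v z r" for r
    unfolding cmean_def
    by (rule Bochner_Integration.integral_add[OF real_subharmonic_integrable[OF u] real_subharmonic_integrable[OF v]])
  show "\<exists>r0>0. \<forall>r. 0 < r \<and> r < r0 \<longrightarrow> u z + v z \<le> cmean (\<lambda>z. u z + v z) z r"
    unfolding eq using r1 r2 by (intro exI[of _ "min r1 r2"]) (simp add: add_mono)
qed

lemma real_subharmonic_cmult:
  assumes v: "real_subharmonic v" and c: "c > 0"
  shows "real_subharmonic (\<lambda>z. c * v z)"
  unfolding real_subharmonic_def
proof (intro conjI allI)
  show "usc (\<lambda>z. c * v z)" unfolding usc_def
  proof (intro allI impI)
    fix z a assume "c * v z < a"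
    then have "v z < a / c" using c by (simp add: field_simps)
    then have "eventually (\<lambda>w. v w < a / c) (nhds z)" using real_subharmonic_usc[OF v] by (auto simp: usc_def)
    then show "eventually (\<lambda>w. c * v w < a) (nhds z)" using c by (simp add: field_simps)
  qed
  obtain b where "\<And>z. b \<le> v z" using real_subharmonic_bounded_below[OF v] by metis
  then show "\<exists>b. \<forall>z. b \<le> c * v z" using c by (intro exI[of _ "c*b"]) auto
  fix z
  show "\<exists>r0>0. \<forall>r. 0 < r \<and> r < r0 \<longrightarrow> c * v z \<le> cmean (\<lambda>z. c * v z) z r"
    using v c by (auto simp: cmean_def real_subharmonic_def)
qed

lemma real_subharmonic_rotate:
  assumes v: "real_subharmonic v" and w: "cmod w = 1"
  shows "real_subharmonic (\<lambda>x. v (a + w * x))"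
  unfolding real_subharmonic_def
proof (intro conjI allI)
  show "usc (\<lambda>x. v (a + w * x))" unfolding usc_def
  proof (intro allI impI)
    fix z b assume "v (a + w * z) < b"
    then have "eventually (\<lambda>x. v x < b) (nhds (a + w * z))"
      using real_subharmonic_usc[OF v] by (auto simp: usc_def)
    moreover have "((\<lambda>x. a + w * x) \<longlongrightarrow> a + w * z) (nhds z)"
      by (intro tendsto_intros filterlim_ident)
    ultimately show "eventually (\<lambda>x. v (a + w * x) < b) (nhds z)"
      unfolding filterlim_iff by blast
  qed
  show "\<exists>b. \<forall>x. b \<le> v (a + w * x)" using v by (auto simp: real_subharmonic_def)
  fix z
  note [measurable] = real_subharmonic_borel[OF v]
  have "cmean (\<lambda>x. v (a + w * x)) z r = cmean v (a + w * z) r" for r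
    unfolding cmean_def
    using integral_circ_rotate[of "\<lambda>y. v (a + w * z + of_real r * y)" w] w
    by (simp add: algebra_simps)
  then show "\<exists>r0>0. \<forall>r. 0 < r \<and> r < r0 \<longrightarrow> v (a + w * z) \<le> cmean (\<lambda>x. v (a + w * x)) z r"
    using v by (auto simp: real_subharmonic_def)
qed

lemma real_subharmonic_sum:
  assumes "finite I" "\<And>i. i \<in> I \<Longrightarrow> real_subharmonic (f i)"
  shows "real_subharmonic (\<lambda>x. \<Sum>i\<in>I. f i x)"
  using assms by (induction rule: finite_induct) (auto intro: real_subharmonic_add)

section \<open>Circle means\<close>

text \<open>An upper envelope that converts closeness of points into an inequality between values,
  which upper semicontinuity alone does not give uniformly. It tends to \<open>v\<close> pointwise
  as \<open>h\<close> tends to 0.\<close>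

definition sup_ball :: "(complex \<Rightarrow> real) \<Rightarrow> real \<Rightarrow> complex \<Rightarrow> real" where
  "sup_ball v h z = (SUP w\<in>ball z h. v w)"

lemma usc_bdd_above_ball: "usc v \<Longrightarrow> bdd_above (v ` ball z h)"
  using usc_bounded_above[of v "cball z h"] unfolding bdd_above_def
  by (metis compact_cball ball_subset_cball imageE subsetD)

lemma sup_ball_upper: "usc v \<Longrightarrow> dist z w < h \<Longrightarrow> v w \<le> sup_ball v h z"
  unfolding sup_ball_def by (intro cSUP_upper usc_bdd_above_ball) auto

lemma sup_ball_least: "h > 0 \<Longrightarrow> (\<And>w. dist z w < h \<Longrightarrow> v w \<le> K) \<Longrightarrow> sup_ball v h z \<le> K"
  unfolding sup_ball_def by (intro cSUP_least) (auto simp: ball_eq_empty)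

text \<open>The envelope is lower semicontinuous: a value above a at w is seen from all of
  \<open>ball w h\<close>, so the superlevel sets are open.\<close>

lemma sup_ball_borel:
  assumes "usc v" "h > 0"
  shows "sup_ball v h \<in> borel_measurable borel"
proof (rule borel_measurableI_greater)
  fix a
  have "open {z. a < sup_ball v h z}"
  proof (subst openin_subopen[of euclidean, simplified], safe)
    fix z assume z: "a < sup_ball v h z"
    then obtain w where w: "dist z w < h" "a < v w"
      using less_cSUP_iff[OF _ usc_bdd_above_ball[OF assms(1)], of z h a] assms(2)
      by (auto simp: sup_ball_def)
    show "\<exists>T. open T \<and> z \<in> T \<and> T \<subseteq> {z. a < sup_ball v h z}"
      by (rule exI[of _ "ball w h"])
         (use w sup_ball_upper[OF assms(1), of _ w h] in \<open>auto simp: dist_commute less_le_trans\<close>)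
  qed
  then show "{z \<in> space borel. a < sup_ball v h z} \<in> sets borel" by simp
qed

lemma sup_ball_tendsto:
  assumes v: "usc v" and h: "h \<longlonglongrightarrow> 0" "\<And>n. h n > 0"
  shows "(\<lambda>n. sup_ball v (h n) z) \<longlonglongrightarrow> v z"
proof (rule order_tendstoI)
  fix a assume "a < v z"
  moreover have "v z \<le> sup_ball v (h n) z" for n
    using sup_ball_upper[OF v, of z z "h n"] h by simp
  ultimately show "eventually (\<lambda>n. a < sup_ball v (h n) z) sequentially"
    by (intro always_eventually allI) (meson less_le_trans)
next
  fix a assume "v z < a"
  then obtain b where b: "v z < b" "b < a" using dense by blast
  then have "eventually (\<lambda>w. v w < b) (nhds z)" using v by (auto simp: usc_def)
  then obtain d where d: "d > 0" "\<And>w. dist w z < d \<Longrightarrow> v w < b"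
    unfolding eventually_nhds_metric by blast
  have "eventually (\<lambda>n. h n < d) sequentially" using h(1) d(1) by (rule order_tendstoD)
  then show "eventually (\<lambda>n. sup_ball v (h n) z < a) sequentially"
  proof eventually_elim
    case (elim n)
    have "sup_ball v (h n) z \<le> b"
    proof (rule sup_ball_least)
      fix w assume "dist z w < h n"
      then have "dist w z < d" using elim by (simp add: dist_commute)
      then show "v w \<le> b" using d(2) by (intro less_imp_le)
    qed (rule h)
    then show ?case using b by simp
  qed
qed

text \<open>Discrete version of the rotation average of \<open>v\<close> about \<open>a\<close>. As
  a finite sum it is subharmonic in \<open>x\<close> without any interchange of limits, so the
  maximum principle applies to it; as \<open>N\<close> grows, its values on a circle are bounded by
  the circle mean up to a small error.\<close>

definition rot_avg :: "(complex \<Rightarrow> real) \<Rightarrow> complex \<Rightarrow> nat \<Rightarrow> complex \<Rightarrow> real" where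
  "rot_avg v a N x = (\<Sum>j<N. v (a + cis (2*pi*real j/real N) * x)) / real N"

lemma real_subharmonic_rot_avg:
  assumes "real_subharmonic v" "N > 0"
  shows "real_subharmonic (rot_avg v a N)"
proof -
  have "real_subharmonic (\<lambda>x. (1/real N) * (\<Sum>j<N. v (a + cis (2*pi*real j/real N) * x)))"
    using assms by (intro real_subharmonic_cmult real_subharmonic_sum real_subharmonic_rotate) auto
  moreover have "rot_avg v a N = (\<lambda>x. (1/real N) * (\<Sum>j<N. v (a + cis (2*pi*real j/real N) * x)))"
    by (auto simp: rot_avg_def)
  ultimately show ?thesis by simp
qed

lemma rot_avg_0: "N > 0 \<Longrightarrow> rot_avg v a N 0 = v a"
  by (simp add: rot_avg_def)

lemma cis_mult_mult: "cis a * (cis b * x) = cis (a + b) * x"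
  by (simp only: mult.assoc[symmetric] cis_mult)

lemma rot_avg_rotate1:
  assumes "N > 0"
  shows "rot_avg v a N (cis (2*pi/real N) * x) = rot_avg v a N x"
proof -
  let ?f = "\<lambda>j. v (a + cis (2*pi*real j/real N) * x)"
  have "(\<Sum>j<N. v (a + cis (2*pi*real j/real N) * (cis (2*pi/real N) * x))) = (\<Sum>j<N. ?f (Suc j))"
    by (simp add: cis_mult_mult add_divide_distrib[symmetric] distrib_left add.commute)
  also have "\<dots> = (\<Sum>j<N. ?f j)"
  proof -
    have "?f 0 + (\<Sum>j<N. ?f (Suc j)) = (\<Sum>j<N. ?f j) + ?f N"
      using sum.lessThan_Suc[of ?f N] sum.lessThan_Suc_shift[of ?f N] by simp
    moreover have "?f N = ?f 0" using assms by simp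
    ultimately show ?thesis by linarith
  qed
  finally show ?thesis by (simp add: rot_avg_def)
qed

lemma rot_avg_rotate:
  assumes "N > 0"
  shows "rot_avg v a N (cis (2*pi*real k/real N) * x) = rot_avg v a N x"
proof (induction k)
  case (Suc k)
  have "cis (2*pi*real (Suc k)/real N) * x = cis (2*pi/real N) * (cis (2*pi*real k/real N) * x)"
    by (simp add: cis_mult_mult add_divide_distrib[symmetric] distrib_left)
  then show ?case by (simp only: rot_avg_rotate1[OF assms] Suc)
qed simp

lemma norm_cis_minus_one_le: "cmod (cis s - 1) \<le> \<bar>s\<bar>"
proof -
  have "cmod (cis s - 1)^2 = (cos s - 1)^2 + (sin s)^2"
    by (simp add: cmod_power2)
  also have "\<dots> = 2 - 2 * cos s"
    using sin_cos_squared_add[of s] by (simp add: power2_diff)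
  also have "\<dots> = (2 * sin (s/2))^2"
    using cos_double_sin[of "s/2"] by (simp add: power_mult_distrib)
  finally have "\<bar>cmod (cis s - 1)\<bar> = \<bar>2 * sin (s/2)\<bar>"
    using abs_eq_iff power2_eq_iff by blast
  then show ?thesis using abs_sin_x_le_abs_x[of "s/2"] by simp
qed

text \<open>Every point of the circle is, up to a rotation by a multiple of \<open>2\<pi>/N\<close>, within \<open>2\<pi>r/N\<close> of \<open>x\<close>.\<close>
lemma rot_avg_le_rot_avg_sup_ball:
  assumes v: "usc v" and N: "N > 0" and h: "2*pi*cmod x/real N < h" and y: "cmod y = 1"
  shows "rot_avg v a N x \<le> rot_avg (sup_ball v h) a N (y * x)"
proof -
  obtain t where t: "y = cis t" "0 \<le> t"
    using Arg2pi[of y] y by (auto simp: is_Arg_def cis_conv_exp mult.commute)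
  define k where "k = nat \<lfloor>t * real N / (2*pi)\<rfloor>"
  define s where "s = t - 2*pi*real k/real N"
  have k: "real k \<le> t * real N / (2*pi)" "t * real N / (2*pi) < real k + 1"
    unfolding k_def using t by (auto simp: of_nat_nat)
  have s: "0 \<le> s" "s \<le> 2*pi/real N"
  proof -
    have "2*pi*real k \<le> t * real N" "t * real N \<le> 2*pi*real k + 2*pi"
      using k by (simp_all add: field_simps)
    then have "2*pi*real k/real N \<le> t" "t \<le> (2*pi*real k + 2*pi)/real N"
      using N by (simp_all add: pos_divide_le_eq pos_le_divide_eq)
    then show "0 \<le> s" "s \<le> 2*pi/real N" by (simp_all add: s_def add_divide_distrib)
  qed
  have yx: "y * x = cis (2*pi*real k/real N) * (cis s * x)"
    by (simp add: t cis_mult_mult s_def)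
  have "rot_avg v a N x \<le> rot_avg (sup_ball v h) a N (cis s * x)"
    unfolding rot_avg_def
  proof (intro divide_right_mono sum_mono sup_ball_upper v)
    fix j
    let ?w = "cis (2*pi*real j/real N)"
    have "dist (a + ?w * (cis s * x)) (a + ?w * x) = cmod (?w * ((cis s - 1) * x))"
      by (simp add: dist_norm algebra_simps)
    also have "\<dots> = cmod (cis s - 1) * cmod x" by (simp add: norm_mult)
    also have "\<dots> \<le> 2*pi/real N * cmod x"
      using norm_cis_minus_one_le[of s] s by (intro mult_right_mono) auto
    finally show "dist (a + ?w * (cis s * x)) (a + ?w * x) < h" using h by simp
  qed auto
  then show ?thesis using rot_avg_rotate[OF N] yx by metis
qed

text \<open>A rotated copy of \<open>v\<close> about \<open>a\<close> has the same mean over a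
  circle about \<open>a\<close>, so averaging \<open>rot_avg\<close> over all rotations gives the
  circle mean exactly, for every \<open>N\<close>.\<close>

lemma cmean_rot_avg:
  assumes [measurable]: "v \<in> borel_measurable borel" and N: "N > 0"
    and int: "integrable circ (\<lambda>y. v (a + of_real (cmod x) * y))"
  shows "(\<integral>y. rot_avg v a N (y * x) \<partial>circ) = cmean v a (cmod x)"
    and "integrable circ (\<lambda>y. rot_avg v a N (y * x))"
proof -
  obtain c where c: "cmod c = 1" "x = of_real (cmod x) * c"
    by (metis rcis_cmod_Arg rcis_def norm_cis)
  let ?w = "\<lambda>j. cis (2*pi*real j/real N)"
  have eq: "v (a + ?w j * (y * x)) = v (a + of_real (cmod x) * (?w j * c * y))" for j y
    by (subst c(2)) (simp add: mult_ac)
  have 1: "(\<integral>y. v (a + ?w j * (y * x)) \<partial>circ) = cmean v a (cmod x)" for j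
    unfolding cmean_def eq using c by (intro integral_circ_rotate[of "\<lambda>y. v (a + of_real (cmod x) * y)"]) (auto simp: norm_mult)
  have 2: "integrable circ (\<lambda>y. v (a + ?w j * (y * x)))" for j
  proof -
    have "distr circ borel ((*) (?w j * c)) = circ" using c by (intro distr_circ_rotate) (simp add: norm_mult)
    then have "integrable (distr circ borel ((*) (?w j * c))) (\<lambda>y. v (a + of_real (cmod x) * y))"
      using int by simp
    then show ?thesis unfolding eq by (subst (asm) integrable_distr_eq) auto
  qed
  show "(\<integral>y. rot_avg v a N (y * x) \<partial>circ) = cmean v a (cmod x)"
    using 1 2 N by (simp add: rot_avg_def)
  show "integrable circ (\<lambda>y. rot_avg v a N (y * x))"
    using 2 by (simp add: rot_avg_def)
qed

lemma cmean_sup_ball_tendsto: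
  assumes v: "real_subharmonic v" and h: "h \<longlonglongrightarrow> 0" "\<And>n. 0 < h n" "\<And>n. h n \<le> H"
  shows "(\<lambda>n. cmean (sup_ball v (h n)) a r) \<longlonglongrightarrow> cmean v a r"
    and "integrable circ (\<lambda>y. sup_ball v (h n) (a + of_real r * y))"
proof -
  note [measurable] = real_subharmonic_borel[OF v] sup_ball_borel[OF real_subharmonic_usc[OF v] h(2)]
  obtain b where b: "\<And>z. b \<le> v z" using real_subharmonic_bounded_below[OF v] by metis
  obtain K where K: "\<And>w. w \<in> cball a (\<bar>r\<bar> + H) \<Longrightarrow> v w \<le> K"
    using usc_bounded_above[OF real_subharmonic_usc[OF v], of "cball a (\<bar>r\<bar> + H)"] by auto
  have bd: "AE y in circ. norm (sup_ball v (h n) (a + of_real r * y)) \<le> max \<bar>K\<bar> \<bar>b\<bar>" for n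
    using AE_circ
  proof eventually_elim
    case (elim y)
    let ?z = "a + of_real r * y"
    have "sup_ball v (h n) ?z \<le> K"
    proof (intro sup_ball_least h K)
      fix w assume "dist ?z w < h n"
      moreover have "dist a ?z = \<bar>r\<bar>" using elim by (simp add: dist_norm norm_mult)
      ultimately show "w \<in> cball a (\<bar>r\<bar> + H)"
        using dist_triangle[of a w ?z] h(3)[of n] by simp
    qed
    moreover have "b \<le> sup_ball v (h n) ?z"
      using sup_ball_upper[OF real_subharmonic_usc[OF v], of ?z ?z "h n"] b[of ?z] h(2)[of n] by simp
    ultimately show ?case by auto
  qed
  show "integrable circ (\<lambda>y. sup_ball v (h n) (a + of_real r * y))"
    by (rule circ.integrable_const_bound[OF bd]) auto
  show "(\<lambda>n. cmean (sup_ball v (h n)) a r) \<longlonglongrightarrow> cmean v a r"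
    unfolding cmean_def
    by (rule integral_dominated_convergence[where w="\<lambda>_. max \<bar>K\<bar> \<bar>b\<bar>"])
       (use bd sup_ball_tendsto[OF real_subharmonic_usc[OF v] h(1,2)] in auto)
qed

text \<open>The value at x is below the discrete average of the envelope at every rotated point y x.
  Integrating over y leaves the left side alone and turns the right side into a circle mean of
  \<open>sup_ball\<close>, so the bound is uniform in x.\<close>

lemma rot_avg_eventually_le:
  assumes v: "real_subharmonic v" and r: "r > 0" and e: "e > 0"
  shows "eventually (\<lambda>N. \<forall>x. cmod x = r \<longrightarrow> rot_avg v a N x \<le> cmean v a r + e) sequentially"
proof -
  \<comment> \<open>Since 7 > 2 pi, \<open>h N\<close> exceeds the arc 2 pi r / Suc N between
    neighbouring rotations.\<close>
  define h where "h = (\<lambda>N::nat. 7 * r / real (Suc N))"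
  have h: "h \<longlonglongrightarrow> 0" "\<And>n. 0 < h n" "\<And>n. h n \<le> 7 * r"
    unfolding h_def using r LIMSEQ_Suc[OF lim_const_over_n[of "7*r"]] by (auto simp: field_simps)
  have "eventually (\<lambda>N. cmean (sup_ball v (h N)) a r < cmean v a r + e) sequentially"
    using cmean_sup_ball_tendsto(1)[OF v h] e by (intro order_tendstoD(2)) auto
  then have "eventually (\<lambda>N. \<forall>x. cmod x = r \<longrightarrow> rot_avg v a (Suc N) x \<le> cmean v a r + e) sequentially"
  proof eventually_elim
    case (elim N)
    show ?case
    proof (intro allI impI)
      fix x assume x: "cmod x = r"
      note int = cmean_sup_ball_tendsto(2)[OF v h, where a=a and r=r and n=N]
      have "2*pi*cmod x / real (Suc N) < h N"
        unfolding h_def x using r pi_less_4 pi_approx by (intro divide_strict_right_mono mult_strict_right_mono) auto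
      then have "AE y in circ. rot_avg v a (Suc N) x \<le> rot_avg (sup_ball v (h N)) a (Suc N) (y * x)"
        using AE_circ by (auto elim!: eventually_mono intro!: rot_avg_le_rot_avg_sup_ball real_subharmonic_usc[OF v])
      then have "(\<integral>y. rot_avg v a (Suc N) x \<partial>circ) \<le> (\<integral>y. rot_avg (sup_ball v (h N)) a (Suc N) (y * x) \<partial>circ)"
        using cmean_rot_avg(2)[OF sup_ball_borel[OF real_subharmonic_usc[OF v] h(2)], where N="Suc N" and a=a and x=x] int x
        by (intro integral_mono_AE) auto
      also have "\<dots> = cmean (sup_ball v (h N)) a r"
        using cmean_rot_avg(1)[OF sup_ball_borel[OF real_subharmonic_usc[OF v] h(2)], where N="Suc N" and a=a and x=x] int x by simp
      finally show "rot_avg v a (Suc N) x \<le> cmean v a r + e" using elim circ.prob_space by simp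
    qed
  qed
  then show ?thesis by (subst (asm) eventually_sequentially_Suc)
qed

lemma cmean_le_of_rot_avg_le:
  assumes v: "real_subharmonic v" and N: "N > 0" and r: "r > 0" and le: "\<And>x. cmod x = r \<Longrightarrow> rot_avg v a N x \<le> K"
  shows "cmean v a r \<le> K"
proof -
  have c: "cmod (of_real r :: complex) = r" using r by simp
  note R = cmean_rot_avg[OF real_subharmonic_borel[OF v] N real_subharmonic_integrable[OF v], of a "of_real r", unfolded c]
  have "cmean v a r = (\<integral>y. rot_avg v a N (y * of_real r) \<partial>circ)" using R by simp
  also have "\<dots> \<le> (\<integral>y. K \<partial>circ)"
    using AE_circ r by (intro integral_mono_AE R) (auto elim!: eventually_mono intro!: le simp: norm_mult)
  finally show ?thesis using circ.prob_space by simp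
qed

lemma rot_avg_le_cmean:
  assumes v: "real_subharmonic v" and r: "r > 0" and e: "e > 0"
  obtains N where "N > 0" "\<And>x. cmod x \<le> r \<Longrightarrow> rot_avg v a N x \<le> cmean v a r + e"
proof -
  have "eventually (\<lambda>N. 0 < N \<and> (\<forall>x. cmod x = r \<longrightarrow> rot_avg v a N x \<le> cmean v a r + e)) sequentially"
    by (intro eventually_conj eventually_gt_at_top rot_avg_eventually_le assms)
  then obtain N where N: "N > 0" "\<And>x. cmod x = r \<Longrightarrow> rot_avg v a N x \<le> cmean v a r + e"
    by (auto dest!: eventually_happens)
  have "rot_avg v a N x \<le> cmean v a r + e" if "cmod x \<le> r" for x
    by (rule real_subharmonic_max_principle[OF real_subharmonic_rot_avg[OF v N(1)], of "cball 0 r" "ball 0 r"])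
       (use N that in auto)
  then show thesis using that N by blast
qed

text \<open>At the centre the discrete average equals \<open>v a\<close>, and the maximum principle
  bounds it by the boundary mean up to e. This frees the sub-mean inequality from the restriction to
  small radii.\<close>

lemma real_subharmonic_le_cmean:
  assumes v: "real_subharmonic v" and r: "r > 0"
  shows "v a \<le> cmean v a r"
proof (rule field_le_epsilon)
  fix e :: real assume "e > 0"
  from rot_avg_le_cmean[OF v r this] obtain N where "N > 0" "rot_avg v a N 0 \<le> cmean v a r + e"
    using r by (metis less_imp_le norm_zero)
  then show "v a \<le> cmean v a r + e" by (simp add: rot_avg_0)
qed

lemma cmean_mono:
  assumes v: "real_subharmonic v" and r: "0 < r1" "r1 \<le> r2"
  shows "cmean v a r1 \<le> cmean v a r2"
proof (rule field_le_epsilon)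
  fix e :: real assume "e > 0"
  from rot_avg_le_cmean[OF v _ this, of r2 a] r
  obtain N where "N > 0" "\<And>x. cmod x \<le> r2 \<Longrightarrow> rot_avg v a N x \<le> cmean v a r2 + e"
    by (metis less_le_trans)
  then show "cmean v a r1 \<le> cmean v a r2 + e"
    using r by (intro cmean_le_of_rot_avg_le[OF v]) auto
qed

text \<open>Three circles theorem for means: \<alpha> + \<beta> ln |x| is harmonic on the annulus,
  and the discrete averages are compared with it there.\<close>

lemma cmean_log_convex:
  assumes v: "real_subharmonic v" and r: "0 < r1" "r1 < r2"
    and line: "cmean v a r1 \<le> \<alpha> + \<beta> * ln r1" "cmean v a r2 \<le> \<alpha> + \<beta> * ln r2"
    and r': "r1 \<le> r" "r \<le> r2"
  shows "cmean v a r \<le> \<alpha> + \<beta> * ln r"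
proof (rule field_le_epsilon)
  fix e :: real assume e: "e > 0"
  have r2: "r2 > 0" using r by simp
  have "eventually (\<lambda>N. 0 < N \<and> (\<forall>x. cmod x = r1 \<longrightarrow> rot_avg v a N x \<le> cmean v a r1 + e) \<and>
      (\<forall>x. cmod x = r2 \<longrightarrow> rot_avg v a N x \<le> cmean v a r2 + e)) sequentially"
    by (intro eventually_conj eventually_gt_at_top rot_avg_eventually_le v r e r2)
  then obtain N where N: "N > 0" "\<And>x. cmod x = r1 \<Longrightarrow> rot_avg v a N x \<le> cmean v a r1 + e"
      "\<And>x. cmod x = r2 \<Longrightarrow> rot_avg v a N x \<le> cmean v a r2 + e"
    by (auto dest!: eventually_happens)
  let ?D = "cball (0::complex) r2 - ball 0 r1" and ?O = "ball (0::complex) r2 - cball 0 r1"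
  let ?h = "\<lambda>x::complex. (\<alpha> + e) + \<beta> * ln (cmod (x - 0))"
  have "rot_avg v a N x \<le> ?h x" if "x \<in> ?D" for x
  proof (rule real_subharmonic_max_principle[OF real_subharmonic_rot_avg[OF v N(1)], of ?D ?O])
    show "compact ?D" by (intro compact_diff) auto
    show "open ?O" by (intro open_Diff) auto
    show "continuous_on ?D ?h" using r by (intro continuous_intros) auto
    show "mean_prop ?h z" if "z \<in> ?O" for z
      using that r by (intro mean_prop_add mean_prop_const mean_prop_cmult mean_prop_ln) auto
    show "rot_avg v a N z \<le> ?h z" if zD: "z \<in> ?D - ?O" for z
    proof -
      have "cmod z = r1 \<or> cmod z = r2" using zD by auto
      then consider "cmod z = r1" | "cmod z = r2" by blast
      then show ?thesis using N(2,3)[of z] line by cases auto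
    qed
  qed (use that in auto)
  then show "cmean v a r \<le> \<alpha> + \<beta> * ln r + e"
    using r r' by (intro cmean_le_of_rot_avg_le[OF v N(1)]) (force simp: algebra_simps)+
qed

lemma cmean_le_sup:
  assumes v: "real_subharmonic v" and le: "\<And>w. dist a w = r \<Longrightarrow> v w \<le> K" and r: "r > 0"
  shows "cmean v a r \<le> K"
proof -
  have "cmean v a r \<le> (\<integral>y. K \<partial>circ)"
    unfolding cmean_def using AE_circ r
    by (intro integral_mono_AE real_subharmonic_integrable[OF v]) (auto elim!: eventually_mono intro!: le simp: norm_mult dist_norm)
  then show ?thesis using circ.prob_space by simp
qed

lemma cmean_tendsto:
  assumes v: "real_subharmonic v"
  shows "(cmean v a \<longlongrightarrow> v a) (at_right 0)"
proof (rule order_tendstoI)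
  fix b assume "b < v a"
  then show "eventually (\<lambda>r. b < cmean v a r) (at_right 0)"
    using real_subharmonic_le_cmean[OF v] by (auto intro!: eventually_at_rightI[of 0 1] intro: less_le_trans)
next
  fix b assume "v a < b"
  then obtain c where c: "v a < c" "c < b" using dense by blast
  then have "eventually (\<lambda>w. v w < c) (nhds a)" using real_subharmonic_usc[OF v] by (auto simp: usc_def)
  then obtain d where d: "d > 0" "\<And>w. dist w a < d \<Longrightarrow> v w < c"
    unfolding eventually_nhds_metric by blast
  have "cmean v a r < b" if "0 < r" "r < d" for r
  proof -
    have "cmean v a r \<le> c" using that d(2) by (intro cmean_le_sup[OF v]) (auto simp: dist_commute intro: less_imp_le)
    then show ?thesis using c by simp
  qed
  then show "eventually (\<lambda>r. cmean v a r < b) (at_right 0)"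
    using d(1) by (auto intro!: eventually_at_rightI[of 0 d])
qed

section \<open>Disc means\<close>

lemma nn_integral_circ_const [simp]: "(\<integral>\<^sup>+y. c \<partial>circ) = c"
  using circ.emeasure_space_1 by simp

text \<open>Transfers planar Lebesgue measure to \<open>real^2\<close>, where the theorems on
  orthogonal transformations apply.\<close>

lemma lborel_complex_eq_distr_vec:
  "distr (lborel :: (real^2) measure) borel (\<lambda>x. Complex (x$1) (x$2)) = lborel"
proof (rule lborel_eqI[symmetric])
  have [measurable]: "(\<lambda>x::real^2. Complex (x$1) (x$2)) \<in> borel_measurable borel"
    by (intro borel_measurable_continuous_onI)
       (auto simp: Complex_eq intro!: continuous_intros)
  fix l u :: complex assume le: "\<And>b. b \<in> Basis \<Longrightarrow> l \<bullet> b \<le> u \<bullet> b"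
  have le': "Re l \<le> Re u" "Im l \<le> Im u" using le[of 1] le[of \<i>] by (simp_all add: Basis_complex_def)
  have eq: "(\<lambda>x::real^2. Complex (x$1) (x$2)) -` box l u = box (vector [Re l, Im l]) (vector [Re u, Im u])"
    by (auto simp: mem_box_cart forall_2 in_box_complex_iff vector_2)
  have "emeasure (distr lborel borel (\<lambda>x::real^2. Complex (x$1) (x$2))) (box l u) =
      emeasure lborel (box (vector [Re l, Im l]) (vector [Re u, Im u] :: real^2))"
    by (subst emeasure_distr) (auto simp: eq)
  also have "\<dots> = ennreal (measure lborel (cbox (vector [Re l, Im l]) (vector [Re u, Im u] :: real^2)))"
    by (simp add: emeasure_lborel_box_eq emeasure_lborel_cbox_eq measure_def)
  also have "measure lborel (cbox (vector [Re l, Im l]) (vector [Re u, Im u] :: real^2)) = (Re u - Re l) * (Im u - Im l)"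
    using le' by (subst content_cbox_cart) (simp_all add: interval_ne_empty_cart forall_2 vector_2 UNIV_2)
  also have "\<dots> = (\<Prod>b\<in>Basis. (u - l) \<bullet> b)"
    by (simp add: Basis_complex_def)
  finally show "emeasure (distr lborel borel (\<lambda>x::real^2. Complex (x$1) (x$2))) (box l u) = (\<Prod>b\<in>Basis. (u - l) \<bullet> b)" .
qed simp

lemma lborel_rotate:
  assumes w: "cmod w = 1"
  shows "distr lborel borel ((*) w) = (lborel :: complex measure)"
proof (rule lborel_eqI[symmetric])
  let ?f = "\<lambda>x::real^2. Complex (x$1) (x$2)"
  let ?g = "\<lambda>z. vector [Re z, Im z] :: real^2"
  have [measurable]: "?f \<in> borel_measurable borel"
    by (intro borel_measurable_continuous_onI) (auto simp: Complex_eq intro!: continuous_intros)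
  have fg: "?f (?g z) = z" for z by (simp add: vector_2)
  have gf: "?g (?f x) = x" for x by (simp add: vec_eq_iff forall_2 vector_2)
  \<comment> \<open>\<open>R\<close> is multiplication by \<open>cnj w\<close>, the inverse
    rotation: the preimage of a box under \<open>w\<close> is its image under
    \<open>R\<close>.\<close>
  define R where "R = (\<lambda>x. ?g (cnj w * ?f x))"
  have ww: "w * cnj w = 1" "cnj w * w = 1" using w complex_norm_square[of w] by (simp_all add: mult.commute)
  have orth: "orthogonal_transformation R"
    unfolding orthogonal_transformation
  proof (intro conjI allI)
    show "linear R" unfolding R_def
      by (intro linearI) (auto simp: vec_eq_iff forall_2 vector_2 algebra_simps)
    have nf: "norm (?f x) = norm x" for x
      by (simp add: norm_vec_def L2_set_def sum_2 cmod_def UNIV_2)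
    have ng: "norm (?g z) = norm z" for z using nf[of "?g z"] fg by simp
    show "norm (R v) = norm v" for v
      using nf[of v] w by (simp only: R_def ng norm_mult complex_mod_cnj mult_1)
  qed
  fix l u :: complex assume le: "\<And>b. b \<in> Basis \<Longrightarrow> l \<bullet> b \<le> u \<bullet> b"
  let ?S = "?f -` box l u"
  have S: "?S = box (vector [Re l, Im l]) (vector [Re u, Im u])"
    by (auto simp: mem_box_cart forall_2 in_box_complex_iff vector_2)
  have im: "?f -` ((*) w -` box l u) = R ` ?S"
  proof (intro set_eqI iffI)
    fix x assume "x \<in> ?f -` ((*) w -` box l u)"
    then have "w * ?f x \<in> box l u" by simp
    then have gS: "?g (w * ?f x) \<in> ?S" by (simp only: vimage_eq fg)
    have "R (?g (w * ?f x)) = ?g ((cnj w * w) * ?f x)"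
      by (simp only: R_def fg mult.assoc)
    then have "R (?g (w * ?f x)) = x" by (simp only: ww mult_1 gf)
    then show "x \<in> R ` ?S" using imageI[OF gS, of R] by (simp only:)
  next
    fix x assume "x \<in> R ` ?S"
    then obtain s where s: "s \<in> ?S" "x = R s" by blast
    have "w * ?f x = (w * cnj w) * ?f s"
      by (simp only: s(2) R_def fg mult.assoc)
    then have "w * ?f x = ?f s" by (simp only: ww mult_1)
    then show "x \<in> ?f -` ((*) w -` box l u)" using s(1) by (simp only: vimage_eq)
  qed
  have "emeasure (distr lborel borel ((*) w)) (box l u) = emeasure lborel ((*) w -` box l u)"
    by (subst emeasure_distr) auto
  also have "\<dots> = emeasure (distr lborel borel ?f) ((*) w -` box l u)"
    by (simp add: lborel_complex_eq_distr_vec)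
  also have "\<dots> = emeasure lborel (R ` ?S)"
    by (subst emeasure_distr) (auto simp: im[symmetric] intro!: measurable_sets_borel[of _ borel])
  also have "\<dots> = emeasure lborel ?S"
  proof -
    have bS: "R ` ?S \<in> sets borel"
      unfolding im[symmetric] by (intro measurable_sets_borel[of _ borel]) auto
    have Sl: "?S \<in> lmeasurable" unfolding S by simp
    have "emeasure lebesgue (R ` ?S) = emeasure lebesgue ?S"
      by (simp only: emeasure_eq_measure2[OF measurable_orthogonal_image[OF orth Sl]]
            emeasure_eq_measure2[OF Sl] measure_orthogonal_image[OF orth Sl])
    then show ?thesis using bS by (simp add: S)
  qed
  also have "\<dots> = emeasure (distr lborel borel ?f) (box l u)"
    by (subst emeasure_distr) auto
  also have "\<dots> = (\<Prod>b\<in>Basis. (u - l) \<bullet> b)"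
    unfolding lborel_complex_eq_distr_vec using le by (simp add: emeasure_lborel_box)
  finally show "emeasure (distr lborel borel ((*) w)) (box l u) = (\<Prod>b\<in>Basis. (u - l) \<bullet> b)" .
qed simp

lemma nn_integral_lborel_rotate:
  assumes [measurable]: "f \<in> borel_measurable borel" and w: "cmod w = 1"
  shows "(\<integral>\<^sup>+z. f (w * z) \<partial>lborel) = (\<integral>\<^sup>+z. f z \<partial>lborel)"
  using nn_integral_distr[of "(*) w" lborel borel f] lborel_rotate[OF w] by simp

lemma nn_integral_lborel_translate:
  fixes a :: complex
  assumes [measurable]: "f \<in> borel_measurable borel"
  shows "(\<integral>\<^sup>+z. f (a + z) \<partial>lborel) = (\<integral>\<^sup>+z. f z \<partial>lborel)"
  using nn_integral_distr[of "(+) a" lborel borel f] lborel_distr_plus[of a] by simp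

interpretation circ_lborel: pair_sigma_finite circ "lborel :: complex measure"
  by standard

text \<open>Polar coordinates without a Jacobian: the integral is averaged over all rotations, the
  order of integration is swapped, and the inner mean depends on |x| only. The radial integral
  remains an integral over a planar disc.\<close>

lemma nn_integral_ball_polar:
  assumes [measurable]: "f \<in> borel_measurable borel"
  shows "(\<integral>\<^sup>+x. indicator (ball a r) x * f x \<partial>lborel) =
    (\<integral>\<^sup>+x. indicator (ball 0 r) x * (\<integral>\<^sup>+y. f (a + of_real (cmod x) * y) \<partial>circ) \<partial>lborel)"
proof -
  let ?G = "\<lambda>x. indicator (ball 0 r) x * f (a + x)"
  have [measurable]: "ball (0::complex) r \<in> sets borel" by simp
  have Gm: "?G \<in> borel_measurable borel" by measurable
  have "(\<integral>\<^sup>+x. indicator (ball a r) x * f x \<partial>lborel) = (\<integral>\<^sup>+x. ?G x \<partial>lborel)"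
    by (subst nn_integral_lborel_translate[symmetric, of _ a])
       (auto intro!: nn_integral_cong simp: indicator_def dist_norm)
  also have "\<dots> = (\<integral>\<^sup>+y. (\<integral>\<^sup>+x. ?G x \<partial>lborel) \<partial>circ)" by (simp only: nn_integral_circ_const)
  also have "\<dots> = (\<integral>\<^sup>+y. (\<integral>\<^sup>+x. ?G (y * x) \<partial>lborel) \<partial>circ)"
  proof (rule nn_integral_cong_AE, use AE_circ in eventually_elim)
    fix y assume "cmod y = 1"
    then show "(\<integral>\<^sup>+x. ?G x \<partial>lborel) = (\<integral>\<^sup>+x. ?G (y * x) \<partial>lborel)"
      by (intro nn_integral_lborel_rotate[symmetric] Gm)
  qed
  also have "\<dots> = (\<integral>\<^sup>+x. (\<integral>\<^sup>+y. ?G (y * x) \<partial>circ) \<partial>lborel)"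
    by (rule circ_lborel.Fubini'[symmetric]) measurable
  also have "\<dots> = (\<integral>\<^sup>+x. indicator (ball 0 r) x * (\<integral>\<^sup>+y. f (a + of_real (cmod x) * y) \<partial>circ) \<partial>lborel)"
  proof (intro nn_integral_cong)
    fix x :: complex
    obtain c where c: "cmod c = 1" "x = of_real (cmod x) * c"
      by (metis rcis_cmod_Arg rcis_def norm_cis)
    have "(\<integral>\<^sup>+y. ?G (y * x) \<partial>circ) = (\<integral>\<^sup>+y. indicator (ball 0 r) x * f (a + y * x) \<partial>circ)"
      by (intro nn_integral_cong_AE) (use AE_circ in eventually_elim, auto simp: indicator_def norm_mult)
    also have "\<dots> = indicator (ball 0 r) x * (\<integral>\<^sup>+y. f (a + y * x) \<partial>circ)"
      by (intro nn_integral_cmult) measurable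
    also have "(\<integral>\<^sup>+y. f (a + y * x) \<partial>circ) = (\<integral>\<^sup>+y. f (a + of_real (cmod x) * (c * y)) \<partial>circ)"
      by (subst c(2)) (simp add: mult_ac)
    also have "\<dots> = (\<integral>\<^sup>+y. f (a + of_real (cmod x) * y) \<partial>circ)"
      by (rule nn_integral_circ_rotate[OF _ c(1)]) measurable
    finally show "(\<integral>\<^sup>+y. ?G (y * x) \<partial>circ) = indicator (ball 0 r) x * (\<integral>\<^sup>+y. f (a + of_real (cmod x) * y) \<partial>circ)" .
  qed
  finally show ?thesis .
qed

section \<open>Area means and a Harnack inequality\<close>

lemma nn_integral_circ_diff:
  assumes v: "real_subharmonic v" and K: "\<And>w. dist a w = r \<Longrightarrow> v w \<le> K" and r: "r \<ge> 0"
  shows "(\<integral>\<^sup>+y. ennreal (K - v (a + of_real r * y)) \<partial>circ) = ennreal (K - cmean v a r)"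
proof -
  have "(\<integral>\<^sup>+y. ennreal (K - v (a + of_real r * y)) \<partial>circ) = ennreal (\<integral>y. K - v (a + of_real r * y) \<partial>circ)"
  proof (rule nn_integral_eq_integral)
    show "integrable circ (\<lambda>y. K - v (a + of_real r * y))"
      using real_subharmonic_integrable[OF v] by simp
    show "AE y in circ. 0 \<le> K - v (a + of_real r * y)"
      using AE_circ by eventually_elim (use K r in \<open>auto simp: dist_norm norm_mult\<close>)
  qed
  then show ?thesis using real_subharmonic_integrable[OF v] circ.prob_space by (simp add: cmean_def)
qed

lemma emeasure_ball_complex: "r \<ge> 0 \<Longrightarrow> emeasure lborel (ball (a::complex) r) = ennreal (pi * r\<^sup>2)"
  by (simp add: emeasure_ball unit_ball_vol_2)

text \<open>In polar form the integrand is K minus the circle mean of radius |x|, and by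
  monotonicity this mean lies between \<open>v a\<close> and the mean of radius r.\<close>

lemma
  assumes v: "real_subharmonic v" and K: "\<And>w. dist a w < r \<Longrightarrow> v w \<le> K" and r: "r > 0"
  shows nn_integral_ball_le: "(\<integral>\<^sup>+x. indicator (ball a r) x * ennreal (K - v x) \<partial>lborel) \<le> ennreal (pi * r\<^sup>2 * (K - v a))" (is ?A)
    and nn_integral_ball_ge: "ennreal (pi * r\<^sup>2 * (K - cmean v a r)) \<le> (\<integral>\<^sup>+x. indicator (ball a r) x * ennreal (K - v x) \<partial>lborel)" (is ?B)
proof -
  note [measurable] = real_subharmonic_borel[OF v]
  have "(\<integral>\<^sup>+x. indicator (ball a r) x * ennreal (K - v x) \<partial>lborel) = 
    (\<integral>\<^sup>+x. indicator (ball 0 r) x * (\<integral>\<^sup>+y. ennreal (K - v (a + of_real (cmod x) * y)) \<partial>circ) \<partial>lborel)"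
    by (rule nn_integral_ball_polar) measurable
  also have "\<dots> = (\<integral>\<^sup>+x. indicator (ball 0 r) x * ennreal (K - cmean v a (cmod x)) \<partial>lborel)"
    by (intro nn_integral_cong) (use K in \<open>auto simp: indicator_def intro!: nn_integral_circ_diff[OF v]\<close>)
  finally have eq: "(\<integral>\<^sup>+x. indicator (ball a r) x * ennreal (K - v x) \<partial>lborel) = (\<integral>\<^sup>+x. indicator (ball 0 r) x * ennreal (K - cmean v a (cmod x)) \<partial>lborel)" .
  have const: "(\<integral>\<^sup>+x. indicator (ball (0::complex) r) x * ennreal c \<partial>lborel) = ennreal (pi * r\<^sup>2 * c)" for c
    using r by (subst nn_integral_multc) (auto simp: emeasure_ball_complex ennreal_mult' intro: borel_measurable_indicator)
  have "(\<integral>\<^sup>+x. indicator (ball 0 r) x * ennreal (K - cmean v a (cmod x)) \<partial>lborel) \<le> (\<integral>\<^sup>+x. indicator (ball (0::complex) r) x * ennreal (K - v a) \<partial>lborel)"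
  proof (intro nn_integral_mono mult_left_mono ennreal_leI)
    fix x
    have "v a \<le> cmean v a (cmod x)"
      \<comment> \<open>At x = 0 the circle degenerates, and its mean is \<open>v a\<close> because
        \<open>circ\<close> has mass 1.\<close>
      by (cases "x = 0") (use real_subharmonic_le_cmean[OF v] circ.prob_space in \<open>auto simp: cmean_def\<close>)
    then show "K - cmean v a (cmod x) \<le> K - v a" by simp
  qed auto
  then show ?A using eq const by simp
  have "(\<integral>\<^sup>+x. indicator (ball (0::complex) r) x * ennreal (K - cmean v a r) \<partial>lborel) \<le> (\<integral>\<^sup>+x. indicator (ball 0 r) x * ennreal (K - cmean v a (cmod x)) \<partial>lborel)"
  proof (intro nn_integral_mono)
    fix x :: complex
    have v0: "v a \<le> cmean v a r" by (rule real_subharmonic_le_cmean[OF v r])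
    have "cmean v a (cmod x) \<le> cmean v a r" if "cmod x < r"
      using that v0 cmean_mono[OF v, of "cmod x" r a] circ.prob_space by (cases "x = 0") (auto simp: cmean_def)
    then show "indicator (ball 0 r) x * ennreal (K - cmean v a r) \<le> indicator (ball 0 r) x * ennreal (K - cmean v a (cmod x))"
      by (auto simp: indicator_def intro!: ennreal_leI)
  qed
  then show ?B using eq const by simp
qed

text \<open>K - v is nonnegative on \<open>ball a r\<close>, so its integral over
  \<open>ball a (r/4)\<close> is at most that over \<open>ball x (r/2)\<close>, which still lies in
  \<open>ball a r\<close>. The two area estimates then lose only the ratio (r/4)^2 / (r/2)^2 =
  1/4.\<close>

lemma harnack_quarter:
  assumes v: "real_subharmonic v" and K: "\<And>w. dist a w < r \<Longrightarrow> v w \<le> K" and r: "r > 0" and x: "dist a x \<le> r / 4"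
  shows "(K - cmean v a r) / 4 \<le> K - v x"
proof -
  have sub: "dist a w < r" if "dist x w < r / 2" for w
    using dist_triangle[of a w x] x that r by simp
  have "ennreal (pi * (r/4)\<^sup>2 * (K - cmean v a r)) \<le> ennreal (pi * (r/4)\<^sup>2 * (K - cmean v a (r/4)))"
    using cmean_mono[OF v, of "r/4" r a] r by (intro ennreal_leI mult_left_mono) auto
  also have "\<dots> \<le> (\<integral>\<^sup>+z. indicator (ball a (r/4)) z * ennreal (K - v z) \<partial>lborel)"
    using K r by (intro nn_integral_ball_ge[OF v]) auto
  also have "\<dots> \<le> (\<integral>\<^sup>+z. indicator (ball x (r/2)) z * ennreal (K - v z) \<partial>lborel)"
  proof (intro nn_integral_mono mult_right_mono)
    fix z
    have "dist x z < r/2" if "dist a z < r/4"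
      using dist_triangle[of x z a] x that by (simp add: dist_commute)
    then show "indicator (ball a (r/4)) z \<le> (indicator (ball x (r/2)) z :: ennreal)"
      by (auto simp: indicator_def)
  qed auto
  also have "\<dots> \<le> ennreal (pi * (r/2)\<^sup>2 * (K - v x))"
    using K r sub by (intro nn_integral_ball_le[OF v]) auto
  finally have *: "ennreal (pi * (r/4)\<^sup>2 * (K - cmean v a r)) \<le> ennreal (pi * (r/2)\<^sup>2 * (K - v x))" .
  have "0 \<le> K - v x" using K[of x] x r by simp
  then have "pi * (r/4)\<^sup>2 * (K - cmean v a r) \<le> pi * (r/2)\<^sup>2 * (K - v x)"
    using * by (subst (asm) ennreal_le_iff) auto
  then have "(pi * r\<^sup>2) * ((K - cmean v a r) / 16) \<le> (pi * r\<^sup>2) * ((K - v x) / 4)"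
    by (simp add: power2_eq_square field_simps)
  then have "(K - cmean v a r) / 16 \<le> (K - v x) / 4"
    using r by (subst (asm) mult_le_cancel_left_pos) auto
  then show ?thesis by simp
qed

section \<open>Convexity in the logarithm of the radius\<close>

lemma cmean_exp_convex:
  assumes v: "real_subharmonic v"
  shows "convex_on UNIV (\<lambda>x. cmean v a (exp x))"
proof (rule convex_onI)
  fix t x y :: real assume t: "0 < t" "t < 1" 
  have key: "cmean v a (exp ((1-t) * x + t * y)) \<le> (1-t) * cmean v a (exp x) + t * cmean v a (exp y)"
    if xy: "x < y" and t: "0 < t" "t < 1" for x y t :: real
  proof -
    let ?f = "\<lambda>x. cmean v a (exp x)"
    define \<beta> where "\<beta> = (?f y - ?f x) / (y - x)"
    define \<alpha> where "\<alpha> = ?f x - \<beta> * x"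
    have b: "\<beta> * (y - x) = ?f y - ?f x" using xy by (simp add: \<beta>_def)
    have ey: "?f y = \<alpha> + \<beta> * y" using b by (simp add: \<alpha>_def algebra_simps)
    have ex: "?f x = \<alpha> + \<beta> * x" by (simp add: \<alpha>_def)
    have bet: "x \<le> (1-t) * x + t * y" "(1-t) * x + t * y \<le> y"
    proof -
      have "(1-t) * x + t * y = x + t * (y - x)" "(1-t) * x + t * y = y - (1 - t) * (y - x)" by (simp_all add: algebra_simps)
      moreover have "0 \<le> t * (y - x)" "0 \<le> (1-t) * (y-x)" using xy t by auto
      ultimately show "x \<le> (1-t) * x + t * y" "(1-t) * x + t * y \<le> y" by linarith+
    qed
    have "?f ((1-t) * x + t * y) \<le> \<alpha> + \<beta> * ln (exp ((1-t) * x + t * y))"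
      by (rule cmean_log_convex[OF v, of "exp x" "exp y"]) (simp_all add: xy bet ex[symmetric] ey[symmetric] del: ln_exp, simp_all add: ex ey)
    also have "\<dots> = (1-t) * ?f x + t * ?f y" unfolding ex ey ln_exp by (simp add: algebra_simps)
    finally show ?thesis .
  qed
  show "cmean v a (exp ((1 - t) *\<^sub>R x + t *\<^sub>R y)) \<le> (1 - t) * cmean v a (exp x) + t * cmean v a (exp y)"
  proof (cases x y rule: linorder_cases)
    case less then show ?thesis using key[OF less t] by simp
  next
    case equal then show ?thesis by (simp add: algebra_simps)
  next
    case greater then show ?thesis using key[OF greater, of "1-t"] t by (simp add: algebra_simps)
  qed
qed simp

text \<open>Both slopes are compared with that of the secant from \<open>t1\<close> to
  \<open>s1\<close>. In this form, a small gain of the mean between two large radii controls the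
  increments at all smaller radii.\<close>

lemma cmean_slope_le:
  assumes v: "real_subharmonic v" and t: "0 < t1" "t1 < t2" "t2 \<le> s1" "s1 < s2"
  shows "(cmean v a t2 - cmean v a t1) / (ln t2 - ln t1) \<le> (cmean v a s2 - cmean v a s1) / (ln s2 - ln s1)"
proof -
  let ?f = "\<lambda>x. cmean v a (exp x)"
  have pos: "t2 > 0" "s1 > 0" "s2 > 0" using t by auto
  have swap: "(p - q) / (r - s) = (q - p) / (s - r)" for p q r s :: real
    by (metis minus_diff_eq minus_divide_divide)
  have sl: "(?f t - ?f x) / (t - x) \<le> (?f y - ?f x) / (y - x)" "(?f y - ?f x) / (y - x) \<le> (?f y - ?f t) / (y - t)"
    if "x < t" "t < y" for x t y
    using convex_on_slope_le[OF cmean_exp_convex[OF v, of a], of x y t] that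
      swap[of "?f t" "?f x" t x] swap[of "?f y" "?f x" y x] swap[of "?f y" "?f t" y t] by simp_all
  have l: "ln t1 < ln t2" "ln t2 \<le> ln s1" "ln s1 < ln s2" using t pos by auto
  have "(?f (ln t2) - ?f (ln t1)) / (ln t2 - ln t1) \<le> (?f (ln s1) - ?f (ln t1)) / (ln s1 - ln t1)"
    using l sl(1)[of "ln t1" "ln t2" "ln s1"] by (cases "ln t2 = ln s1") auto
  also have "\<dots> \<le> (?f (ln s2) - ?f (ln s1)) / (ln s2 - ln s1)"
    using l sl[of "ln t1" "ln s1" "ln s2"] by linarith
  finally show ?thesis using t pos by simp
qed

section \<open>Lower bounds for circle means far out\<close>

text \<open>If the mean over the circle of radius \<open>\<surd>\<bar>a\<bar>/2\<close> about \<open>a\<close> were too small, then \<open>v\<close> would be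
too small on a disc about \<open>a\<close>; comparing \<open>v\<close> with \<open>\<sigma> ln \<bar>z\<bar>\<close> minus a multiple of the Green function
of the exterior of the unit disc with pole \<open>a\<close> makes \<open>v\<close> too small on the whole circle
\<open>\<bar>z\<bar> = \<bar>a\<bar>\<close>.\<close>
lemma cmean_ge_of_growth:
  fixes \<sigma> C \<epsilon> R0 :: real
  assumes \<sigma>: "\<sigma> \<ge> 0" and C: "C \<ge> 0" and \<epsilon>: "\<epsilon> > 0"
  shows "\<exists>R\<ge>9. \<forall>v. real_subharmonic v \<longrightarrow> (\<forall>z. v z \<le> \<sigma> * ln (max 1 (cmod z)) + C) \<longrightarrow>
      (\<forall>r\<ge>R0. \<exists>z. cmod z = r \<and> v z \<ge> (\<sigma> - \<epsilon>/24) * ln r) \<longrightarrow>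
      (\<forall>a. cmod a \<ge> R \<longrightarrow> (\<sigma> - \<epsilon>) * ln (cmod a) \<le> cmean v a (sqrt (cmod a) / 2))"
proof -
  \<comment> \<open>Harnack turns a deficit \<epsilon> L of the mean into a deficit \<epsilon> L / 4
    = 3 \<kappa> L on a small disc, and the Green function is at most 3 L on the boundary of that
    disc.\<close>
  define \<kappa> where "\<kappa> = \<epsilon> / 12"
  have \<kappa>: "\<kappa> > 0" using \<epsilon> by (simp add: \<kappa>_def)
  \<comment> \<open>One \<sigma> ln 2 comes from \<open>K\<close>, the other from |z| \<ge> A / 2 on
    the boundary of the small disc.\<close>
  define C' where "C' = C + 2 * \<sigma> * ln 2"
  \<comment> \<open>The exponential makes \<kappa> L / 4, the margin left in the final comparison,
    exceed C' + 2 \<kappa>. The 9 gives sqrt A \<ge> 3 and absorbs ln 24 below.\<close>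
  define R where "R = max (max 9 R0) (exp (4 * (C' + 2 * \<kappa>) / \<kappa>) + 1)"
  show ?thesis
  proof (rule exI[of _ R], safe)
    show "9 \<le> R" by (simp add: R_def)
    fix v a
    assume v: "real_subharmonic v" and gr: "\<forall>z. v z \<le> \<sigma> * ln (max 1 (cmod z)) + C"
      and lo: "\<forall>r\<ge>R0. \<exists>z. cmod z = r \<and> v z \<ge> (\<sigma> - \<epsilon>/24) * ln r"
      and a: "R \<le> cmod a"
    define A where "A = cmod a"
    define L where "L = ln A"
    define \<rho> where "\<rho> = sqrt A / 2"
    have A: "A \<ge> 9" "A \<ge> R0" "A > exp (4 * (C' + 2 * \<kappa>) / \<kappa>)"
      using a by (auto simp: A_def R_def)
    have a0: "a \<noteq> 0" using A by (auto simp: A_def)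
    have "ln (exp (4 * (C' + 2 * \<kappa>) / \<kappa>)) < L"
      unfolding L_def using A by (subst ln_less_cancel_iff) auto
    then have L: "4 * (C' + 2 * \<kappa>) < \<kappa> * L" using \<kappa> by (simp add: field_simps)
    have sA: "3 \<le> sqrt A" "sqrt A * sqrt A = A"
      using A by (auto intro: real_le_rsqrt)
    then have sA2: "3 * sqrt A \<le> A" using mult_right_mono[of 3 "sqrt A" "sqrt A"] by simp
    have \<rho>: "\<rho> > 0" "\<rho> \<le> A" "4 * \<rho> \<le> A * 2" using sA sA2 A by (auto simp: \<rho>_def)
    have C'0: "C' \<ge> C" using \<sigma> by (simp add: C'_def)
    have ln4: "ln 4 < (2::real)" using ln_2_less_1 ln_realpow[of 2 2] by simp
    have Lpos: "L > 0" using A by (simp add: L_def)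
    define K where "K = \<sigma> * (ln 2 + L) + C"
    have le_K: "v w \<le> K" if "cmod w \<le> 2 * A" for w
    proof -
      have "ln (max 1 (cmod w)) \<le> ln (2 * A)" using that A by (subst ln_le_cancel_iff) auto
      also have "\<dots> = ln 2 + L" using A by (simp add: ln_mult L_def)
      finally have "\<sigma> * ln (max 1 (cmod w)) \<le> \<sigma> * (ln 2 + L)" using \<sigma> by (rule mult_left_mono)
      then show ?thesis using gr[rule_format, of w] by (simp add: K_def)
    qed
    show "(\<sigma> - \<epsilon>) * ln (cmod a) \<le> cmean v a (sqrt (cmod a) / 2)"
    proof (rule ccontr)
      assume "\<not> ?thesis"
      then have less: "cmean v a \<rho> < (\<sigma> - \<epsilon>) * L" by (simp add: A_def L_def \<rho>_def)
      have disc: "v x \<le> K - 3 * \<kappa> * L" if "dist a x \<le> \<rho> / 4" for x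
      proof -
        have H: "(K - cmean v a \<rho>) / 4 \<le> K - v x"
        proof (rule harnack_quarter[OF v _ \<rho>(1) that])
          fix w assume "dist a w < \<rho>"
          then have "cmod w \<le> 2 * A" using norm_triangle_ineq2[of w a] \<rho> by (simp add: A_def dist_norm norm_minus_commute)
          then show "v w \<le> K" by (rule le_K)
        qed
        have "K \<ge> \<sigma> * L" using \<sigma> C by (simp add: K_def distrib_left)
        moreover have "cmean v a \<rho> < \<sigma> * L - \<epsilon> * L" using less by (simp add: left_diff_distrib)
        ultimately have "\<epsilon> * L \<le> K - cmean v a \<rho>" by linarith
        then have "\<epsilon> * L / 4 \<le> (K - cmean v a \<rho>) / 4" by (rule divide_right_mono) simp
        from this H have "\<epsilon> * L / 4 \<le> K - v x" by (rule order_trans)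
        moreover have "3 * \<kappa> * L = \<epsilon> * L / 4" by (simp add: \<kappa>_def)
        ultimately show ?thesis by linarith
      qed
      \<comment> \<open>\<open>b\<close> is the reflection of \<open>a\<close> in the unit circle,
        so that \<open>G\<close> is the Green function ln (|1 - cnj a z| / |z - a|), written through
        distances to two points outside the comparison domain, as \<open>mean_prop_ln\<close>
        requires.\<close>
      define b where "b = 1 / cnj a"
      define G where "G = (\<lambda>z. L + ln (cmod (z - b)) - ln (cmod (z - a)))"
      have ab: "A * cmod (z - b) = cmod (1 - cnj a * z)" for z
      proof -
        have "A * cmod (z - b) = cmod (cnj a * (z - b))" by (simp add: norm_mult A_def)
        also have "cnj a * (z - b) = - (1 - cnj a * z)" using a0 by (simp add: b_def algebra_simps)
        finally show ?thesis by (simp only: norm_minus_cancel)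
      qed
      have bsmall: "cmod b < 1" using A a0 by (simp add: b_def norm_divide A_def divide_less_eq_1)
      have zb: "z \<noteq> b" if "cmod z \<ge> 1" for z using that bsmall by auto
      have G_eq: "G z = ln (cmod (1 - cnj a * z)) - ln (cmod (z - a))" if "cmod z \<ge> 1" for z
      proof -
        have "ln (cmod (1 - cnj a * z)) = L + ln (cmod (z - b))"
          using zb[OF that] A by (simp add: ab[symmetric] ln_mult L_def)
        then show ?thesis by (simp add: G_def)
      qed
      \<comment> \<open>The extra slope \<tau> serves on the outer circle |z| = Q, where
        \<open>G\<close> may reach ln (4 A): there \<tau> ln Q pays for \<kappa> G. The value
        \<kappa> / 4 keeps \<kappa> - \<tau> - \<kappa>/2 = \<kappa>/4 in reserve.\<close>
      define \<tau> where "\<tau> = \<kappa> / 4"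
      have \<tau>: "\<tau> > 0" using \<kappa> by (simp add: \<tau>_def)
      define Q where "Q = max (2 * A) (exp (\<kappa> * ln (4 * A) / \<tau>))"
      have Q: "Q \<ge> 2 * A" "Q > 0" using A by (auto simp: Q_def)
      have "\<kappa> * ln (4 * A) / \<tau> \<le> ln Q"
        using Q by (subst ln_ge_iff) (auto simp: Q_def)
      then have lnQ: "\<kappa> * ln (4 * A) \<le> \<tau> * ln Q" using \<tau> by (simp add: field_simps)
      define h where "h = (\<lambda>z. (C' - \<kappa> * L) + (\<sigma> + \<tau>) * ln (cmod (z - 0)) + (-\<kappa>) * ln (cmod (z - b)) + \<kappa> * ln (cmod (z - a)))"
      have h_eq: "h z = (\<sigma> + \<tau>) * ln (cmod z) + C' - \<kappa> * G z" for z
        by (simp add: h_def G_def algebra_simps)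
      let ?D = "(cball (0::complex) Q - ball 0 1) - ball a (\<rho>/4)"
      let ?O = "(ball (0::complex) Q - cball 0 1) - cball a (\<rho>/4)"
      have vh: "v z \<le> h z" if zD: "z \<in> ?D" for z
      proof (rule real_subharmonic_max_principle[OF v, of ?D ?O h])
        show "compact ?D" by (intro compact_diff) auto
        show "open ?O" by (intro open_Diff) auto
        show "?O \<subseteq> ?D" by auto
        show "continuous_on ?D h" unfolding h_def
          using \<rho> zb by (intro continuous_intros) auto
        show "mean_prop h z" if "z \<in> ?O" for z
          unfolding h_def using that \<rho> zb[of z]
          by (intro mean_prop_add mean_prop_const mean_prop_cmult mean_prop_ln) auto
        show "z \<in> ?D" by (rule zD)
        fix z assume "z \<in> ?D - ?O"
        then have "1 \<le> cmod z" "cmod z \<le> Q" "\<rho>/4 \<le> cmod (z - a)" "cmod z = 1 \<or> cmod (z - a) = \<rho>/4 \<or> cmod z = Q"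
          by (auto simp: dist_norm norm_minus_commute)
        then consider "cmod z = 1" | "cmod (z - a) = \<rho>/4" | "cmod z = Q" by blast
        then show "v z \<le> h z"
        proof cases
          case 1
          \<comment> \<open>The reflection identity makes \<open>G\<close> vanish on the unit
            circle, where no more than the bound C on v is available.\<close>
          have "1 - cnj a * z = z * (cnj z - cnj a)"
            using 1 complex_norm_square[of z] by (simp add: algebra_simps)
          then have "cmod (1 - cnj a * z) = cmod (cnj (z - a))" using 1 by (simp add: norm_mult)
          then have "G z = 0" using G_eq[of z] 1 by (simp del: complex_cnj_diff)
          then show ?thesis using gr[rule_format, of z] 1 C'0 by (simp add: h_eq)
        next
          case 2
          have zA: "cmod z \<ge> A / 2" "cmod z \<le> 2 * A"
            using norm_triangle_ineq2[of z a] norm_triangle_ineq2[of a z] 2 \<rho> by (auto simp: A_def norm_minus_commute)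
          have z1: "cmod z \<ge> 1" using zA A by simp
          have "cmod (1 - cnj a * z) \<le> 1 + A * cmod z"
            using norm_triangle_ineq4[of 1 "cnj a * z"] by (simp add: norm_mult A_def)
          also have "\<dots> \<le> 1 + A * (2 * A)" using zA A by (intro add_left_mono mult_left_mono) auto
          also have "\<dots> \<le> 3 * (A * A)" using A mult_mono[of 1 A 1 A] by simp
          finally have n: "cmod (1 - cnj a * z) \<le> 3 * (A * A)" .
          have "cmod (1 - cnj a * z) > 0" using zb[OF z1] A ab[of z] by (metis less_le_trans mult_pos_pos norm_ge_zero right_minus_eq zero_less_norm_iff zero_less_numeral)
          then have "ln (cmod (1 - cnj a * z)) \<le> ln (3 * (A * A))" using ln_mono[OF n] by blast
          also have "\<dots> = ln 3 + 2 * L" using A by (simp add: ln_mult L_def)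
          finally have 3: "ln (cmod (1 - cnj a * z)) \<le> ln 3 + 2 * L" .
          have "cmod (z - a) = sqrt A / 8" using 2 by (simp add: \<rho>_def)
          moreover have "ln (sqrt A / 8) = ln (sqrt A) - ln 8" using A by (simp add: ln_div)
          moreover have "ln (sqrt A) = L / 2" using A by (simp add: ln_sqrt L_def)
          ultimately have 4: "ln (cmod (z - a)) = L / 2 - ln 8" by (simp only:)
          \<comment> \<open>Here \<open>G\<close> is at most (2 - 1/2) L + ln 24; the constant is
            absorbed because 24 \<le> 27 = 9 powr (3/2) and A \<ge> 9.\<close>
          have "ln 3 + ln 8 \<le> 3/2 * L"
          proof -
            have "ln 3 + ln 8 = ln (24::real)" using ln_mult[of 3 "8::real"] by simp
            also have "\<dots> \<le> ln 27" by simp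
            also have "\<dots> = 3 * ln 3" using ln_realpow[of 3 3] by simp
            also have "\<dots> = 3/2 * ln 9" using ln_realpow[of 3 2] by simp
            also have "\<dots> \<le> 3/2 * L" using A by (simp add: L_def)
            finally show ?thesis .
          qed
          then have "G z \<le> 3 * L" using G_eq[OF z1] 3 4 by simp
          then have i: "\<kappa> * G z \<le> \<kappa> * (3 * L)" using \<kappa> by (intro mult_left_mono) auto
          have "ln (A / 2) \<le> ln (cmod z)" using zA A z1 by (subst ln_le_cancel_iff) auto
          then have ii: "(\<sigma> + \<tau>) * ln (A / 2) \<le> (\<sigma> + \<tau>) * ln (cmod z)" using \<sigma> \<tau> by (intro mult_left_mono) auto
          have "ln (A / 2) = L - ln 2" using A by (simp add: ln_div L_def)
          then have iii: "\<sigma> * ln (A / 2) = \<sigma> * L - \<sigma> * ln 2" by (simp add: right_diff_distrib)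
          have iv: "0 \<le> \<tau> * ln (A / 2)" using \<tau> A by auto
          have "(\<sigma> + \<tau>) * ln (A / 2) = \<sigma> * ln (A / 2) + \<tau> * ln (A / 2)" by (simp add: distrib_right)
          moreover have "K = \<sigma> * ln 2 + \<sigma> * L + C" by (simp add: K_def distrib_left)
          moreover have "C' = C + 2 * (\<sigma> * ln 2)" by (simp add: C'_def)
          moreover have "3 * \<kappa> * L = \<kappa> * (3 * L)" by simp
          ultimately have "K - 3 * \<kappa> * L \<le> h z"
            unfolding h_eq using i ii iii iv by linarith
          moreover have "v z \<le> K - 3 * \<kappa> * L" using 2 by (intro disc) (simp add: dist_norm norm_minus_commute)
          ultimately show ?thesis by simp
        next
          case 3
          have z1: "cmod z \<ge> 1" using 3 Q A by simp
          have "cmod (1 - cnj a * z) \<le> 1 + A * Q"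
            using norm_triangle_ineq4[of 1 "cnj a * z"] 3 by (simp add: norm_mult A_def)
          also have "\<dots> \<le> 2 * A * Q" using A Q mult_mono[of 1 A 1 Q] by simp
          finally have n: "cmod (1 - cnj a * z) \<le> 2 * A * Q" .
          have "cmod (1 - cnj a * z) > 0" using zb[OF z1] A ab[of z] by (metis less_le_trans mult_pos_pos norm_ge_zero right_minus_eq zero_less_norm_iff zero_less_numeral)
          then have "ln (cmod (1 - cnj a * z)) \<le> ln (2 * A * Q)" using ln_mono[OF n] by blast
          moreover have "cmod (z - a) \<ge> Q / 2" using norm_triangle_ineq2[of z a] 3 Q by (simp add: A_def)
          then have "ln (Q / 2) \<le> ln (cmod (z - a))" using Q by (subst ln_le_cancel_iff) auto
          moreover have "ln (2 * A * Q) - ln (Q / 2) = ln (4 * A)"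
            using A Q ln_mult[of 2 2] by (simp add: ln_mult ln_div)
          ultimately have "G z \<le> ln (4 * A)" using G_eq[OF z1] by simp
          then have "\<kappa> * G z \<le> \<kappa> * ln (4 * A)" using \<kappa> by (intro mult_left_mono) auto
          then have "\<sigma> * ln Q + C \<le> h z" using lnQ C'0 unfolding h_eq 3 by (simp add: algebra_simps)
          moreover have "v z \<le> \<sigma> * ln Q + C" using gr[rule_format, of z] 3 z1 by (simp add: max_def split: if_splits)
          ultimately show ?thesis by simp
        qed
      qed
      obtain z where z: "cmod z = A" "(\<sigma> - \<kappa>/2) * L \<le> v z"
        using lo[rule_format, OF A(2)] by (auto simp: \<kappa>_def L_def)
      show False
      proof (cases "dist a z \<le> \<rho> / 4")
        case True
        then have "v z \<le> K - 3 * \<kappa> * L" by (rule disc)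
        moreover have "0 \<le> \<sigma> * ln 2" using \<sigma> by simp
        moreover have "\<kappa> * L > 0" using \<kappa> Lpos by simp
        ultimately show False using z L \<kappa> C by (simp add: K_def C'_def algebra_simps)
      next
        case False
        have z1: "cmod z \<ge> 1" using z A by simp
        have "v z \<le> h z" using False z Q A by (intro vh) auto
        \<comment> \<open>On |z| = A the quotient |1 - cnj a z| / |z - a| is at least (A^2 / 2) / (2
          A) = A / 4 wherever z lies, which is why a deficit near a depresses the whole
          circle.\<close>
        moreover have "L - ln 4 \<le> G z"
        proof -
          have za: "0 < cmod (z - a)" "cmod (z - a) \<le> 2 * A"
            using False \<rho> norm_triangle_ineq4[of z a] z by (auto simp: A_def)
          have "A * A - 1 \<le> cmod (1 - cnj a * z)"
            using norm_triangle_ineq2[of "cnj a * z" 1] z by (simp add: norm_mult A_def norm_minus_commute)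
          moreover have "A * A / 2 \<le> A * A - 1" using A mult_mono[of 9 A 9 A] by simp
          ultimately have n: "A * A / 2 \<le> cmod (1 - cnj a * z)" by simp
          have "ln (A * A / 2) \<le> ln (cmod (1 - cnj a * z))"
            using A by (intro ln_mono[OF n]) auto
          moreover have "ln (cmod (z - a)) \<le> ln (2 * A)" using za A by (subst ln_le_cancel_iff) auto
          moreover have "ln (A * A / 2) - ln (2 * A) = L - ln 4"
            using A ln_mult[of 2 "2::real"] by (simp add: ln_mult ln_div L_def)
          ultimately show ?thesis using G_eq[OF z1] by simp
        qed
        then have "\<kappa> * (L - ln 4) \<le> \<kappa> * G z" using \<kappa> by (intro mult_left_mono) auto
        moreover have "\<kappa> * ln 4 \<le> \<kappa> * 2" using \<kappa> ln4 by (intro mult_left_mono) auto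
        ultimately have "v z \<le> (\<sigma> + \<tau>) * L + C' - \<kappa> * L + \<kappa> * 2"
          unfolding h_eq z L_def[symmetric] by (simp add: algebra_simps)
        then show False using z L \<kappa> C C'0 by (simp add: \<tau>_def algebra_simps)
      qed
    qed
  qed
qed

section \<open>Increments of circle means\<close>

text \<open>A test function supported in the disc of radius \<open>L\<close>. Squaring the positive
  part makes the gradient Lipschitz, so circle means differ from the value only to order t^2; this
  is the source of the factor 4^(-k).\<close>

definition bump :: "real \<Rightarrow> complex \<Rightarrow> real" where
  "bump L z = (max 0 (L\<^sup>2 - (cmod z)\<^sup>2))\<^sup>2"

lemma bump_borel [measurable]: "bump L \<in> borel_measurable borel"
  unfolding bump_def by measurable

lemma bump_nonneg: "0 \<le> bump L z" by (simp add: bump_def)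

lemma bump_le: "bump L z \<le> L^4"
proof -
  have "(max 0 (L\<^sup>2 - (cmod z)\<^sup>2))\<^sup>2 \<le> (L\<^sup>2)\<^sup>2" by (intro power_mono) auto
  then show ?thesis by (simp add: bump_def power_mult[symmetric])
qed

lemma bump_eq_0: "0 \<le> L \<Longrightarrow> L \<le> cmod z \<Longrightarrow> bump L z = 0"
  by (simp add: bump_def power_mono)

lemma bump_ge:
  assumes "cmod z < L / 2"
  shows "L^4 / 2 \<le> bump L z"
proof -
  have L: "L > 0" using assms norm_ge_zero[of z] by linarith
  have "(cmod z)\<^sup>2 \<le> (L/2)\<^sup>2" using assms by (intro power_mono) auto
  then have "3/4 * L\<^sup>2 \<le> max 0 (L\<^sup>2 - (cmod z)\<^sup>2)"
    by (intro max.coboundedI2) (simp add: power_divide)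
  then have "(3/4 * L\<^sup>2)\<^sup>2 \<le> bump L z" unfolding bump_def by (intro power_mono) auto
  moreover have "L^4 / 2 \<le> (3/4 * L\<^sup>2)\<^sup>2" by (simp add: power_mult_distrib power_mult[symmetric] power_divide)
  ultimately show ?thesis by simp
qed

text \<open>First order Taylor estimate: the squared positive part has derivative 2 max 0 p, which
  is Lipschitz with constant 2.\<close>

lemma pos_square_taylor:
  fixes p q :: real
  shows "\<bar>(max 0 q)\<^sup>2 - (max 0 p)\<^sup>2 - 2 * max 0 p * (q - p)\<bar> \<le> (q - p)\<^sup>2"
proof -
  have sq: "0 \<le> q * q" "0 \<le> p * p" by auto
  consider "p \<ge> 0" "q \<ge> 0" | "p \<ge> 0" "q < 0" | "p < 0" "q \<ge> 0" | "p < 0" "q < 0" by linarith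
  then show ?thesis
  proof cases
    case 1
    then have "(max 0 q)\<^sup>2 - (max 0 p)\<^sup>2 - 2 * max 0 p * (q - p) = (q - p)\<^sup>2"
      by (simp add: power2_eq_square algebra_simps)
    then show ?thesis by simp
  next
    case 2
    have "p * q \<le> 0" using 2 by (simp add: mult_nonneg_nonpos)
    moreover have "(max 0 q)\<^sup>2 - (max 0 p)\<^sup>2 - 2 * max 0 p * (q - p) = p * p - 2 * (p * q)"
      using 2 by (simp add: power2_eq_square algebra_simps)
    moreover have "(q - p)\<^sup>2 = q * q + p * p - 2 * (p * q)"
      by (simp add: power2_eq_square algebra_simps)
    ultimately show ?thesis using sq by linarith
  next
    case 3
    have "p * q \<le> 0" using 3 by (simp add: mult_nonpos_nonneg)
    then show ?thesis using 3 sq by (simp add: power2_eq_square algebra_simps abs_if)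
  next
    case 4 then show ?thesis by simp
  qed
qed

text \<open>The integrand is odd and \<open>circ\<close> is invariant under y -> -y. This removes
  the first order term of the bump.\<close>

lemma integral_circ_inner: "(\<integral>y. x \<bullet> y \<partial>circ) = 0"
proof -
  have "(\<integral>y. x \<bullet> (-1 * y) \<partial>circ) = (\<integral>y. x \<bullet> y \<partial>circ)"
    by (rule integral_circ_rotate[of "\<lambda>y. x \<bullet> y"]) auto
  then show ?thesis by simp
qed

definition bump_mean :: "real \<Rightarrow> real \<Rightarrow> complex \<Rightarrow> real" where
  "bump_mean L t x = (\<integral>y. bump L (x + of_real t * y) \<partial>circ)"

lemma integrable_bump: "integrable circ (\<lambda>y. bump L (x + of_real t * y))"
  by (rule circ.integrable_const_bound[where B="L^4"])
     (auto intro!: AE_I2 simp: bump_nonneg bump_le)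

lemma nn_integral_bump: "(\<integral>\<^sup>+y. ennreal (bump L (x + of_real t * y)) \<partial>circ) = ennreal (bump_mean L t x)"
  unfolding bump_mean_def
  by (rule nn_integral_eq_integral[OF integrable_bump]) (auto simp: bump_nonneg)

text \<open>The linear term 4 t P (x \<bullet> y) has mean 0. For the rest, |q - p| \<le> 4 L t +
  t^2 \<le> 5 L t leaves a Taylor remainder of 25 L^2 t^2, and 2 P t^2 adds 2 L^2 t^2.\<close>

lemma bump_mean_approx:
  assumes t: "0 < t" "t \<le> L" and x: "cmod x \<le> 2 * L"
  shows "\<bar>bump_mean L t x - bump L x\<bar> \<le> 27 * L\<^sup>2 * t\<^sup>2"
proof -
  define P where "P = max 0 (L\<^sup>2 - (cmod x)\<^sup>2)"
  have L: "L > 0" using t by simp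
  have P: "0 \<le> P" "P \<le> L\<^sup>2" by (auto simp: P_def)
  let ?k = "\<lambda>y. bump L (x + of_real t * y) - bump L x + 4 * t * P * (x \<bullet> y)"
  have bound: "\<bar>?k y\<bar> \<le> 27 * L\<^sup>2 * t\<^sup>2" if y: "cmod y = 1" for y
  proof -
    define p where "p = L\<^sup>2 - (cmod x)\<^sup>2"
    define q where "q = L\<^sup>2 - (cmod (x + of_real t * y))\<^sup>2"
    have "(cmod (x + of_real t * y))\<^sup>2 = (cmod x)\<^sup>2 + 2 * t * (x \<bullet> y) + t\<^sup>2"
      using dot_norm[of x "t *\<^sub>R y"] y t by (simp add: scaleR_conv_of_real[symmetric] power_mult_distrib)
    then have qp: "q - p = - 2 * t * (x \<bullet> y) - t\<^sup>2" by (simp add: p_def q_def)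
    have "\<bar>x \<bullet> y\<bar> \<le> 2 * L" using Cauchy_Schwarz_ineq2[of x y] x y by simp
    then have "\<bar>2 * t * (x \<bullet> y)\<bar> \<le> 2 * t * (2 * L)" using t by (simp add: abs_mult)
    moreover have "t\<^sup>2 \<le> t * L" using t by (simp add: power2_eq_square)
    moreover have "\<bar>q - p\<bar> \<le> \<bar>2 * t * (x \<bullet> y)\<bar> + t\<^sup>2"
      unfolding qp by (simp add: abs_if)
    moreover have "5 * L * t = 2 * t * (2 * L) + t * L" by simp
    ultimately have "\<bar>q - p\<bar> \<le> 5 * L * t" by linarith
    then have "(q - p)\<^sup>2 \<le> (5 * L * t)\<^sup>2" by (rule power2_le_iff_abs_le[THEN iffD2, rotated]) (use L t in auto)
    then have sq: "(q - p)\<^sup>2 \<le> 25 * L\<^sup>2 * t\<^sup>2" by (simp add: power_mult_distrib)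
    have b: "bump L (x + of_real t * y) = (max 0 q)\<^sup>2" "bump L x = (max 0 p)\<^sup>2" "P = max 0 p"
      by (simp_all add: bump_def p_def q_def P_def)
    have "?k y = ((max 0 q)\<^sup>2 - (max 0 p)\<^sup>2 - 2 * max 0 p * (q - p)) - 2 * P * t\<^sup>2"
      unfolding qp b by (simp add: algebra_simps)
    then have "\<bar>?k y\<bar> \<le> (q - p)\<^sup>2 + 2 * P * t\<^sup>2"
      using pos_square_taylor[of q p] P
        abs_triangle_ineq4[of "(max 0 q)\<^sup>2 - (max 0 p)\<^sup>2 - 2 * max 0 p * (q - p)" "2 * P * t\<^sup>2"]
      by simp
    also have "\<dots> \<le> 25 * L\<^sup>2 * t\<^sup>2 + 2 * L\<^sup>2 * t\<^sup>2"
      using sq P by (intro add_mono mult_right_mono) auto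
    finally show ?thesis by simp
  qed
  have int_in: "integrable circ (\<lambda>y. x \<bullet> y)"
    by (rule circ.integrable_const_bound[where B="cmod x"])
       (use AE_circ in \<open>auto elim!: eventually_mono intro: order_trans[OF Cauchy_Schwarz_ineq2]\<close>)
  have int: "integrable circ ?k" using integrable_bump int_in by simp
  have "(\<integral>y. ?k y \<partial>circ) = bump_mean L t x - bump L x"
    using integrable_bump int_in integral_circ_inner[of x] circ.prob_space
    by (simp add: bump_mean_def)
  moreover have "\<bar>\<integral>y. ?k y \<partial>circ\<bar> \<le> (\<integral>y. \<bar>?k y\<bar> \<partial>circ)" by (rule integral_abs_bound)
  moreover have "(\<integral>y. \<bar>?k y\<bar> \<partial>circ) \<le> (\<integral>y. 27 * L\<^sup>2 * t\<^sup>2 \<partial>circ)"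
    using int AE_circ by (intro integral_mono_AE) (auto elim!: eventually_mono intro!: bound)
  ultimately show ?thesis using circ.prob_space by simp
qed

lemma bump_mean_eq_0:
  assumes t: "0 \<le> t" "t \<le> L" and x: "2 * L \<le> cmod x"
  shows "bump_mean L t x = 0"
proof -
  have "bump L (x + of_real t * y) = 0" if "cmod y = 1" for y
    using norm_diff_ineq[of x "of_real t * y"] that t x by (intro bump_eq_0) (auto simp: norm_mult)
  then have "(\<integral>y. bump L (x + of_real t * y) \<partial>circ) = (\<integral>y. 0 \<partial>circ)"
    using AE_circ by (intro integral_cong_AE) (auto elim!: eventually_mono)
  then show ?thesis by (simp add: bump_mean_def)
qed

text \<open>For |x| \<le> 2 L both means are within 27 L^2 t^2 of the bump, whence 54; beyond that
  both vanish.\<close>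

lemma bump_mean_half:
  assumes t: "0 < t" "t \<le> L"
  shows "bump_mean L (t/2) x \<le> bump_mean L t x + 54 * L\<^sup>2 * t\<^sup>2 * indicator (ball 0 (3*L)) x"
proof (cases "cmod x \<le> 2 * L")
  case True
  have "bump_mean L (t/2) x \<le> bump L x + 27 * L\<^sup>2 * (t/2)\<^sup>2"
    using bump_mean_approx[of "t/2" L x] t True by (auto simp: abs_if split: if_splits)
  moreover have "bump L x \<le> bump_mean L t x + 27 * L\<^sup>2 * t\<^sup>2"
    using bump_mean_approx[of t L x] t True by (auto simp: abs_if split: if_splits)
  moreover have "27 * L\<^sup>2 * (t/2)\<^sup>2 \<le> 27 * L\<^sup>2 * t\<^sup>2"
    by (intro mult_left_mono power_mono) (use t in auto)
  moreover have "cmod x < 3 * L" using True t by simp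
  ultimately show ?thesis by simp
next
  case False
  then show ?thesis using bump_mean_eq_0[of "t/2" L x] bump_mean_eq_0[of t L x] t by simp
qed

lemma bump_mean_borel [measurable]: "bump_mean L t \<in> borel_measurable borel"
  unfolding bump_mean_def by measurable

text \<open>Circle averaging is self-adjoint: Fubini, a translation and the symmetry y -> -y move
  the mean from \<open>w\<close> to the bump.\<close>

lemma nn_integral_bump_exchange:
  assumes [measurable]: "w \<in> borel_measurable borel"
  shows "(\<integral>\<^sup>+z. ennreal (bump L z) * (\<integral>\<^sup>+y. w (z + of_real t * y) \<partial>circ) \<partial>lborel) =
    (\<integral>\<^sup>+x. w x * ennreal (bump_mean L t x) \<partial>lborel)"
proof -
  have "(\<integral>\<^sup>+z. ennreal (bump L z) * (\<integral>\<^sup>+y. w (z + of_real t * y) \<partial>circ) \<partial>lborel) =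
     (\<integral>\<^sup>+z. (\<integral>\<^sup>+y. ennreal (bump L z) * w (z + of_real t * y) \<partial>circ) \<partial>lborel)"
    by (intro nn_integral_cong nn_integral_cmult[symmetric]) measurable
  also have "\<dots> = (\<integral>\<^sup>+y. (\<integral>\<^sup>+z. ennreal (bump L z) * w (z + of_real t * y) \<partial>lborel) \<partial>circ)"
    by (rule circ_lborel.Fubini') measurable
  also have "\<dots> = (\<integral>\<^sup>+y. (\<integral>\<^sup>+x. ennreal (bump L (x + of_real t * (-1 * y))) * w x \<partial>lborel) \<partial>circ)"
  proof (rule nn_integral_cong)
    fix y
    have m: "(\<lambda>x. ennreal (bump L (x + of_real t * (-1 * y))) * w x) \<in> borel_measurable borel" by measurable
    show "(\<integral>\<^sup>+z. ennreal (bump L z) * w (z + of_real t * y) \<partial>lborel) = (\<integral>\<^sup>+x. ennreal (bump L (x + of_real t * (-1 * y))) * w x \<partial>lborel)"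
      using nn_integral_lborel_translate[OF m, of "of_real t * y"] by (simp add: add.commute)
  qed
  also have "\<dots> = (\<integral>\<^sup>+x. (\<integral>\<^sup>+y. ennreal (bump L (x + of_real t * (-1 * y))) * w x \<partial>circ) \<partial>lborel)"
    by (rule circ_lborel.Fubini'[symmetric]) measurable
  also have "\<dots> = (\<integral>\<^sup>+x. w x * ennreal (bump_mean L t x) \<partial>lborel)"
  proof (intro nn_integral_cong)
    fix x
    have "(\<integral>\<^sup>+y. ennreal (bump L (x + of_real t * (-1 * y))) * w x \<partial>circ) = (\<integral>\<^sup>+y. ennreal (bump L (x + of_real t * (-1 * y))) \<partial>circ) * w x"
      by (rule nn_integral_multc) measurable
    also have "(\<integral>\<^sup>+y. ennreal (bump L (x + of_real t * (-1 * y))) \<partial>circ) = (\<integral>\<^sup>+y. ennreal (bump L (x + of_real t * y)) \<partial>circ)"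
      by (rule nn_integral_circ_rotate[of "\<lambda>y. ennreal (bump L (x + of_real t * y))"]) auto
    finally show "(\<integral>\<^sup>+y. ennreal (bump L (x + of_real t * (-1 * y))) * w x \<partial>circ) = w x * ennreal (bump_mean L t x)"
      by (simp only: nn_integral_bump mult.commute[of "w x"])
  qed
  finally show ?thesis .
qed

lemma cmean_borel:
  assumes "real_subharmonic v"
  shows "(\<lambda>z. cmean v z t) \<in> borel_measurable borel"
proof -
  note [measurable] = real_subharmonic_borel[OF assms]
  show ?thesis unfolding cmean_def by measurable
qed

text \<open>This replaces the finiteness of the Riesz mass of a disc.\<close>
lemma nn_integral_cmean_increment:
  assumes v: "real_subharmonic v" and t: "0 < t" "t \<le> L"
    and K: "\<And>z. cmod z < 3 * L \<Longrightarrow> v z \<le> K"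
    and J: "(\<integral>\<^sup>+x. indicator (ball 0 (3*L)) x * ennreal (K - v x) \<partial>lborel) \<le> ennreal J0" and J0: "J0 \<ge> 0"
  shows "(\<integral>\<^sup>+z. indicator (ball 0 (L/2)) z * ennreal (cmean v z t - cmean v z (t/2)) \<partial>lborel) \<le> ennreal (108 * t\<^sup>2 * J0 / L\<^sup>2)"
proof -
  note [measurable] = real_subharmonic_borel[OF v] cmean_borel[OF v]
  have L: "L > 0" using t by simp
  \<comment> \<open>Passing to K - v permits nonnegative integration. Negative values, which
    \<open>ennreal\<close> cuts off, can occur only outside the disc of radius 3 L, where the bump
    means vanish.\<close>
  define w where "w = (\<lambda>x. ennreal (K - v x))"
  have [measurable]: "w \<in> borel_measurable borel" unfolding w_def by measurable
  have [measurable]: "ball (0::complex) R \<in> sets borel" for R by simp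
  define d where "d = (\<lambda>z. cmean v z t - cmean v z (t/2))"
  have [measurable]: "d \<in> borel_measurable borel" unfolding d_def by measurable
  define I where "I = (\<lambda>t. \<integral>\<^sup>+z. ennreal (bump L z) * (\<integral>\<^sup>+y. w (z + of_real t * y) \<partial>circ) \<partial>lborel)"
  have I_eq: "I t = (\<integral>\<^sup>+x. w x * ennreal (bump_mean L t x) \<partial>lborel)" for t
    unfolding I_def by (rule nn_integral_bump_exchange) measurable
  let ?J = "\<integral>\<^sup>+x. indicator (ball 0 (3*L)) x * w x \<partial>lborel"
  have J': "?J \<le> ennreal J0" using J by (simp add: w_def)
  have mean_le: "bump_mean L t x \<le> L^4 * indicator (ball 0 (3*L)) x" for x
  proof (cases "2 * L \<le> cmod x")
    case True then show ?thesis using bump_mean_eq_0[OF _ t(2) True] t L by simp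
  next
    case False
    have "bump_mean L t x \<le> (\<integral>y. L^4 \<partial>circ)" unfolding bump_mean_def
      by (intro integral_mono integrable_bump) (auto simp: bump_le)
    then show ?thesis using False L circ.prob_space by simp
  qed
  have "I t \<le> (\<integral>\<^sup>+x. ennreal (L^4) * (indicator (ball 0 (3*L)) x * w x) \<partial>lborel)"
    unfolding I_eq
  proof (intro nn_integral_mono)
    fix x
    have "ennreal (bump_mean L t x) \<le> ennreal (L^4 * indicator (ball 0 (3*L)) x)" by (intro ennreal_leI mean_le)
    then have "w x * ennreal (bump_mean L t x) \<le> w x * ennreal (L^4 * indicator (ball 0 (3*L)) x)" by (rule mult_left_mono) auto
    also have "\<dots> = ennreal (L^4) * (indicator (ball 0 (3*L)) x * w x)"
      by (auto simp: indicator_def mult_ac)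
    finally show "w x * ennreal (bump_mean L t x) \<le> ennreal (L^4) * (indicator (ball 0 (3*L)) x * w x)" .
  qed
  also have "\<dots> = ennreal (L^4) * ?J" by (rule nn_integral_cmult) measurable
  also have "\<dots> \<le> ennreal (L^4) * ennreal J0" using J' by (rule mult_left_mono) auto
  also have "\<dots> < \<infinity>" by (simp add: ennreal_mult_less_top)
  \<comment> \<open>Finiteness lets \<open>I t\<close> be cancelled in \<open>ennreal\<close> when
    \<open>upper\<close> and \<open>split\<close> are combined.\<close>
  finally have fin: "I t < \<infinity>" .
  have "I (t/2) \<le> (\<integral>\<^sup>+x. w x * ennreal (bump_mean L t x) + ennreal (54 * L\<^sup>2 * t\<^sup>2) * (indicator (ball 0 (3*L)) x * w x) \<partial>lborel)"
    unfolding I_eq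
  proof (intro nn_integral_mono)
    fix x
    have mn: "0 \<le> bump_mean L t x" unfolding bump_mean_def by (intro integral_nonneg_AE) (auto simp: bump_nonneg)
    have "ennreal (bump_mean L (t/2) x) \<le> ennreal (bump_mean L t x + 54 * L\<^sup>2 * t\<^sup>2 * indicator (ball 0 (3*L)) x)"
      by (intro ennreal_leI bump_mean_half t)
    also have "\<dots> = ennreal (bump_mean L t x) + ennreal (54 * L\<^sup>2 * t\<^sup>2) * indicator (ball 0 (3*L)) x"
      using mn by (subst ennreal_plus) (auto simp: indicator_def)
    finally have "w x * ennreal (bump_mean L (t/2) x) \<le> w x * (ennreal (bump_mean L t x) + ennreal (54 * L\<^sup>2 * t\<^sup>2) * indicator (ball 0 (3*L)) x)"
      by (rule mult_left_mono) auto
    then show "w x * ennreal (bump_mean L (t/2) x) \<le> w x * ennreal (bump_mean L t x) + ennreal (54 * L\<^sup>2 * t\<^sup>2) * (indicator (ball 0 (3*L)) x * w x)"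
      by (simp add: distrib_left mult_ac)
  qed
  also have "\<dots> = I t + ennreal (54 * L\<^sup>2 * t\<^sup>2) * ?J"
    unfolding I_eq by (subst nn_integral_add) (auto simp: nn_integral_cmult)
  also have "\<dots> \<le> I t + ennreal (54 * L\<^sup>2 * t\<^sup>2) * ennreal J0"
    using J' by (intro add_left_mono mult_left_mono) auto
  finally have upper: "I (t/2) \<le> I t + ennreal (54 * L\<^sup>2 * t\<^sup>2) * ennreal J0" .
  \<comment> \<open>For |z| < L the circles stay where v \<le> K, so lowering the mean of v by
    \<open>d\<close> raises that of \<open>w\<close> by exactly \<open>d\<close>; elsewhere the bump
    is 0.\<close>
  have split: "I (t/2) = I t + (\<integral>\<^sup>+z. ennreal (bump L z) * ennreal (d z) \<partial>lborel)"
  proof -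
    have circ_w: "(\<integral>\<^sup>+y. w (z + of_real s * y) \<partial>circ) = ennreal (K - cmean v z s)" "cmean v z s \<le> K"
      if "cmod z < L" "0 < s" "s \<le> L" for z s
    proof -
      have le: "v x \<le> K" if "dist z x = s" for x
      proof -
        have "cmod (x - z) = s" using that by (simp add: dist_norm norm_minus_commute)
        then show ?thesis
          using norm_triangle_ineq2[of x z] \<open>cmod z < L\<close> \<open>s \<le> L\<close> L by (intro K) linarith
      qed
      show "(\<integral>\<^sup>+y. w (z + of_real s * y) \<partial>circ) = ennreal (K - cmean v z s)"
        unfolding w_def using le \<open>0 < s\<close> by (intro nn_integral_circ_diff[OF v]) auto
      show "cmean v z s \<le> K" using cmean_le_sup[of v z s K] v le \<open>0 < s\<close> by blast
    qed
    have "I (t/2) = (\<integral>\<^sup>+z. ennreal (bump L z) * (\<integral>\<^sup>+y. w (z + of_real t * y) \<partial>circ) + ennreal (bump L z) * ennreal (d z) \<partial>lborel)"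
      unfolding I_def
    proof (intro nn_integral_cong)
      fix z
      show "ennreal (bump L z) * (\<integral>\<^sup>+y. w (z + of_real (t/2) * y) \<partial>circ) = ennreal (bump L z) * (\<integral>\<^sup>+y. w (z + of_real t * y) \<partial>circ) + ennreal (bump L z) * ennreal (d z)"
      proof (cases "cmod z < L")
        case True
        have dz: "0 \<le> d z" unfolding d_def using cmean_mono[OF v, of "t/2" t z] t by simp
        have "(\<integral>\<^sup>+y. w (z + of_real (t/2) * y) \<partial>circ) = ennreal (K - cmean v z (t/2))"
          using t by (intro circ_w[OF True]) auto
        also have "\<dots> = ennreal ((K - cmean v z t) + d z)" by (simp add: d_def)
        also have "\<dots> = ennreal (K - cmean v z t) + ennreal (d z)"
          using dz circ_w(2)[OF True t] by (intro ennreal_plus) auto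
        finally show ?thesis using circ_w(1)[OF True t] by (simp add: distrib_left)
      next
        case False
        then show ?thesis using bump_eq_0[of L z] L by simp
      qed
    qed
    also have "\<dots> = I t + (\<integral>\<^sup>+z. ennreal (bump L z) * ennreal (d z) \<partial>lborel)"
      unfolding I_def by (rule nn_integral_add) measurable
    finally show ?thesis .
  qed
  have bd: "(\<integral>\<^sup>+z. ennreal (bump L z) * ennreal (d z) \<partial>lborel) \<le> ennreal (54 * L\<^sup>2 * t\<^sup>2) * ennreal J0"
    using upper fin unfolding split by (auto simp: ennreal_add_left_cancel_le)
  \<comment> \<open>On this disc the bump is at least L^4 / 2, whence the factor 2 / L^4 and 108 as
    twice 54.\<close>
  have "(\<integral>\<^sup>+z. indicator (ball 0 (L/2)) z * ennreal (d z) \<partial>lborel) \<le> (\<integral>\<^sup>+z. ennreal (2 / L^4) * (ennreal (bump L z) * ennreal (d z)) \<partial>lborel)"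
  proof (intro nn_integral_mono)
    fix z
    have "1 \<le> (2 / L^4) * bump L z" if "cmod z < L/2" using bump_ge[OF that] L by (simp add: field_simps)
    then have "indicator (ball 0 (L/2)) z \<le> ennreal ((2 / L^4) * bump L z)"
      by (auto simp: indicator_def)
    then have "indicator (ball 0 (L/2)) z * ennreal (d z) \<le> ennreal ((2 / L^4) * bump L z) * ennreal (d z)"
      by (rule mult_right_mono) auto
    also have "\<dots> = ennreal (2 / L^4) * (ennreal (bump L z) * ennreal (d z))"
      using L by (subst ennreal_mult) (auto simp: bump_nonneg mult.assoc)
    finally show "indicator (ball 0 (L/2)) z * ennreal (d z) \<le> ennreal (2 / L^4) * (ennreal (bump L z) * ennreal (d z))" .
  qed
  also have "\<dots> = ennreal (2 / L^4) * (\<integral>\<^sup>+z. ennreal (bump L z) * ennreal (d z) \<partial>lborel)"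
    by (rule nn_integral_cmult) measurable
  also have "\<dots> \<le> ennreal (2 / L^4) * (ennreal (54 * L\<^sup>2 * t\<^sup>2) * ennreal J0)"
    using bd by (rule mult_left_mono) auto
  also have "\<dots> = ennreal (2 / L^4 * (54 * L\<^sup>2 * t\<^sup>2 * J0))"
    using L J0 by (simp add: ennreal_mult[symmetric])
  also have "2 / L^4 * (54 * L\<^sup>2 * t\<^sup>2 * J0) = 108 * t\<^sup>2 * J0 / L\<^sup>2"
    using L by (simp add: field_simps power4_eq_xxxx power2_eq_square)
  finally show ?thesis by (simp add: d_def)
qed

section \<open>Integrals over annuli\<close>

text \<open>Each increment raises the exponential by at most b d_k times its new value, and that
  value is at most exp (b \<delta>)^(k+1). The bound is linear in the increments, so estimates of
  their integrals can be inserted.\<close>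

lemma exp_telescope_bound:
  fixes d :: "nat \<Rightarrow> real"
  assumes d: "\<And>j. 0 \<le> d j" "\<And>j. d j \<le> \<delta>" and b: "b \<ge> 0"
  shows "exp (b * (\<Sum>j<k. d j)) \<le> 1 + (\<Sum>j<k. b * exp (b * \<delta>) ^ Suc j * d j)"
proof (induction k)
  case (Suc k)
  let ?S = "\<Sum>j<k. d j"
  have step: "exp (b * (?S + d k)) - exp (b * ?S) \<le> b * d k * exp (b * (?S + d k))"
  proof -
    have "1 - b * d k \<le> exp (- (b * d k))" using exp_ge_add_one_self[of "- (b * d k)"] by simp
    then have "exp (b * (?S + d k)) * (1 - b * d k) \<le> exp (b * (?S + d k)) * exp (- (b * d k))" by (intro mult_left_mono) auto
    also have "\<dots> = exp (b * ?S)" by (simp add: exp_add[symmetric] distrib_left)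
    finally show ?thesis by (simp add: algebra_simps)
  qed
  have "?S + d k \<le> real (Suc k) * \<delta>"
    using sum_mono[of "{..<Suc k}" d "\<lambda>_. \<delta>"] d(2) by simp
  then have "b * (?S + d k) \<le> b * (real (Suc k) * \<delta>)" using b by (rule mult_left_mono)
  then have "exp (b * (?S + d k)) \<le> exp (real (Suc k) * (b * \<delta>))" by (simp add: mult_ac)
  also have "\<dots> = exp (b * \<delta>) ^ Suc k" by (rule exp_of_nat_mult)
  finally have "b * d k * exp (b * (?S + d k)) \<le> b * d k * exp (b * \<delta>) ^ Suc k"
    using b d(1) by (intro mult_left_mono) auto
  then have "exp (b * (?S + d k)) \<le> exp (b * ?S) + b * exp (b * \<delta>) ^ Suc k * d k"
    using step by (simp add: mult_ac)
  then show ?case using Suc by simp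
qed simp

text \<open>By \<open>q\<close> the j-th increment enters with weight of order 2^j, while its
  integral is of order 4^(-j); a geometric series of ratio 1/2 remains. The passage from the means
  \<open>M k\<close> to \<open>v\<close> is Fatou's lemma.\<close>

lemma nn_integral_exp_le:
  assumes v: "real_subharmonic v" and c: "c > 0" and s: "0 < s" "s \<le> L"
    and K: "\<And>z. cmod z < 3 * L \<Longrightarrow> v z \<le> K"
    and J: "(\<integral>\<^sup>+x. indicator (ball 0 (3*L)) x * ennreal (K - v x) \<partial>lborel) \<le> ennreal J0" and J0: "J0 \<ge> 0"
    and S: "S \<in> sets borel" "S \<subseteq> ball 0 (L/2)"
    and m: "\<And>z. z \<in> S \<Longrightarrow> m \<le> cmean v z s"
    and \<delta>: "\<And>z t. z \<in> S \<Longrightarrow> 0 < t \<Longrightarrow> t \<le> s \<Longrightarrow> cmean v z t - cmean v z (t/2) \<le> \<delta>"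
    and q: "exp (2 * c * \<delta>) \<le> 2"
  shows "(\<integral>\<^sup>+z. indicator S z * ennreal (exp (- 2 * c * v z)) \<partial>lborel) \<le>
    ennreal (exp (- 2 * c * m) * (pi * (L/2)\<^sup>2 + 864 * c * s\<^sup>2 * J0 / L\<^sup>2))"
proof -
  note [measurable] = real_subharmonic_borel[OF v] cmean_borel[OF v] S(1)
  have L: "L > 0" using s by simp
  define t where "t = (\<lambda>k::nat. s / 2^k)"
  have t: "0 < t k" "t k \<le> s" "t k / 2 = t (Suc k)" for k
    using s by (auto simp: t_def field_simps)
  have t0: "t 0 = s" by (simp add: t_def)
  define M where "M = (\<lambda>k z. cmean v z (t k))"
  have [measurable]: "M k \<in> borel_measurable borel" for k unfolding M_def by measurable
  define d where "d = (\<lambda>k z. M k z - M (Suc k) z)"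
  have [measurable]: "d k \<in> borel_measurable borel" for k unfolding d_def by measurable
  define E where "E = exp (- 2 * c * m)"
  have E: "E > 0" by (simp add: E_def)
  have d0: "0 \<le> d k z" for k z
    unfolding d_def M_def using cmean_mono[OF v, of "t (Suc k)" "t k" z] t(1)[of "Suc k"] t(1)[of k] t(3)[of k] by simp
  have d1: "d k z \<le> \<delta>" if "z \<in> S" for k z
    using \<delta>[OF that t(1) t(2), of k] by (simp add: d_def M_def t(3))
  have tele: "M k z = M 0 z - (\<Sum>j<k. d j z)" for k z
    by (induction k) (auto simp: d_def)
  have pt: "exp (- 2 * c * M k z) \<le> E * (1 + (\<Sum>j<k. 2 * c * 2 ^ Suc j * d j z))" if z: "z \<in> S" for k z
  proof -
    have "exp (- 2 * c * M k z) = exp (- 2 * c * M 0 z) * exp (2 * c * (\<Sum>j<k. d j z))"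
      by (subst tele) (simp add: exp_add[symmetric] algebra_simps)
    also have "\<dots> \<le> E * exp (2 * c * (\<Sum>j<k. d j z))"
      using m[OF z] c by (intro mult_right_mono) (auto simp: E_def M_def t0)
    also have "exp (2 * c * (\<Sum>j<k. d j z)) \<le> 1 + (\<Sum>j<k. 2 * c * exp (2 * c * \<delta>) ^ Suc j * d j z)"
      using d0 d1[OF z] c by (intro exp_telescope_bound) auto
    also have "\<dots> \<le> 1 + (\<Sum>j<k. 2 * c * 2 ^ Suc j * d j z)"
      using d0 c q by (intro add_left_mono sum_mono mult_right_mono mult_left_mono power_mono) auto
    finally show ?thesis using E by simp
  qed
  have int_d: "(\<integral>\<^sup>+z. indicator S z * ennreal (d j z) \<partial>lborel) \<le> ennreal (108 * (t j)\<^sup>2 * J0 / L\<^sup>2)" for j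
  proof -
    have "(\<integral>\<^sup>+z. indicator S z * ennreal (d j z) \<partial>lborel) \<le> (\<integral>\<^sup>+z. indicator (ball 0 (L/2)) z * ennreal (d j z) \<partial>lborel)"
      using S(2) by (intro nn_integral_mono mult_right_mono) (auto simp: indicator_def)
    also have "\<dots> \<le> ennreal (108 * (t j)\<^sup>2 * J0 / L\<^sup>2)"
      using nn_integral_cmean_increment[OF v t(1) order_trans[OF t(2) s(2)] K J J0, of j]
      by (simp add: d_def M_def t(3))
    finally show ?thesis .
  qed
  have Mk: "(\<integral>\<^sup>+z. indicator S z * ennreal (exp (- 2 * c * M k z)) \<partial>lborel) \<le>
      ennreal (E * (pi * (L/2)\<^sup>2 + 864 * c * s\<^sup>2 * J0 / L\<^sup>2))" for k
  proof -
    have "(\<integral>\<^sup>+z. indicator S z * ennreal (exp (- 2 * c * M k z)) \<partial>lborel) \<le>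
      (\<integral>\<^sup>+z. ennreal E * (indicator S z + (\<Sum>j<k. ennreal (2 * c * 2 ^ Suc j) * (indicator S z * ennreal (d j z)))) \<partial>lborel)"
    proof (intro nn_integral_mono)
      fix z
      show "indicator S z * ennreal (exp (- 2 * c * M k z)) \<le>
        ennreal E * (indicator S z + (\<Sum>j<k. ennreal (2 * c * 2 ^ Suc j) * (indicator S z * ennreal (d j z))))"
      proof (cases "z \<in> S")
        case True
        have "ennreal (exp (- 2 * c * M k z)) \<le> ennreal (E * (1 + (\<Sum>j<k. 2 * c * 2 ^ Suc j * d j z)))"
          by (intro ennreal_leI pt True)
        also have "\<dots> = ennreal E * (1 + (\<Sum>j<k. ennreal (2 * c * 2 ^ Suc j) * ennreal (d j z)))"
        proof -
          have p: "0 \<le> 2 * c * 2 ^ Suc j * d j z" for j using c d0 by simp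
          have "ennreal (E * (1 + (\<Sum>j<k. 2 * c * 2 ^ Suc j * d j z))) = ennreal E * ennreal (1 + (\<Sum>j<k. 2 * c * 2 ^ Suc j * d j z))"
            using E by (intro ennreal_mult') auto
          also have "ennreal (1 + (\<Sum>j<k. 2 * c * 2 ^ Suc j * d j z)) = 1 + ennreal (\<Sum>j<k. 2 * c * 2 ^ Suc j * d j z)"
            using p by (subst ennreal_plus) (auto intro!: sum_nonneg)
          also have "ennreal (\<Sum>j<k. 2 * c * 2 ^ Suc j * d j z) = (\<Sum>j<k. ennreal (2 * c * 2 ^ Suc j * d j z))"
            by (rule sum_ennreal[symmetric]) (use p in auto)
          also have "\<dots> = (\<Sum>j<k. ennreal (2 * c * 2 ^ Suc j) * ennreal (d j z))"
            using c d0 by (intro sum.cong refl ennreal_mult) auto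
          finally show ?thesis .
        qed
        finally show ?thesis using True by simp
      qed simp
    qed
    also have "\<dots> = ennreal E * (emeasure lborel S + (\<Sum>j<k. ennreal (2 * c * 2 ^ Suc j) * (\<integral>\<^sup>+z. indicator S z * ennreal (d j z) \<partial>lborel)))"
      by (simp add: nn_integral_cmult nn_integral_add nn_integral_sum)
    also have "\<dots> \<le> ennreal E * (ennreal (pi * (L/2)\<^sup>2) + (\<Sum>j<k. ennreal (2 * c * 2 ^ Suc j) * ennreal (108 * (t j)\<^sup>2 * J0 / L\<^sup>2)))"
    proof (intro mult_left_mono add_mono sum_mono int_d)
      have "emeasure lborel S \<le> emeasure lborel (ball (0::complex) (L/2))" using S by (intro emeasure_mono) auto
      then show "emeasure lborel S \<le> ennreal (pi * (L/2)\<^sup>2)" using emeasure_ball_complex[of "L/2" 0] L by simp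
    qed auto
    also have "(\<Sum>j<k. ennreal (2 * c * 2 ^ Suc j) * ennreal (108 * (t j)\<^sup>2 * J0 / L\<^sup>2)) = ennreal (\<Sum>j<k. 2 * c * 2 ^ Suc j * (108 * (t j)\<^sup>2 * J0 / L\<^sup>2))"
    proof -
      have "(\<Sum>j<k. ennreal (2 * c * 2 ^ Suc j) * ennreal (108 * (t j)\<^sup>2 * J0 / L\<^sup>2)) = (\<Sum>j<k. ennreal (2 * c * 2 ^ Suc j * (108 * (t j)\<^sup>2 * J0 / L\<^sup>2)))"
        using c J0 by (intro sum.cong refl ennreal_mult[symmetric]) auto
      also have "\<dots> = ennreal (\<Sum>j<k. 2 * c * 2 ^ Suc j * (108 * (t j)\<^sup>2 * J0 / L\<^sup>2))"
        by (rule sum_ennreal) (use c J0 in auto)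
      finally show ?thesis .
    qed
    \<comment> \<open>432 is 2 times 2 times 108; the geometric series doubles it to 864.\<close>
    also have "(\<Sum>j<k. 2 * c * 2 ^ Suc j * (108 * (t j)\<^sup>2 * J0 / L\<^sup>2)) = 432 * c * s\<^sup>2 * J0 / L\<^sup>2 * (\<Sum>j<k. (1/2) ^ j)"
    proof -
      have "2 * c * 2 ^ Suc j * (108 * (t j)\<^sup>2 * J0 / L\<^sup>2) = 432 * c * s\<^sup>2 * J0 / L\<^sup>2 * (1/2) ^ j" for j
      proof -
        have "(2::real) ^ j * (t j)\<^sup>2 = s\<^sup>2 * (1/2)^j"
          by (simp add: t_def power_divide power2_eq_square field_simps)
        then have "432 * c * J0 / L\<^sup>2 * ((2::real) ^ j * (t j)\<^sup>2) = 432 * c * J0 / L\<^sup>2 * (s\<^sup>2 * (1/2)^j)" by simp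
        then show ?thesis by (simp add: mult_ac)
      qed
      then show ?thesis by (simp only: sum_distrib_left)
    qed
    also have "ennreal E * (ennreal (pi * (L/2)\<^sup>2) + ennreal (432 * c * s\<^sup>2 * J0 / L\<^sup>2 * (\<Sum>j<k. (1/2) ^ j))) \<le>
       ennreal E * (ennreal (pi * (L/2)\<^sup>2) + ennreal (864 * c * s\<^sup>2 * J0 / L\<^sup>2))"
    proof (intro mult_left_mono add_left_mono ennreal_leI)
      have "(\<Sum>j<k. (1/2::real) ^ j) \<le> 2" by (subst sum_gp_strict) auto
      then have "432 * c * s\<^sup>2 * J0 / L\<^sup>2 * (\<Sum>j<k. (1/2) ^ j) \<le> 432 * c * s\<^sup>2 * J0 / L\<^sup>2 * 2"
        using c J0 by (intro mult_left_mono) auto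
      then show "432 * c * s\<^sup>2 * J0 / L\<^sup>2 * (\<Sum>j<k. (1/2) ^ j) \<le> 864 * c * s\<^sup>2 * J0 / L\<^sup>2" by simp
    qed auto
    also have "\<dots> = ennreal (E * (pi * (L/2)\<^sup>2 + 864 * c * s\<^sup>2 * J0 / L\<^sup>2))"
      using E c J0 by (simp add: ennreal_mult ennreal_plus[symmetric])
    finally show ?thesis .
  qed
  have lim: "(\<lambda>k. M k z) \<longlonglongrightarrow> v z" for z
  proof -
    have "filterlim t (at_right 0) sequentially"
      unfolding t_def using s LIMSEQ_divide_realpow_zero[of 2 s]
      by (intro tendsto_imp_filterlim_at_right) auto
    then show ?thesis unfolding M_def by (rule filterlim_compose[OF cmean_tendsto[OF v]])
  qed
  have "(\<integral>\<^sup>+z. indicator S z * ennreal (exp (- 2 * c * v z)) \<partial>lborel) =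
      (\<integral>\<^sup>+z. liminf (\<lambda>k. indicator S z * ennreal (exp (- 2 * c * M k z))) \<partial>lborel)"
  proof (rule nn_integral_cong)
    fix z
    have "(\<lambda>k. indicator S z * ennreal (exp (- 2 * c * M k z))) \<longlonglongrightarrow> indicator S z * ennreal (exp (- 2 * c * v z))"
      by (intro tendsto_mult_ennreal tendsto_ennrealI tendsto_intros lim) (auto simp: indicator_def)
    from lim_imp_Liminf[OF _ this]
    show "indicator S z * ennreal (exp (- 2 * c * v z)) = liminf (\<lambda>k. indicator S z * ennreal (exp (- 2 * c * M k z)))" by simp
  qed
  also have "\<dots> \<le> liminf (\<lambda>k. \<integral>\<^sup>+z. indicator S z * ennreal (exp (- 2 * c * M k z)) \<partial>lborel)"
    by (rule nn_integral_liminf) measurable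
  also have "\<dots> \<le> ennreal (E * (pi * (L/2)\<^sup>2 + 864 * c * s\<^sup>2 * J0 / L\<^sup>2))"
    using Mk by (intro Liminf_le) auto
  finally show ?thesis by (simp add: E_def)
qed

text \<open>With L = 4 r in \<open>nn_integral_exp_le\<close> the annulus lies in the disc of radius
  L / 2. The value at \<open>p\<close> bounds the L1 norm of K - v, and \<open>lo\<close> supplies
  both the lower bound m and, through slopes, the bound \<delta> on the increments.\<close>

lemma nn_integral_annulus_le:
  fixes \<sigma> C \<epsilon> R c C0 :: real
  assumes v: "real_subharmonic v" and gr: "\<And>z. v z \<le> \<sigma> * ln (max 1 (cmod z)) + C" and \<sigma>: "\<sigma> \<ge> 0" and C: "C \<ge> 0"
    and \<epsilon>: "\<epsilon> > 0" "\<epsilon> \<le> \<sigma>" and c: "c > 0" "6 * c * \<epsilon> \<le> 1"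
    and p: "- C0 \<le> v p" "cmod p \<le> r" and C0: "C0 \<ge> 0"
    and lo: "\<And>a. cmod a \<ge> r \<Longrightarrow> (\<sigma> - \<epsilon>) * ln (cmod a) \<le> cmean v a (sqrt (cmod a) / 2)"
    and r: "r > 1" "2 * (\<sigma> * ln 2 + C) \<le> \<epsilon> * ln r"
  shows "(\<integral>\<^sup>+z. indicator {z. r \<le> cmod z \<and> cmod z < 2 * r} z * ennreal (exp (- 2 * c * v z)) \<partial>lborel) \<le>
     ennreal ((4 * pi + 54 * 169 * pi * c * (14 * \<sigma> + C + C0)) * r powr (2 - 2 * c * (\<sigma> - \<epsilon>)))"
proof -
  let ?S = "{z::complex. r \<le> cmod z \<and> cmod z < 2 * r}"
  have r0: "r > 0" using r by simp
  define K where "K = \<sigma> * ln (14 * r) + C"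
  \<comment> \<open>The disc of radius 12 r lies in \<open>ball p (13 * r)\<close>, and this in the
    disc of radius 14 r; 169 is 13^2.\<close>
  define J0 where "J0 = 169 * pi * r\<^sup>2 * (\<sigma> * ln (14 * r) + C + C0)"
  define s where "s = sqrt r"
  have ln14: "0 \<le> ln (14 * r)" "ln (14 * r) \<le> 14 * r" using r ln_le_minus_one[of "14 * r"] by auto
  have le_K: "v z \<le> K" if "cmod z \<le> 14 * r" for z
  proof -
    have "ln (max 1 (cmod z)) \<le> ln (14 * r)" using that r by (subst ln_le_cancel_iff) auto
    then have "\<sigma> * ln (max 1 (cmod z)) \<le> \<sigma> * ln (14 * r)" using \<sigma> by (rule mult_left_mono)
    then show ?thesis using gr[of z] by (simp add: K_def)
  qed
  have J0: "J0 \<ge> 0" using \<sigma> C C0 ln14 by (simp add: J0_def)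
  have s: "0 < s" "s \<le> 4 * r" "s\<^sup>2 = r" "s < r"
  proof -
    show "0 < s" "s\<^sup>2 = r" using r by (auto simp: s_def)
    show "s < r" using r by (simp add: s_def real_sqrt_less_iff real_less_lsqrt power2_eq_square)
    then show "s \<le> 4 * r" using r by simp
  qed
  have key: "(\<integral>\<^sup>+z. indicator ?S z * ennreal (exp (- 2 * c * v z)) \<partial>lborel) \<le>
    ennreal (exp (- 2 * c * ((\<sigma> - \<epsilon>) * ln r)) * (pi * (4 * r/2)\<^sup>2 + 864 * c * s\<^sup>2 * J0 / (4 * r)\<^sup>2))"
  proof (rule nn_integral_exp_le[OF v c(1) s(1,2) _ _ J0, where K=K and \<delta>="3 * \<epsilon> * ln 2"])
    show "v z \<le> K" if "cmod z < 3 * (4 * r)" for z using that r by (intro le_K) simp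
    have "(\<integral>\<^sup>+x. indicator (ball 0 (3 * (4 * r))) x * ennreal (K - v x) \<partial>lborel) \<le> (\<integral>\<^sup>+x. indicator (ball p (13 * r)) x * ennreal (K - v x) \<partial>lborel)"
    proof (intro nn_integral_mono mult_right_mono)
      fix x :: complex
      have "dist p x < 13 * r" if "cmod x < 12 * r"
        using that p norm_triangle_ineq4[of p x] by (simp add: dist_norm)
      then show "indicator (ball 0 (3 * (4 * r))) x \<le> (indicator (ball p (13 * r)) x :: ennreal)"
        by (auto simp: indicator_def)
    qed auto
    also have "\<dots> \<le> ennreal (pi * (13 * r)\<^sup>2 * (K - v p))"
    proof (rule nn_integral_ball_le[OF v])
      fix w assume "dist p w < 13 * r"
      then show "v w \<le> K" using p norm_triangle_ineq2[of w p] by (intro le_K) (simp add: dist_norm norm_minus_commute)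
    qed (use r in auto)
    also have "\<dots> \<le> ennreal J0"
    proof (intro ennreal_leI)
      have "pi * (13 * r)\<^sup>2 * (K - v p) \<le> pi * (13 * r)\<^sup>2 * (\<sigma> * ln (14 * r) + C + C0)"
        using p by (intro mult_left_mono) (auto simp: K_def)
      then show "pi * (13 * r)\<^sup>2 * (K - v p) \<le> J0" by (simp add: J0_def power_mult_distrib mult_ac)
    qed
    finally show "(\<integral>\<^sup>+x. indicator (ball 0 (3 * (4 * r))) x * ennreal (K - v x) \<partial>lborel) \<le> ennreal J0" .
    show "?S \<in> sets borel" by measurable
    show "?S \<subseteq> ball 0 (4 * r/2)" by auto
    show mz: "(\<sigma> - \<epsilon>) * ln r \<le> cmean v z s" if z: "z \<in> ?S" for z
    proof -
      have "ln r \<le> ln (cmod z)" using z r0 by (intro ln_mono) auto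
      then have "(\<sigma> - \<epsilon>) * ln r \<le> (\<sigma> - \<epsilon>) * ln (cmod z)" using \<epsilon> by (intro mult_left_mono) auto
      also have "\<dots> \<le> cmean v z (sqrt (cmod z) / 2)" using z by (intro lo) auto
      \<comment> \<open>The radius in \<open>lo\<close> depends on z; monotonicity passes to the
        common radius \<open>s\<close>, which is larger because |z| < 4 r.\<close>
      also have "\<dots> \<le> cmean v z s"
      proof (rule cmean_mono[OF v])
        show "0 < sqrt (cmod z) / 2" using z r by auto
        have "sqrt (cmod z) \<le> sqrt (4 * r)" using z r by auto
        also have "\<dots> = 2 * s" by (simp add: s_def real_sqrt_mult)
        finally show "sqrt (cmod z) / 2 \<le> s" by simp
      qed
      finally show ?thesis .
    qed
    fix z t assume z: "z \<in> ?S" and t: "0 < t" "t \<le> s"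
    define A where "A = cmod z"
    have A: "r \<le> A" "A < 2 * r" "A > 1" using z r by (auto simp: A_def)
    have lnA: "ln r \<le> ln A" "0 < ln r" "0 < ln A" using A r by auto
    have up: "cmean v z A \<le> \<sigma> * (ln 2 + ln A) + C"
    proof (rule cmean_le_sup[OF v])
      fix w assume "dist z w = A"
      then have "cmod w \<le> 2 * A" using norm_triangle_ineq2[of w z] by (simp add: A_def dist_norm norm_minus_commute)
      then have "ln (max 1 (cmod w)) \<le> ln (2 * A)" using A by (subst ln_le_cancel_iff) auto
      also have "\<dots> = ln 2 + ln A" using A by (simp add: ln_mult)
      finally have "\<sigma> * ln (max 1 (cmod w)) \<le> \<sigma> * (ln 2 + ln A)" using \<sigma> by (rule mult_left_mono)
      then show "v w \<le> \<sigma> * (ln 2 + ln A) + C" using gr[of w] by simp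
    qed (use A in auto)
    have dn: "(\<sigma> - \<epsilon>) * ln A \<le> cmean v z s"
    proof -
      have "(\<sigma> - \<epsilon>) * ln A \<le> cmean v z (sqrt A / 2)" unfolding A_def using z by (intro lo) auto
      also have "\<dots> \<le> cmean v z s"
      proof (rule cmean_mono[OF v])
        show "0 < sqrt A / 2" using A by auto
        have "sqrt A \<le> sqrt (4 * r)" using A by auto
        also have "\<dots> = 2 * s" by (simp add: s_def real_sqrt_mult)
        finally show "sqrt A / 2 \<le> s" by simp
      qed
      finally show ?thesis .
    qed
    have lns: "ln s = ln r / 2" using r by (simp add: s_def ln_sqrt)
    \<comment> \<open>By the choice of r the constant \<sigma> ln 2 + C is at most half of
      \<epsilon> ln A, so the gain from s to A is at most (1 + 1/2) \<epsilon> ln A.\<close>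
    have num: "cmean v z A - cmean v z s \<le> 3/2 * \<epsilon> * ln A"
    proof -
      have "\<epsilon> * ln r \<le> \<epsilon> * ln A" using lnA \<epsilon> by (intro mult_left_mono) auto
      then have "2 * (\<sigma> * ln 2 + C) \<le> \<epsilon> * ln A" using r by linarith
      then show ?thesis using up dn by (simp add: algebra_simps)
    qed
    \<comment> \<open>The slope from s to A dominates those at radii up to s, and ln A - ln s \<ge>
      ln A / 2 because ln s = ln r / 2.\<close>
    have "(cmean v z t - cmean v z (t/2)) / (ln t - ln (t/2)) \<le> (cmean v z A - cmean v z s) / (ln A - ln s)"
      using t s A by (intro cmean_slope_le[OF v]) auto
    also have "\<dots> \<le> (3/2 * \<epsilon> * ln A) / (ln A - ln s)"
      using num lnA lns by (intro divide_right_mono) auto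
    also have "\<dots> \<le> (3/2 * \<epsilon> * ln A) / (ln A / 2)"
      using lnA lns \<epsilon> by (intro divide_left_mono) auto
    also have "\<dots> = 3 * \<epsilon>" using lnA by simp
    also have "ln t - ln (t/2) = ln 2" using t by (simp add: ln_div)
    finally show "cmean v z t - cmean v z (t/2) \<le> 3 * \<epsilon> * ln 2"
      by (simp add: pos_divide_le_eq)
  next
    have "2 * c * (3 * \<epsilon> * ln 2) = (6 * c * \<epsilon>) * ln 2" by simp
    also have "\<dots> \<le> 1 * ln 2" using c by (intro mult_right_mono) auto
    finally have "exp (2 * c * (3 * \<epsilon> * ln 2)) \<le> exp (ln 2)" by (simp only: exp_le_cancel_iff mult_1)
    then show "exp (2 * c * (3 * \<epsilon> * ln 2)) \<le> 2" by simp
  qed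
  have e1: "exp (- 2 * c * ((\<sigma> - \<epsilon>) * ln r)) * r\<^sup>2 = r powr (2 - 2 * c * (\<sigma> - \<epsilon>))"
  proof -
    have "r\<^sup>2 = exp (2 * ln r)" using r0 by (simp add: exp_double)
    then show ?thesis using r0 by (simp add: powr_def exp_add[symmetric] algebra_simps)
  qed
  \<comment> \<open>Here it matters that s^2 is r and not r^2: the spare factor r absorbs the
    logarithm in \<open>J0\<close> through ln (14 r) \<le> 14 r.\<close>
  have e2: "864 * c * s\<^sup>2 * J0 / (4 * r)\<^sup>2 \<le> 54 * 169 * pi * c * (14 * \<sigma> + C + C0) * r\<^sup>2"
  proof -
    have "864 * c * s\<^sup>2 * J0 / (4 * r)\<^sup>2 = 54 * 169 * pi * c * r * (\<sigma> * ln (14 * r) + C + C0)"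
      unfolding s(3) J0_def using r0 by (simp add: power2_eq_square field_simps)
    also have "\<dots> \<le> 54 * 169 * pi * c * r * ((14 * \<sigma> + C + C0) * r)"
    proof (intro mult_left_mono)
      have "\<sigma> * ln (14 * r) \<le> \<sigma> * (14 * r)" using ln14 \<sigma> by (intro mult_left_mono) auto
      moreover have "C \<le> C * r" "C0 \<le> C0 * r" using C C0 r mult_left_mono[of 1 r C] mult_left_mono[of 1 r C0] by auto
      ultimately show "\<sigma> * ln (14 * r) + C + C0 \<le> (14 * \<sigma> + C + C0) * r" by (simp add: algebra_simps)
    qed (use c r in auto)
    finally show ?thesis by (simp add: power2_eq_square mult_ac)
  qed
  have "exp (- 2 * c * ((\<sigma> - \<epsilon>) * ln r)) * (pi * (4 * r/2)\<^sup>2 + 864 * c * s\<^sup>2 * J0 / (4 * r)\<^sup>2) \<le>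
     exp (- 2 * c * ((\<sigma> - \<epsilon>) * ln r)) * ((4 * pi + 54 * 169 * pi * c * (14 * \<sigma> + C + C0)) * r\<^sup>2)"
    using e2 by (intro mult_left_mono) (auto simp: power_mult_distrib algebra_simps)
  also have "\<dots> = (4 * pi + 54 * 169 * pi * c * (14 * \<sigma> + C + C0)) * r powr (2 - 2 * c * (\<sigma> - \<epsilon>))"
    unfolding e1[symmetric] by (simp only: mult_ac)
  finally show ?thesis using key by (meson ennreal_leI order_trans)
qed

section \<open>Summation over dyadic annuli\<close>

lemma dyadic_shell:
  assumes "0 < R" "R \<le> (x::real)"
  obtains j where "R * 2 ^ j \<le> x" "x < 2 * (R * 2 ^ j)"
proof -
  obtain n where n: "x / R < 2 ^ n" using real_arch_pow[of 2 "x / R"] by auto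
  define k where "k = (LEAST n. x < R * 2 ^ n)"
  have k: "x < R * 2 ^ k"
    unfolding k_def by (rule LeastI[of _ n]) (use n assms in \<open>simp add: field_simps\<close>)
  have "k \<noteq> 0" using k assms by (intro notI) simp
  then obtain j where j: "k = Suc j" using not0_implies_Suc by blast
  have "\<not> x < R * 2 ^ j"
    using not_less_Least[of j "\<lambda>n. x < R * 2 ^ n"] j by (simp add: k_def)
  then show thesis using that[of j] k j by simp
qed

text \<open>Stated for a family so that R and I are chosen before v: the truncations of one function
  share their growth bounds and a lower bound at one point, and need a common estimate.\<close>

lemma nn_integral_outside_le:
  fixes \<sigma> C c C0 :: real and F :: "(complex \<Rightarrow> real) set"
  assumes c: "c > 0" "c * \<sigma> > 1" and C: "C \<ge> 0" and C0: "C0 \<ge> 0"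
    and F: "\<And>v. v \<in> F \<Longrightarrow> real_subharmonic v" "\<And>v z. v \<in> F \<Longrightarrow> v z \<le> \<sigma> * ln (max 1 (cmod z)) + C"
      "\<And>v. v \<in> F \<Longrightarrow> - C0 \<le> v p"
    and lo: "\<And>\<epsilon>. \<epsilon> > 0 \<Longrightarrow> \<exists>R0. \<forall>v\<in>F. \<forall>r\<ge>R0. \<exists>z. cmod z = r \<and> (\<sigma> - \<epsilon>) * ln r \<le> v z"
  shows "\<exists>R I. \<forall>v\<in>F. (\<integral>\<^sup>+z. indicator {z. R \<le> cmod z} z * ennreal (exp (- 2 * c * v z)) \<partial>lborel) \<le> ennreal I"
proof -
  have \<sigma>: "\<sigma> > 1 / c" using c by (simp add: field_simps)
  then have \<sigma>0: "\<sigma> > 0" using c by (meson less_trans zero_less_divide_1_iff)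
  \<comment> \<open>The first bound is the smallness of increments required by
    \<open>nn_integral_annulus_le\<close>; the second keeps c (\<sigma> - \<epsilon>) > 1 and so
    makes the exponent \<open>\<gamma>\<close> negative.\<close>
  define \<epsilon> where "\<epsilon> = min (1 / (6 * c)) ((\<sigma> - 1 / c) / 2)"
  have \<epsilon>: "\<epsilon> > 0" using \<sigma> c by (simp add: \<epsilon>_def)
  have \<epsilon>1: "6 * c * \<epsilon> \<le> 1"
  proof -
    have "\<epsilon> \<le> 1 / (6 * c)" by (simp add: \<epsilon>_def)
    then show ?thesis using c by (simp add: field_simps)
  qed
  have \<epsilon>2: "\<epsilon> < \<sigma> - 1 / c"
  proof -
    have "\<epsilon> \<le> (\<sigma> - 1 / c) / 2" unfolding \<epsilon>_def by (rule min.cobounded2)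
    also have "\<dots> < \<sigma> - 1 / c" using \<sigma> by simp
    finally show ?thesis .
  qed
  then have \<epsilon>3: "\<epsilon> \<le> \<sigma>" using c by (smt (verit) zero_less_divide_1_iff)
  have cs: "c * (\<sigma> - \<epsilon>) > 1"
  proof -
    have "1 / c < \<sigma> - \<epsilon>" using \<epsilon>2 by simp
    then show ?thesis using c by (simp add: field_simps)
  qed
  obtain R0 where R0: "\<And>v r. v \<in> F \<Longrightarrow> r \<ge> R0 \<Longrightarrow> \<exists>z. cmod z = r \<and> (\<sigma> - \<epsilon>/24) * ln r \<le> v z"
    using lo[of "\<epsilon>/24"] \<epsilon> by auto
  obtain R1 where R1: "R1 \<ge> 9" "\<forall>v. real_subharmonic v \<longrightarrow> (\<forall>z. v z \<le> \<sigma> * ln (max 1 (cmod z)) + C) \<longrightarrow>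
      (\<forall>r\<ge>R0. \<exists>z. cmod z = r \<and> v z \<ge> (\<sigma> - \<epsilon>/24) * ln r) \<longrightarrow>
      (\<forall>a. cmod a \<ge> R1 \<longrightarrow> (\<sigma> - \<epsilon>) * ln (cmod a) \<le> cmean v a (sqrt (cmod a) / 2))"
    using cmean_ge_of_growth[of \<sigma> C \<epsilon> R0] \<sigma>0 C \<epsilon> by auto
  have low: "(\<sigma> - \<epsilon>) * ln (cmod a) \<le> cmean v a (sqrt (cmod a) / 2)" if "v \<in> F" "cmod a \<ge> R1" for v a
    using R1(2)[rule_format, of v a] F[OF that(1)] R0[OF that(1)] that(2) by blast
  \<comment> \<open>Beyond this radius \<open>low\<close> holds and \<epsilon> ln r dominates the
    additive constants; moreover p lies in the closed disc of radius R.\<close>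
  define R where "R = max (max R1 (cmod p)) (exp (2 * (\<sigma> * ln 2 + C) / \<epsilon>))"
  have R: "R \<ge> 9" "R \<ge> R1" "R \<ge> cmod p" "R \<ge> exp (2 * (\<sigma> * ln 2 + C) / \<epsilon>)"
    using R1(1) by (auto simp: R_def)
  have Rln: "2 * (\<sigma> * ln 2 + C) \<le> \<epsilon> * ln r" if "r \<ge> R" for r
  proof -
    have "r > 0" using that R by simp
    have "2 * (\<sigma> * ln 2 + C) / \<epsilon> \<le> ln r"
      using that R \<open>r > 0\<close> by (subst ln_ge_iff) auto
    then show ?thesis using \<epsilon> by (simp add: field_simps)
  qed
  define \<gamma> where "\<gamma> = 2 - 2 * c * (\<sigma> - \<epsilon>)"
  have \<gamma>: "\<gamma> < 0" using cs by (simp add: \<gamma>_def)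
  define B where "B = 4 * pi + 54 * 169 * pi * c * (14 * \<sigma> + C + C0)"
  have B: "B \<ge> 0" using c \<sigma>0 C C0 by (auto simp: B_def)
  define S where "S = (\<lambda>j::nat. {z::complex. R * 2 ^ j \<le> cmod z \<and> cmod z < 2 * (R * 2 ^ j)})"
  have [measurable]: "S j \<in> sets borel" for j unfolding S_def by measurable
  define q where "q = 2 powr \<gamma>"
  have q: "0 \<le> q" "q < 1" using \<gamma> powr_less_mono[of \<gamma> 0 2] by (auto simp: q_def)
  define b where "b = (\<lambda>j::nat. B * R powr \<gamma> * q ^ j)"
  have b_sums: "b sums (B * R powr \<gamma> * (1 / (1 - q)))"
    unfolding b_def using q by (intro sums_mult geometric_sums) auto
  have b0: "0 \<le> b j" for j using B q by (simp add: b_def)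
  show ?thesis
  proof (rule exI[of _ R], rule exI[of _ "B * R powr \<gamma> * (1 / (1 - q))"], intro ballI)
    fix v assume vF: "v \<in> F"
    note [measurable] = real_subharmonic_borel[OF F(1)[OF vF]]
    let ?g = "\<lambda>z. ennreal (exp (- 2 * c * v z))"
    have shell: "(\<integral>\<^sup>+z. indicator (S j) z * ?g z \<partial>lborel) \<le> ennreal (b j)" for j
    proof -
      have "(1::real) \<le> 2 ^ j" by simp
      then have r: "R \<le> R * 2 ^ j" using R by simp
      have "(\<integral>\<^sup>+z. indicator (S j) z * ?g z \<partial>lborel) \<le> ennreal (B * (R * 2 ^ j) powr \<gamma>)"
        unfolding S_def B_def \<gamma>_def
      proof (rule nn_integral_annulus_le[OF F(1)[OF vF] F(2)[OF vF] _ C \<epsilon> \<epsilon>3 c(1) \<epsilon>1 F(3)[OF vF] _ C0])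
        show "cmod p \<le> R * 2 ^ j" using R r by linarith
        show "(\<sigma> - \<epsilon>) * ln (cmod a) \<le> cmean v a (sqrt (cmod a) / 2)" if "R * 2 ^ j \<le> cmod a" for a
          using that R r by (intro low vF) linarith
        show "2 * (\<sigma> * ln 2 + C) \<le> \<epsilon> * ln (R * 2 ^ j)" by (rule Rln[OF r])
        show "1 < R * 2 ^ j" using R r by linarith
      qed (use \<sigma>0 in auto)
      also have "B * (R * 2 ^ j) powr \<gamma> = b j"
        using R by (simp add: b_def q_def powr_mult powr_power powr_realpow[symmetric] powr_powr mult.commute)
      finally show ?thesis .
    qed
    have "(\<integral>\<^sup>+z. indicator {z. R \<le> cmod z} z * ?g z \<partial>lborel) \<le> (\<integral>\<^sup>+z. (\<Sum>j. indicator (S j) z * ?g z) \<partial>lborel)"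
    proof (intro nn_integral_mono)
      fix z
      show "indicator {z. R \<le> cmod z} z * ?g z \<le> (\<Sum>j. indicator (S j) z * ?g z)"
      proof (cases "R \<le> cmod z")
        case True
        obtain j where "R * 2 ^ j \<le> cmod z" "cmod z < 2 * (R * 2 ^ j)"
          using dyadic_shell[of R "cmod z"] True R by auto
        then have "z \<in> S j" by (simp add: S_def)
        then have "?g z = (\<Sum>j\<in>{j}. indicator (S j) z * ?g z)" by simp
        also have "\<dots> \<le> (\<Sum>j. indicator (S j) z * ?g z)" by (rule sum_le_suminf) auto
        finally show ?thesis using True by simp
      qed simp
    qed
    also have "\<dots> = (\<Sum>j. \<integral>\<^sup>+z. indicator (S j) z * ?g z \<partial>lborel)"
      by (rule nn_integral_suminf) measurable
    also have "\<dots> \<le> (\<Sum>j. ennreal (b j))" by (intro suminf_le shell) auto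
    also have "\<dots> = ennreal (B * R powr \<gamma> * (1 / (1 - q)))" by (rule suminf_ennreal_eq[OF b0 b_sums])
    finally show "(\<integral>\<^sup>+z. indicator {z. R \<le> cmod z} z * ?g z \<partial>lborel) \<le> ennreal (B * R powr \<gamma> * (1 / (1 - q)))" .
  qed
qed

text \<open>On the annulus r \<le> |z| < 2 r the integrand is at least 1 / (2 r)^2 and the area is 3
  pi r^2, so every dyadic annulus contributes at least 3 pi / 4.\<close>

lemma nn_integral_outside_inverse_square:
  assumes b: "b > 0"
  shows "(\<integral>\<^sup>+z. indicator {z. b \<le> cmod z} z * ennreal (1 / (cmod z)\<^sup>2) \<partial>lborel) = \<infinity>"
proof -
  define S where "S = (\<lambda>j::nat. {z::complex. b * 2 ^ j \<le> cmod z \<and> cmod z < 2 * (b * 2 ^ j)})"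
  have [measurable]: "S j \<in> sets borel" for j unfolding S_def by measurable
  let ?g = "\<lambda>z. ennreal (1 / (cmod z)\<^sup>2)"
  have shell: "ennreal (3 * pi / 4) \<le> (\<integral>\<^sup>+z. indicator (S j) z * ?g z \<partial>lborel)" for j
  proof -
    define r where "r = b * 2 ^ j"
    have r: "r > 0" using b by (simp add: r_def)
    have Seq: "S j = ball 0 (2 * r) - ball 0 r" by (auto simp: S_def r_def)
    have "emeasure lborel (S j) = emeasure lborel (ball (0::complex) (2 * r)) - emeasure lborel (ball (0::complex) r)"
      unfolding Seq using r by (intro emeasure_Diff) (auto simp: emeasure_ball_complex)
    also have "\<dots> = ennreal (3 * pi * r\<^sup>2)"
      using r by (simp add: emeasure_ball_complex ennreal_minus power_mult_distrib)
    finally have em: "emeasure lborel (S j) = ennreal (3 * pi * r\<^sup>2)" .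
    have "ennreal (3 * pi / 4) = ennreal (1 / (2 * r)\<^sup>2) * ennreal (3 * pi * r\<^sup>2)"
      using r by (subst ennreal_mult[symmetric]) (auto simp: power_mult_distrib)
    also have "\<dots> = (\<integral>\<^sup>+z. indicator (S j) z * ennreal (1 / (2 * r)\<^sup>2) \<partial>lborel)"
      by (subst nn_integral_multc) (auto simp: em mult.commute)
    also have "\<dots> \<le> (\<integral>\<^sup>+z. indicator (S j) z * ?g z \<partial>lborel)"
    proof (intro nn_integral_mono)
      fix z
      have "1 / (2 * r)\<^sup>2 \<le> 1 / (cmod z)\<^sup>2" if "z \<in> S j"
      proof (intro divide_left_mono power_mono mult_pos_pos zero_less_power)
        show "0 < cmod z" using that r by (auto simp: S_def r_def[symmetric])
        show "cmod z \<le> 2 * r" using that by (simp add: S_def r_def)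
      qed (use r in auto)
      then show "indicator (S j) z * ennreal (1 / (2 * r)\<^sup>2) \<le> indicator (S j) z * ?g z"
        by (auto simp: indicator_def intro!: ennreal_leI)
    qed
    finally show ?thesis .
  qed
  have disj: "disjoint_family S"
    unfolding disjoint_family_on_def
  proof (intro ballI impI)
    fix i j :: nat assume "i \<noteq> j"
    have *: "S i \<inter> S j = {}" if "i < j" for i j
    proof -
      have "(2::real) ^ Suc i \<le> 2 ^ j" using that by (intro power_increasing) auto
      then have "2 * (b * 2 ^ i) \<le> b * 2 ^ j" using b by simp
      then show ?thesis by (auto simp: S_def)
    qed
    show "S i \<inter> S j = {}" using *[of i j] *[of j i] \<open>i \<noteq> j\<close> by (cases "i < j") auto
  qed
  have "\<infinity> = (\<integral>\<^sup>+j. ennreal (3 * pi / 4) \<partial>count_space (UNIV :: nat set))"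
    by (simp add: ennreal_mult_top)
  also have "\<dots> = (\<Sum>j::nat. ennreal (3 * pi / 4))"
    by (rule nn_integral_count_space_nat)
  also have "\<dots> \<le> (\<Sum>j. \<integral>\<^sup>+z. indicator (S j) z * ?g z \<partial>lborel)"
    by (intro suminf_le shell) auto
  also have "\<dots> = (\<integral>\<^sup>+z. (\<Sum>j. indicator (S j) z * ?g z) \<partial>lborel)"
    by (rule nn_integral_suminf[symmetric]) measurable
  also have "\<dots> \<le> (\<integral>\<^sup>+z. indicator {z. b \<le> cmod z} z * ?g z \<partial>lborel)"
  proof (intro nn_integral_mono)
    fix z
    have "(\<Sum>j. indicator (S j) z * ?g z) = (\<Sum>j. indicator (S j) z) * ?g z"
      by (rule ennreal_suminf_multc)
    also have "(\<Sum>j. indicator (S j) z) = (indicator (\<Union>j. S j) z :: ennreal)"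
      by (rule suminf_indicator[OF disj])
    also have "\<dots> \<le> indicator {z. b \<le> cmod z} z"
    proof -
      have "b \<le> cmod z" if "z \<in> S j" for j
      proof -
        have "b * 1 \<le> b * 2 ^ j" using b by (intro mult_left_mono) auto
        then show ?thesis using that by (simp add: S_def)
      qed
      then show ?thesis by (auto simp: indicator_def)
    qed
    finally show "(\<Sum>j. indicator (S j) z * ?g z) \<le> indicator {z. b \<le> cmod z} z * ?g z"
      by (simp add: mult_right_mono)
  qed
  finally show ?thesis by (simp add: top.extremum_unique)
qed

section \<open>Truncation of subharmonic functions and growth\<close>

text \<open>For subharmonic u the value +\<infinity> does not occur, so the conversion to reals
  loses nothing. \<open>trunc u 0\<close> is the positive part, and the sequence decreases to
  u.\<close>

definition trunc :: "(complex \<Rightarrow> ereal) \<Rightarrow> nat \<Rightarrow> complex \<Rightarrow> real" where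
  "trunc u n z = real_of_ereal (max (u z) (ereal (- real n)))"

lemma subharmonic_neq_PInf: "subharmonic u \<Longrightarrow> u z \<noteq> \<infinity>"
  by (simp add: subharmonic_def)

lemma ereal_trunc: "subharmonic u \<Longrightarrow> ereal (trunc u n z) = max (u z) (ereal (- real n))"
  using subharmonic_neq_PInf[of u z] unfolding trunc_def by (cases "u z") (auto simp: max_def)

lemma trunc_less_iff: "subharmonic u \<Longrightarrow> trunc u n z < a \<longleftrightarrow> u z < ereal a \<and> - real n < a"
proof -
  assume "subharmonic u"
  then have "trunc u n z < a \<longleftrightarrow> max (u z) (ereal (- real n)) < ereal a"
    using ereal_trunc[of u n z] by (metis less_ereal.simps(1))
  then show ?thesis by simp
qed

lemma trunc_le_iff: "subharmonic u \<Longrightarrow> trunc u n z \<le> a \<longleftrightarrow> u z \<le> ereal a \<and> - real n \<le> a"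
proof -
  assume "subharmonic u"
  then have "trunc u n z \<le> a \<longleftrightarrow> max (u z) (ereal (- real n)) \<le> ereal a"
    using ereal_trunc[of u n z] by (metis ereal_less_eq(3))
  then show ?thesis by simp
qed

lemma subharmonic_eventually_less:
  assumes "subharmonic u" "u z < a"
  shows "eventually (\<lambda>w. u w < a) (nhds z)"
proof -
  have "\<forall>z a. u z < a \<longrightarrow> eventually (\<lambda>w. u w < a) (at z)"
    using assms(1) unfolding subharmonic_def by (elim conjE)
  then show ?thesis using assms(2) by (simp add: eventually_nhds_conv_at)
qed

lemma subharmonic_nontrivial: "subharmonic u \<Longrightarrow> \<exists>z. u z \<noteq> - \<infinity>"
  unfolding subharmonic_def by (elim conjE)

lemma usc_trunc:
  assumes u: "subharmonic u"
  shows "usc (trunc u n)"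
  unfolding usc_def trunc_less_iff[OF u]
proof (intro allI impI)
  fix z a assume *: "u z < ereal a \<and> - real n < a"
  then have "eventually (\<lambda>w. u w < ereal a) (nhds z)" using subharmonic_eventually_less[OF u] by blast
  then show "eventually (\<lambda>w. u w < ereal a \<and> - real n < a) (nhds z)" using * by simp
qed

lemma trunc_ge: "subharmonic u \<Longrightarrow> - real n \<le> trunc u n z"
  using trunc_less_iff[of u n z "- real n"] by (simp add: not_less[symmetric])

lemma le_trunc: "subharmonic u \<Longrightarrow> u z \<le> ereal (trunc u n z)"
  by (simp add: ereal_trunc)

lemma trunc_antimono: "subharmonic u \<Longrightarrow> m \<le> n \<Longrightarrow> trunc u n z \<le> trunc u m z"
  using le_trunc[of u z m] trunc_ge[of u m z] by (subst trunc_le_iff) (auto simp: order_trans)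

lemma subharmonic_borel:
  assumes "subharmonic u"
  shows "u \<in> borel_measurable borel"
proof (rule borel_measurableI_less)
  fix a
  have "open {z. u z < a}"
    unfolding open_subopen[of "{z. u z < a}"]
  proof (intro ballI)
    fix z assume "z \<in> {z. u z < a}"
    then have "eventually (\<lambda>w. u w < a) (nhds z)" using subharmonic_eventually_less[OF assms] by simp
    then show "\<exists>T. open T \<and> z \<in> T \<and> T \<subseteq> {z. u z < a}" unfolding eventually_nhds by auto
  qed
  then show "{z \<in> space borel. u z < a} \<in> sets borel" by simp
qed

text \<open>Truncation at a level \<le> 0 keeps the positive part and can only shrink the negative
  part. The negative part of u may have infinite integral; then \<open>circle_mean\<close> is
  -\<infinity>, since the positive part is finite.\<close>

lemma circle_mean_le_cmean_trunc:
  assumes u: "subharmonic u"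
  shows "circle_mean u z r \<le> ereal (cmean (trunc u n) z r)"
proof -
  note [measurable] = subharmonic_borel[OF u] usc_borel[OF usc_trunc[OF u, of n]]
  define g where "g = (\<lambda>y. trunc u n (z + of_real r * y))"
  have [measurable]: "g \<in> borel_measurable borel" unfolding g_def by measurable
  have int: "integrable circ g" unfolding g_def
    by (rule usc_integrable[OF usc_trunc[OF u] trunc_ge[OF u]])
  define P where "P = (\<integral>\<^sup>+y. ennreal (g y) \<partial>circ)"
  define N where "N = (\<integral>\<^sup>+y. ennreal (- g y) \<partial>circ)"
  have fin: "P < \<infinity>" "N < \<infinity>" using int unfolding P_def N_def real_integrable_def
    by (auto simp: less_top)
  define p where "p = enn2real P" 
  define q where "q = enn2real N"
  have pq: "P = ennreal p" "N = ennreal q" "0 \<le> p" "0 \<le> q"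
    using fin by (auto simp: p_def q_def)
  have mean: "cmean (trunc u n) z r = p - q"
    unfolding cmean_def using real_lebesgue_integral_def[OF int] by (simp add: g_def p_def q_def P_def N_def)
  have e1: "e2ennreal (u x) = ennreal (trunc u n x)" for x
  proof -
    have "e2ennreal (u x) = e2ennreal (max (u x) (ereal (- real n)))"
    proof (cases "u x \<ge> ereal (- real n)")
      case False
      moreover have n0: "ereal (- real n) \<le> 0" by simp
      ultimately have "u x \<le> 0" by (meson le_less_linear less_imp_le order_trans)
      then show ?thesis using n0 by (simp add: e2ennreal_neg)
    qed (simp add: max_absorb1)
    also have "\<dots> = ennreal (trunc u n x)" by (simp only: ereal_trunc[OF u, symmetric] e2ennreal_ereal)
    finally show ?thesis .
  qed
  have e2: "ennreal (- trunc u n x) \<le> e2ennreal (- u x)" for x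
  proof -
    have "- ereal (trunc u n x) \<le> - u x" using le_trunc[OF u] by (simp only: ereal_minus_le_minus)
    then have "e2ennreal (ereal (- trunc u n x)) \<le> e2ennreal (- u x)" by (intro e2ennreal_mono) simp
    then show ?thesis by (simp only: e2ennreal_ereal)
  qed
  have Pe: "(\<integral>\<^sup>+t. indicator {0..2*pi} t * e2ennreal (u (z + of_real r * cis t)) \<partial>lborel) = ennreal (2 * pi * p)"
    using nn_integral_circ_scaled[of "\<lambda>y. ennreal (g y)"] pq
    by (simp add: e1 g_def P_def[symmetric, unfolded g_def] ennreal_mult)
  have Ne: "ennreal (2 * pi * q) \<le> (\<integral>\<^sup>+t. indicator {0..2*pi} t * e2ennreal (- u (z + of_real r * cis t)) \<partial>lborel)" (is "_ \<le> ?N")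
  proof -
    have "ennreal (2 * pi * q) = (\<integral>\<^sup>+t. indicator {0..2*pi} t * ennreal (- g (cis t)) \<partial>lborel)"
      using nn_integral_circ_scaled[of "\<lambda>y. ennreal (- g y)"] pq by (simp add: N_def[symmetric] ennreal_mult)
    also have "\<dots> \<le> ?N" unfolding g_def by (intro nn_integral_mono mult_left_mono e2) auto
    finally show ?thesis .
  qed
  have "enn2ereal (ennreal (2 * pi * p)) - enn2ereal ?N \<le> enn2ereal (ennreal (2 * pi * p)) - enn2ereal (ennreal (2 * pi * q))"
    using Ne by (intro ereal_minus_mono) (auto simp: less_eq_ennreal.rep_eq)
  also have "\<dots> = ereal (2 * pi * (p - q))"
    using pq by (simp add: enn2ereal_ennreal right_diff_distrib)
  finally have "circle_mean u z r \<le> ereal (2 * pi * (p - q)) / ereal (2 * pi)"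
    unfolding circle_mean_def Pe by (intro ereal_divide_right_mono) auto
  also have "\<dots> = ereal (cmean (trunc u n) z r)" by (simp add: mean)
  finally show ?thesis .
qed

lemma real_subharmonic_trunc:
  assumes u: "subharmonic u"
  shows "real_subharmonic (trunc u n)"
  unfolding real_subharmonic_def
proof (intro conjI allI)
  show "usc (trunc u n)" by (rule usc_trunc[OF u])
  show "\<exists>b. \<forall>z. b \<le> trunc u n z" using trunc_ge[OF u] by blast
  fix z
  have "\<forall>z. \<exists>r0>0. \<forall>r. 0 < r \<and> r < r0 \<longrightarrow> u z \<le> circle_mean u z r"
    using u unfolding subharmonic_def by (elim conjE)
  then obtain r0 where r0: "r0 > 0" "\<And>r. 0 < r \<Longrightarrow> r < r0 \<Longrightarrow> u z \<le> circle_mean u z r" by metis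
  have "trunc u n z \<le> cmean (trunc u n) z r" if "0 < r" "r < r0" for r
    unfolding trunc_le_iff[OF u]
  proof
    show "u z \<le> ereal (cmean (trunc u n) z r)"
      using r0(2)[OF that] circle_mean_le_cmean_trunc[OF u] by (rule order_trans)
    have "(\<integral>y. - real n \<partial>circ) \<le> cmean (trunc u n) z r"
      unfolding cmean_def
      by (intro integral_mono usc_integrable[OF usc_trunc[OF u] trunc_ge[OF u]] trunc_ge[OF u]) auto
    then show "- real n \<le> cmean (trunc u n) z r" using circ.prob_space by simp
  qed
  then show "\<exists>r0>0. \<forall>r. 0 < r \<and> r < r0 \<longrightarrow> trunc u n z \<le> cmean (trunc u n) z r"
    using r0(1) by blast
qed

section \<open>Growth in terms of the logarithmic type\<close>

lemma eventually_less_of_log_type: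
  assumes "log_type u < ereal s"
  obtains b where "b > 1" "\<And>z. cmod z \<ge> b \<Longrightarrow> u z < ereal (s * ln (cmod z))"
proof -
  have "eventually (\<lambda>z. u z / ereal (ln (cmod z)) < ereal s) at_infinity"
    using assms unfolding log_type_def by (rule Limsup_lessD)
  then obtain b where b: "\<And>z. cmod z \<ge> b \<Longrightarrow> u z / ereal (ln (cmod z)) < ereal s"
    unfolding eventually_at_infinity by blast
  show thesis
  proof (rule that[of "max b 2"])
    fix z assume z: "max b 2 \<le> cmod z"
    then have l: "0 < ln (cmod z)" by (intro ln_gt_zero) auto
    have "u z / ereal (ln (cmod z)) < ereal s" using b z by simp
    then show "u z < ereal (s * ln (cmod z))"
      using l by (cases "u z") (auto simp: field_simps)
  qed simp
qed

text \<open>A negative type would send u to -\<infinity> at infinity. The maximum principle on large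
  discs would then give u \<le> -n everywhere for all n, but u is not identically
  -\<infinity>.\<close>

lemma log_type_nonneg:
  assumes u: "subharmonic u"
  shows "0 \<le> log_type u"
proof (rule ccontr)
  assume "\<not> 0 \<le> log_type u"
  then have "log_type u < 0" by simp
  then obtain s where s: "log_type u < ereal s" "ereal s < 0"
    using ereal_dense2 by blast
  then have s0: "s < 0" by simp
  obtain b where b: "b > 1" "\<And>z. cmod z \<ge> b \<Longrightarrow> u z < ereal (s * ln (cmod z))"
    using eventually_less_of_log_type[OF s(1)] by metis
  have "u z \<le> ereal (- real n)" for z n
  proof -
    define Q where "Q = max (max b (cmod z)) (exp (real n / (- s)))"
    have Q: "Q \<ge> b" "Q \<ge> cmod z" "Q \<ge> exp (real n / (- s))" "Q > 0" using b by (auto simp: Q_def)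
    have "real n / (- s) \<le> ln Q" using Q by (subst ln_ge_iff) auto
    then have lnQ: "s * ln Q \<le> - real n" using s0 by (simp add: field_simps)
    have "trunc u n z \<le> - real n"
    proof (rule real_subharmonic_max_principle[OF real_subharmonic_trunc[OF u], of "cball 0 Q" "ball 0 Q" "\<lambda>_. - real n"])
      fix w :: complex assume "w \<in> cball 0 Q - ball 0 Q"
      then have w: "cmod w = Q" by auto
      then have "u w \<le> ereal (s * ln Q)" using b(2)[of w] Q by simp
      also have "\<dots> \<le> ereal (- real n)" using lnQ by simp
      finally show "trunc u n w \<le> - real n" by (simp add: trunc_le_iff[OF u])
    qed (use Q in auto)
    then show ?thesis by (simp add: trunc_le_iff[OF u])
  qed
  note le = this
  have "u z = - \<infinity>" for z
  proof (cases "u z")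
    case (real x)
    obtain n :: nat where "- x < real n" using reals_Archimedean2 by blast
    then show ?thesis using le[of z n] real by simp
  next
    case PInf
    then show ?thesis using subharmonic_neq_PInf[OF u] by simp
  qed simp
  then show False using subharmonic_nontrivial[OF u] by blast
qed

lemma annulus_max_principle:
  assumes v: "real_subharmonic v" and Q: "Q > 1"
    and 1: "\<And>z. cmod z = 1 \<Longrightarrow> v z \<le> C" and 2: "\<And>z. cmod z = Q \<Longrightarrow> v z \<le> C + s * ln Q"
    and z: "1 \<le> cmod z" "cmod z \<le> Q"
  shows "v z \<le> C + s * ln (cmod z)"
proof -
  let ?D = "cball (0::complex) Q - ball 0 1" and ?O = "ball (0::complex) Q - cball 0 1"
  have "v z \<le> C + s * ln (cmod (z - 0))"
  proof (rule real_subharmonic_max_principle[OF v, of ?D ?O])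
    show "compact ?D" by (intro compact_diff) auto
    show "open ?O" by (intro open_Diff) auto
    show "continuous_on ?D (\<lambda>z. C + s * ln (cmod (z - 0)))" by (intro continuous_intros) auto
    show "mean_prop (\<lambda>z. C + s * ln (cmod (z - 0))) w" if "w \<in> ?O" for w
      using that by (intro mean_prop_add mean_prop_const mean_prop_cmult mean_prop_ln) auto
    fix w :: complex assume "w \<in> ?D - ?O"
    then have "cmod w = 1 \<or> cmod w = Q" by auto
    then show "v w \<le> C + s * ln (cmod (w - 0))" using 1[of w] 2[of w] by auto
  qed (use z in auto)
  then show ?thesis by simp
qed

text \<open>For every \<tau> > 0 the maximum principle on annuli gives the slope \<sigma> + \<tau>
  with a constant C taken from the unit disc. As C does not depend on \<tau>, the limit \<tau> -> 0
  is allowed.\<close>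

lemma growth_bound:
  assumes u: "subharmonic u" and \<sigma>: "log_type u = ereal \<sigma>"
  obtains C where "C \<ge> 0" "\<And>z. trunc u 0 z \<le> \<sigma> * ln (max 1 (cmod z)) + C"
proof -
  have \<sigma>0: "\<sigma> \<ge> 0" using log_type_nonneg[OF u] \<sigma> by simp
  obtain C1 where C1: "\<And>z. z \<in> cball 0 1 \<Longrightarrow> trunc u 0 z \<le> C1"
    using usc_bounded_above[OF usc_trunc[OF u], of "cball 0 1"] by auto
  define C where "C = max 0 C1"
  show thesis
  proof (rule that[of C])
    show "C \<ge> 0" by (simp add: C_def)
    fix z
    show "trunc u 0 z \<le> \<sigma> * ln (max 1 (cmod z)) + C"
    proof (cases "cmod z \<le> 1")
      case True
      then have "trunc u 0 z \<le> C" using C1[of z] by (simp add: C_def)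
      then show ?thesis using True by (simp add: max_absorb1)
    next
      case False
      have l: "ln (cmod z) > 0" using False by (intro ln_gt_zero) auto
      have "trunc u 0 z \<le> \<sigma> * ln (cmod z) + C"
      proof (rule field_le_epsilon)
        fix e :: real assume e: "e > 0"
        define \<tau> where "\<tau> = e / ln (cmod z)"
        have \<tau>: "\<tau> > 0" using e l by (simp add: \<tau>_def)
        obtain b where b: "b > 1" "\<And>z. cmod z \<ge> b \<Longrightarrow> u z < ereal ((\<sigma> + \<tau>) * ln (cmod z))"
          using eventually_less_of_log_type[of u "\<sigma> + \<tau>"] \<sigma> \<tau> by auto
        define Q where "Q = max b (cmod z)"
        have Q: "Q > 1" "Q \<ge> b" "Q \<ge> cmod z" using b by (auto simp: Q_def)
        have "trunc u 0 z \<le> C + (\<sigma> + \<tau>) * ln (cmod z)"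
        proof (rule annulus_max_principle[OF real_subharmonic_trunc[OF u] Q(1)])
          show "trunc u 0 w \<le> C" if "cmod w = 1" for w using C1[of w] that by (simp add: C_def)
          show "trunc u 0 w \<le> C + (\<sigma> + \<tau>) * ln Q" if "cmod w = Q" for w
          proof -
            have nn: "0 \<le> (\<sigma> + \<tau>) * ln Q" using \<sigma>0 \<tau> Q by auto
            have "u w \<le> ereal ((\<sigma> + \<tau>) * ln Q)" using b(2)[of w] that Q by (simp add: less_imp_le)
            then have "trunc u 0 w \<le> (\<sigma> + \<tau>) * ln Q" using nn by (simp add: trunc_le_iff[OF u])
            then show ?thesis by (simp add: C_def)
          qed
        qed (use False Q in auto)
        moreover have "\<tau> * ln (cmod z) = e" using l by (simp add: \<tau>_def)
        ultimately show "trunc u 0 z \<le> \<sigma> * ln (cmod z) + C + e" by (simp add: algebra_simps)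
      qed
      then show ?thesis using False by (simp add: max_absorb2)
    qed
  qed
qed

text \<open>The limsup supplies only scattered points p with large u p. If a larger circle stayed
  below the slope \<sigma> - d, the annulus principle would force u p to be too small; hence one p
  serves all circles of radius r \<ge> |p|.\<close>

lemma growth_attained:
  assumes u: "subharmonic u" and \<sigma>: "log_type u = ereal \<sigma>" "\<sigma> > 0" and \<epsilon>: "\<epsilon> > 0"
  shows "\<exists>R0. \<forall>n. \<forall>r\<ge>R0. \<exists>z. cmod z = r \<and> (\<sigma> - \<epsilon>) * ln r \<le> trunc u n z"
proof -
  \<comment> \<open>\<sigma> - d > 0 makes the values found positive, where all truncations agree
    with u; so the radius does not depend on n.\<close>
  define d where "d = min \<epsilon> (\<sigma> / 2)"
  have d: "0 < d" "d \<le> \<epsilon>" "d < \<sigma>" using \<epsilon> \<sigma> by (auto simp: d_def min_def)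
  obtain C where C: "C \<ge> 0" "\<And>z. trunc u 0 z \<le> \<sigma> * ln (max 1 (cmod z)) + C"
    using growth_bound[OF u \<sigma>(1)] by metis
  \<comment> \<open>Guarantees (d / 2) ln |p| > C, which contradicts the annulus estimate at
    p.\<close>
  define b where "b = exp (2 * C / d + 1)"
  have "\<not> eventually (\<lambda>z. u z / ereal (ln (cmod z)) \<le> ereal (\<sigma> - d / 2)) at_infinity"
  proof
    assume "eventually (\<lambda>z. u z / ereal (ln (cmod z)) \<le> ereal (\<sigma> - d / 2)) at_infinity"
    then have "log_type u \<le> ereal (\<sigma> - d / 2)" unfolding log_type_def by (rule Limsup_bounded)
    then show False using \<sigma> d by simp
  qed
  then obtain p where p: "b \<le> cmod p" "\<not> u p / ereal (ln (cmod p)) \<le> ereal (\<sigma> - d / 2)"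
    unfolding eventually_at_infinity by blast
  have b1: "b > 1" using C d by (simp add: b_def add_nonneg_pos)
  have lnp: "2 * C / d + 1 \<le> ln (cmod p)" using p b1 by (subst ln_ge_iff) (auto simp: b_def)
  have l: "0 < ln (cmod p)" using p b1 by (intro ln_gt_zero) auto
  have up: "ereal ((\<sigma> - d / 2) * ln (cmod p)) < u p"
    using p(2) l subharmonic_neq_PInf[OF u, of p] by (cases "u p") (auto simp: field_simps)
  have up0: "(\<sigma> - d / 2) * ln (cmod p) < trunc u 0 p"
    using less_le_trans[OF up le_trunc[OF u, of p 0]] by simp
  show ?thesis
  proof (intro exI[of _ "cmod p"] allI impI)
    fix n and r :: real assume r: "cmod p \<le> r"
    have r1: "r > 1" using r p b1 by simp
    obtain z where z: "cmod z = r" "(\<sigma> - d) * ln r \<le> trunc u 0 z"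
    proof (cases "\<exists>z. cmod z = r \<and> (\<sigma> - d) * ln r \<le> trunc u 0 z")
      case False
      then have F: "trunc u 0 z < (\<sigma> - d) * ln r" if "cmod z = r" for z using that by force
      have "trunc u 0 p \<le> C + (\<sigma> - d) * ln (cmod p)"
      proof (rule annulus_max_principle[OF real_subharmonic_trunc[OF u] r1])
        show "trunc u 0 w \<le> C" if "cmod w = 1" for w using C(2)[of w] that by simp
        show "trunc u 0 w \<le> C + (\<sigma> - d) * ln r" if "cmod w = r" for w
          using F[OF that] C(1) by linarith
      qed (use p b1 r in auto)
      then have "d / 2 * ln (cmod p) < C" using up0 by (simp add: algebra_simps)
      moreover have "d / 2 * (2 * C / d + 1) \<le> d / 2 * ln (cmod p)"
        using lnp d by (intro mult_left_mono) auto
      moreover have "d / 2 * (2 * C / d + 1) = C + d / 2" using d by (simp add: field_simps)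
      ultimately show thesis using d by linarith
    qed blast
    have pos: "0 < (\<sigma> - d) * ln r" using d r1 by simp
    then have "0 < trunc u 0 z" using z by linarith
    then have "ereal (trunc u 0 z) = u z" using ereal_trunc[OF u, of 0 z] by (auto simp: max_def split: if_splits)
    then have "trunc u 0 z \<le> trunc u n z" using le_trunc[OF u, of z n] by (metis ereal_less_eq(3))
    moreover have "(\<sigma> - \<epsilon>) * ln r \<le> (\<sigma> - d) * ln r" using d r1 by (intro mult_right_mono) auto
    ultimately show "\<exists>z. cmod z = r \<and> (\<sigma> - \<epsilon>) * ln r \<le> trunc u n z" using z by (intro exI[of _ z]) auto
  qed
qed

section \<open>Integrability exponents\<close>

lemma eexp_infinity [simp]: "eexp \<infinity> = \<infinity>" "eexp (- \<infinity>) = 0"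
  using eexp.simps(2,3) by simp_all

lemma eexp_mono: "x \<le> y \<Longrightarrow> eexp x \<le> eexp y"
  by (cases x; cases y) (auto intro: ennreal_leI)

lemma eexp_square: "(eexp (ereal x))\<^sup>2 = ennreal (exp (2 * x))"
  by (simp add: ennreal_power exp_double)

lemma pos_part_eq_trunc: "subharmonic u \<Longrightarrow> pos_part u z = ereal (trunc u 0 z)"
  using ereal_trunc[of u 0 z] by (simp add: pos_part_def zero_ereal_def)

lemma exps_L2_subset_pos_part: "exps_L2 u \<subseteq> exps_L2 (pos_part u)"
proof
  fix c assume "c \<in> exps_L2 u"
  then obtain K where c: "c > 0" and K: "compact K" "(\<integral>\<^sup>+z. indicator (UNIV - K) z * (eexp (- ereal c * u z))\<^sup>2 \<partial>lborel) < \<infinity>"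
    by (auto simp: exps_L2_def L2_infty_def)
  have "(\<integral>\<^sup>+z. indicator (UNIV - K) z * (eexp (- ereal c * pos_part u z))\<^sup>2 \<partial>lborel) \<le>
      (\<integral>\<^sup>+z. indicator (UNIV - K) z * (eexp (- ereal c * u z))\<^sup>2 \<partial>lborel)"
  proof (intro nn_integral_mono mult_left_mono power_mono eexp_mono)
    fix z
    have "u z \<le> pos_part u z" by (simp add: pos_part_def)
    then have "ereal c * u z \<le> ereal c * pos_part u z" using c by (intro ereal_mult_left_mono) auto
    then show "- ereal c * pos_part u z \<le> - ereal c * u z" by (simp only: ereal_mult_minus_left ereal_minus_le_minus)
  qed auto
  then show "c \<in> exps_L2 (pos_part u)"
    using c K le_less_trans by (auto simp: exps_L2_def L2_infty_def)
qed

lemma exps_L2_pos_part_lower: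
  assumes u: "subharmonic u" and \<sigma>: "log_type u = ereal \<sigma>" and c: "c \<in> exps_L2 (pos_part u)"
  shows "1 < c * \<sigma>"
proof (rule ccontr)
  assume neg: "\<not> 1 < c * \<sigma>"
  obtain K where c0: "c > 0" and K: "compact K" "(\<integral>\<^sup>+z. indicator (UNIV - K) z * (eexp (- ereal c * pos_part u z))\<^sup>2 \<partial>lborel) < \<infinity>"
    using c by (auto simp: exps_L2_def L2_infty_def)
  obtain C where C: "C \<ge> 0" "\<And>z. trunc u 0 z \<le> \<sigma> * ln (max 1 (cmod z)) + C"
    using growth_bound[OF u \<sigma>] by metis
  obtain b0 where b0: "\<And>z. z \<in> K \<Longrightarrow> cmod z \<le> b0"
    using compact_imp_bounded[OF K(1)] by (auto simp: bounded_iff)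
  define b where "b = max 1 (b0 + 1)"
  have b: "b \<ge> 1" "b > b0" by (auto simp: b_def)
  have "ennreal (exp (- 2 * c * C)) * \<infinity> = 
      (\<integral>\<^sup>+z. ennreal (exp (- 2 * c * C)) * (indicator {z. b \<le> cmod z} z * ennreal (1 / (cmod z)\<^sup>2)) \<partial>lborel)"
    using nn_integral_outside_inverse_square[of b] b by (subst nn_integral_cmult) auto
  also have "\<dots> \<le> (\<integral>\<^sup>+z. indicator (UNIV - K) z * (eexp (- ereal c * pos_part u z))\<^sup>2 \<partial>lborel)"
  proof (intro nn_integral_mono)
    fix z
    show "ennreal (exp (- 2 * c * C)) * (indicator {z. b \<le> cmod z} z * ennreal (1 / (cmod z)\<^sup>2)) \<le> indicator (UNIV - K) z * (eexp (- ereal c * pos_part u z))\<^sup>2"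
    proof (cases "b \<le> cmod z")
      case True
      then have z1: "cmod z \<ge> 1" "z \<notin> K" using b b0[of z] by auto
      define l where "l = ln (cmod z)"
      have l: "0 \<le> l" using z1 by (simp add: l_def)
      have "exp (2 * l) = (cmod z)\<^sup>2" using less_le_trans[OF zero_less_one z1(1)] by (simp add: l_def exp_double)
      then have "1 / (cmod z)\<^sup>2 = exp (- 2 * l)" by (simp add: exp_minus inverse_eq_divide)
      then have "exp (- 2 * c * C) * (1 / (cmod z)\<^sup>2) = exp (- 2 * c * C - 2 * l)"
        by (simp add: exp_add[symmetric])
      also have "\<dots> \<le> exp (2 * (- c * trunc u 0 z))"
      proof -
        have "c * trunc u 0 z \<le> c * (\<sigma> * l + C)"
          using C(2)[of z] z1 c0 by (intro mult_left_mono) (auto simp: l_def max_absorb2)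
        moreover have "(c * \<sigma>) * l \<le> 1 * l" using neg l by (intro mult_right_mono) auto
        ultimately show ?thesis by (simp add: algebra_simps)
      qed
      finally have "ennreal (exp (- 2 * c * C) * (1 / (cmod z)\<^sup>2)) \<le> ennreal (exp (2 * (- c * trunc u 0 z)))" by (rule ennreal_leI)
      moreover have "(eexp (- ereal c * pos_part u z))\<^sup>2 = ennreal (exp (2 * (- c * trunc u 0 z)))"
        unfolding pos_part_eq_trunc[OF u] by (simp only: uminus_ereal.simps times_ereal.simps eexp_square)
      ultimately show ?thesis using True z1 by (simp add: ennreal_mult[symmetric])
    qed simp
  qed
  finally show False using K(2) by (simp add: ennreal_mult_top)
qed

text \<open>Lets monotone convergence carry uniform bounds from the truncations to u, including the
  points where u is -\<infinity> and both sides are infinite.\<close>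

lemma eexp_square_trunc_SUP:
  assumes u: "subharmonic u" and c: "c > 0"
  shows "(eexp (- ereal c * u z))\<^sup>2 = (SUP n. ennreal (exp (- 2 * c * trunc u n z)))"
proof (cases "u z")
  case (real x)
  have tr: "trunc u n z \<ge> x" for n using le_trunc[OF u, of z n] real by simp
  obtain n0 :: nat where n0: "- x \<le> real n0" using real_arch_simple by blast
  have t0: "trunc u n0 z = x"
  proof -
    have "ereal (trunc u n0 z) = ereal x" unfolding ereal_trunc[OF u] real using n0 by (simp add: max_def)
    then show ?thesis by simp
  qed
  have "(eexp (- ereal c * u z))\<^sup>2 = ennreal (exp (2 * (- c * x)))"
    unfolding real by (simp only: uminus_ereal.simps times_ereal.simps eexp_square)
  also have "\<dots> = (SUP n. ennreal (exp (- 2 * c * trunc u n z)))"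
  proof (rule antisym)
    show "ennreal (exp (2 * (- c * x))) \<le> (SUP n. ennreal (exp (- 2 * c * trunc u n z)))"
      by (rule SUP_upper2[of n0]) (auto simp: t0)
    show "(SUP n. ennreal (exp (- 2 * c * trunc u n z))) \<le> ennreal (exp (2 * (- c * x)))"
      using tr c by (intro SUP_least ennreal_leI) auto
  qed
  finally show ?thesis .
next
  case PInf
  then show ?thesis using subharmonic_neq_PInf[OF u] by simp
next
  case MInf
  have t: "trunc u n z = - real n" for n
  proof -
    have "ereal (trunc u n z) = ereal (- real n)" unfolding ereal_trunc[OF u] MInf by (simp add: max_def)
    then show ?thesis by simp
  qed
  have "(SUP n. ennreal (exp (- 2 * c * trunc u n z))) = top"
  proof (rule ccontr)
    assume "(SUP n. ennreal (exp (- 2 * c * trunc u n z))) \<noteq> top"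
    then obtain m :: nat where m: "(SUP n. ennreal (exp (- 2 * c * trunc u n z))) < of_nat m"
      using ennreal_Ex_less_of_nat less_top by blast
    obtain n :: nat where n: "real m / (2 * c) \<le> real n" using real_arch_simple by blast
    have "real m \<le> 2 * c * real n" using n c by (simp add: field_simps)
    also have "\<dots> \<le> exp (2 * c * real n)" using exp_ge_add_one_self[of "2 * c * real n"] by linarith
    finally have "ennreal (real m) \<le> ennreal (exp (- 2 * c * trunc u n z))" by (intro ennreal_leI) (simp add: t)
    also have "\<dots> \<le> (SUP n. ennreal (exp (- 2 * c * trunc u n z)))" by (rule SUP_upper) simp
    finally show False using m by (simp add: ennreal_of_nat_eq_real_of_nat)
  qed
  moreover have "eexp (- ereal c * u z) = top" using c MInf by simp
  ultimately show ?thesis by (simp only: power2_eq_square) simp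
qed

lemma exps_L2_upper:
  assumes u: "subharmonic u" and \<sigma>: "log_type u = ereal \<sigma>" and c: "c > 0" "c * \<sigma> > 1"
  shows "c \<in> exps_L2 u"
proof -
  have \<sigma>0: "\<sigma> > 0" using c by (intro zero_less_mult_pos[of c \<sigma>]) auto
  obtain C where C: "C \<ge> 0" "\<And>z. trunc u 0 z \<le> \<sigma> * ln (max 1 (cmod z)) + C"
    using growth_bound[OF u \<sigma>] by metis
  obtain p where "u p \<noteq> - \<infinity>" using subharmonic_nontrivial[OF u] by blast
  \<comment> \<open>Every truncation is at least x at this point p, which gives a lower bound
    independent of n.\<close>
  then obtain x where x: "u p = ereal x" using subharmonic_neq_PInf[OF u, of p] by (cases "u p") auto
  have "\<exists>R I. \<forall>v\<in>range (trunc u). (\<integral>\<^sup>+z. indicator {z. R \<le> cmod z} z * ennreal (exp (- 2 * c * v z)) \<partial>lborel) \<le> ennreal I"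
  proof (rule nn_integral_outside_le[OF c C(1), where ?C0.0="\<bar>x\<bar>" and p=p])
    show "0 \<le> \<bar>x\<bar>" by simp
    fix v assume "v \<in> range (trunc u)"
    then obtain n where n: "v = trunc u n" by auto
    show "real_subharmonic v" unfolding n by (rule real_subharmonic_trunc[OF u])
    show "v z \<le> \<sigma> * ln (max 1 (cmod z)) + C" for z
      unfolding n using trunc_antimono[OF u, of 0 n z] C(2)[of z] by simp
    show "- \<bar>x\<bar> \<le> v p" unfolding n using le_trunc[OF u, of p n] x by simp
  next
    fix \<epsilon> :: real assume "\<epsilon> > 0"
    then show "\<exists>R0. \<forall>v\<in>range (trunc u). \<forall>r\<ge>R0. \<exists>z. cmod z = r \<and> (\<sigma> - \<epsilon>) * ln r \<le> v z"
      using growth_attained[OF u \<sigma> \<sigma>0] by blast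
  qed
  then obtain R I where RI: "\<And>n. (\<integral>\<^sup>+z. indicator {z. R \<le> cmod z} z * ennreal (exp (- 2 * c * trunc u n z)) \<partial>lborel) \<le> ennreal I"
    by blast
  note [measurable] = real_subharmonic_borel[OF real_subharmonic_trunc[OF u]]
  have "(\<integral>\<^sup>+z. indicator (UNIV - cball 0 R) z * (eexp (- ereal c * u z))\<^sup>2 \<partial>lborel) \<le>
      (\<integral>\<^sup>+z. indicator {z. R \<le> cmod z} z * (SUP n. ennreal (exp (- 2 * c * trunc u n z))) \<partial>lborel)"
    unfolding eexp_square_trunc_SUP[OF u c(1)]
    by (intro nn_integral_mono mult_right_mono) (auto simp: indicator_def)
  also have "\<dots> = (\<integral>\<^sup>+z. (SUP n. indicator {z. R \<le> cmod z} z * ennreal (exp (- 2 * c * trunc u n z))) \<partial>lborel)"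
    by (simp add: SUP_mult_left_ennreal)
  also have "\<dots> = (SUP n. \<integral>\<^sup>+z. indicator {z. R \<le> cmod z} z * ennreal (exp (- 2 * c * trunc u n z)) \<partial>lborel)"
  proof (rule nn_integral_monotone_convergence_SUP)
    show "incseq (\<lambda>n z. indicator {z. R \<le> cmod z} z * ennreal (exp (- 2 * c * trunc u n z)))"
      using c(1) trunc_antimono[OF u]
      by (auto simp: mono_def le_fun_def intro!: mult_left_mono ennreal_leI)
  qed measurable
  also have "\<dots> \<le> ennreal I" by (intro SUP_least RI)
  finally have "(\<integral>\<^sup>+z. indicator (UNIV - cball 0 R) z * (eexp (- ereal c * u z))\<^sup>2 \<partial>lborel) < \<infinity>"
    by (rule le_less_trans) simp
  then show ?thesis using c(1) unfolding exps_L2_def L2_infty_def by (auto intro!: exI[of _ "cball 0 R"])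
qed

theorem theorem4p1:
  fixes u :: "complex \<Rightarrow> ereal"
  assumes "u \<in> LPSH"
  shows "c_infty u = 1 / log_type u \<and> c_infty_hat u = 1 / log_type u \<and>
         ((\<nexists>k. \<forall>z. u z = k) \<longrightarrow>
           exps_L2 u = exps_L2 (pos_part u) \<and>
           exps_L2 (pos_part u) = {c. ereal c > 1 / log_type u})"
proof -
  have u: "subharmonic u" and fin: "log_type u < \<infinity>" using assms by (auto simp: LPSH_def)
  obtain \<sigma> where \<sigma>: "log_type u = ereal \<sigma>" "\<sigma> \<ge> 0"
    using log_type_nonneg[OF u] fin by (cases "log_type u") auto
  \<comment> \<open>For \<sigma> = 0 both sides are false, since 1 / 0 = \<infinity> in
    \<open>ereal\<close>.\<close>
  have gt: "ereal c > 1 / log_type u \<longleftrightarrow> c > 0 \<and> c * \<sigma> > 1" for c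
  proof (cases "\<sigma> = 0")
    case False
    then have "\<sigma> > 0" using \<sigma> by simp
    then have "1 / log_type u < ereal c \<longleftrightarrow> 1 / \<sigma> < c" by (simp add: \<sigma>(1) one_ereal_def)
    also have "\<dots> \<longleftrightarrow> c * \<sigma> > 1" using \<open>\<sigma> > 0\<close> by (simp add: field_simps)
    also have "\<dots> \<longleftrightarrow> c > 0 \<and> c * \<sigma> > 1" using \<open>\<sigma> > 0\<close> by (auto intro: zero_less_mult_pos2 less_trans[OF zero_less_one])
    finally show ?thesis .
  qed (simp add: \<sigma> divide_ereal_def)
  have pos: "c > 0" if "c \<in> exps_L2 (pos_part u)" for c using that by (simp add: exps_L2_def)
  \<comment> \<open>The inclusions close a cycle: \<open>exps_L2 (pos_part u)\<close> lies in the
    set where c \<sigma> > 1, this lies in \<open>exps_L2 u\<close>, and that again in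
    \<open>exps_L2 (pos_part u)\<close>.\<close>
  have E2: "exps_L2 (pos_part u) = {c. ereal c > 1 / log_type u}"
    using exps_L2_pos_part_lower[OF u \<sigma>(1)] exps_L2_upper[OF u \<sigma>(1)] exps_L2_subset_pos_part[of u] pos
    unfolding gt by blast
  have E1: "exps_L2 u = {c. ereal c > 1 / log_type u}"
    using exps_L2_upper[OF u \<sigma>(1)] exps_L2_subset_pos_part[of u] unfolding E2 gt by blast
  \<comment> \<open>The argument by order density also covers 1 / \<sigma> = \<infinity>, where the
    set is empty and its infimum is \<infinity>.\<close>
  have inf: "Inf (ereal ` {c. ereal c > 1 / log_type u}) = 1 / log_type u"
  proof (rule antisym)
    show "1 / log_type u \<le> Inf (ereal ` {c. ereal c > 1 / log_type u})"
      by (rule Inf_greatest) auto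
    show "Inf (ereal ` {c. ereal c > 1 / log_type u}) \<le> 1 / log_type u"
    proof (rule dense_ge)
      fix x assume "1 / log_type u < x"
      then obtain c where "1 / log_type u < ereal c" "ereal c < x" using ereal_dense2 by blast
      then show "Inf (ereal ` {c. ereal c > 1 / log_type u}) \<le> x"
        by (intro Inf_lower2[of "ereal c"]) auto
    qed
  qed
  show ?thesis unfolding c_infty_hat_def c_infty_def E1 E2 inf by simp
qed

end
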